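(* Let $n\ge 1$. A function $q\colon (\mathbb{C}^{+})^{n}\to\mathbb{C}$ is a Herglotz-Nevanlinna function (in $n$ variables) if and only if $q$ can be written as $$q(\vec z)=a+\sum_{\ell=1}^n b_\ell z_\ell+\frac{1}{\pi^n}\int_{\mathbb{R}^n}K_n(\vec z,\vec t)\,d\mu(\vec t),\qquad \vec z\in(\mathbb{C}^+)^n,$$ where $a\in\mathbb{R}$, $\vec b=(b_1,\dots,b_n)\in[0,\infty)^n$, and $\mu$ is a positive Borel measure on $\mathbb{R}^n$ satisfying both $$\int_{\mathbb{R}^n}\prod_{\ell=1}^n\frac{1}{1+t_\ell^2}\,d\mu(\vec t)<\infty$$ and $$\sum_{\substack{\vec\rho\in\{-1,0,1\}^n\\ -1\in\vec\rho\ \wedge\ 1\in\vec\rho}}\int_{\mathbb{R}^n}N_{\rho_1,1}N_{\rho_2,2}\cdots N_{\rho_n,n}\,d\mu(\vec t)=0\qquad\text{for all }\vec z\in(\mathbb{C}^+)^n.$$ Furthermore, the parameters $a$, $\vec b$ and $\mu$ are unique for a given function $q$.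
   Context: $\mathbb{C}^+=\{z\in\mathbb{C}: \mathrm{Im}\,z>0\}$ and $i$ is the imaginary unit. A Herglotz-Nevanlinna function in $n$ variables is a holomorphic function $q\colon(\mathbb{C}^+)^n\to\mathbb{C}$ with $\mathrm{Im}\,q\ge 0$ everywhere. The kernel is $$K_n(\vec z,\vec t):=i\left(\frac{2}{(2i)^n}\prod_{\ell=1}^n\left(\frac{1}{t_\ell-z_\ell}-\frac{1}{t_\ell+i}\right)-\frac{1}{(2i)^n}\prod_{\ell=1}^n\left(\frac{1}{t_\ell-i}-\frac{1}{t_\ell+i}\right)\right),\quad \vec z\in(\mathbb{C}^+)^n,\ \vec t\in\mathbb{R}^n.$$ For $j\in\{1,\dots,n\}$ (depending on $z_j$ and $t_j$) $$N_{-1,j}:=\frac{1}{t_j-z_j}-\frac{1}{t_j-i},\quad N_{0,j}:=\frac{1}{t_j-i}-\frac{1}{t_j+i},\quad N_{1,j}:=\frac{1}{t_j+i}-\frac{1}{t_j-\overline{z_j}}.$$ The notation "$-1\in\vec\rho\wedge 1\in\vec\rho$" means that the vector $\vec\rho$ has at least one entry equal to $-1$ and at least one entry equal to $1$; for $n=1$ the sum is empty and the last condition on $\mu$ is void. *)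

theory Defs
  imports "HOL-Analysis.Analysis"
begin

text \<open>
  The number of variables is \<open>n = CARD('n)\<close>; all indices range over the finite nonempty type \<open>'n\<close>.
\<close>

definition upper_half_plane :: "complex set" where
  "upper_half_plane = {z. Im z > 0}"

definition poly_upper_half_plane :: "(complex ^ 'n) set" where
  "poly_upper_half_plane = {z. \<forall>j. z $ j \<in> upper_half_plane}"

text \<open>
  Holomorphy in several variables on an open set: Frechet differentiability at every point with a
  complex-linear derivative (\<open>D $ j\<close> is the j-th complex partial derivative).
\<close>

definition holomorphic_several_on :: "(complex ^ 'n \<Rightarrow> complex) \<Rightarrow> (complex ^ 'n) set \<Rightarrow> bool" where
  "holomorphic_several_on f S \<longleftrightarrow>
     (\<forall>z\<in>S. \<exists>D :: complex ^ 'n. (f has_derivative (\<lambda>h. \<Sum>j\<in>UNIV. D $ j * h $ j)) (at z))"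

definition herglotz_nevanlinna :: "(complex ^ 'n \<Rightarrow> complex) \<Rightarrow> bool" where
  "herglotz_nevanlinna q \<longleftrightarrow>
     holomorphic_several_on q poly_upper_half_plane \<and>
     (\<forall>z\<in>poly_upper_half_plane. Im (q z) \<ge> 0)"

definition kernel_K :: "complex ^ 'n \<Rightarrow> real ^ 'n \<Rightarrow> complex" where
  "kernel_K z t =
     \<i> * (2 / (2 * \<i>) ^ CARD('n) *
             (\<Prod>l\<in>UNIV. 1 / (of_real (t $ l) - z $ l) - 1 / (of_real (t $ l) + \<i>))
          - 1 / (2 * \<i>) ^ CARD('n) *
             (\<Prod>l\<in>UNIV. 1 / (of_real (t $ l) - \<i>) - 1 / (of_real (t $ l) + \<i>)))"

text \<open>
  The j-th factor \<open>N\<^bsub>r,j\<^esub>\<close> is \<open>N_factor r (z $ j) (t $ j)\<close>; only \<open>r \<in> {-1, 0, 1}\<close> is meaningful.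
\<close>

definition N_factor :: "int \<Rightarrow> complex \<Rightarrow> real \<Rightarrow> complex" where
  "N_factor r z t =
     (if r = -1 then 1 / (of_real t - z) - 1 / (of_real t - \<i>)
      else if r = 0 then 1 / (of_real t - \<i>) - 1 / (of_real t + \<i>)
      else 1 / (of_real t + \<i>) - 1 / (of_real t - cnj z))"

definition mixed_indices :: "(int ^ 'n) set" where
  "mixed_indices =
     {\<rho>. (\<forall>j. \<rho> $ j \<in> {-1, 0, 1}) \<and> (\<exists>j. \<rho> $ j = -1) \<and> (\<exists>j. \<rho> $ j = 1)}"

lemma finite_mixed_indices: "finite (mixed_indices :: (int ^ 'n) set)"
proof -
  have "finite (vec_nth ` (mixed_indices :: (int ^ 'n) set))"
    by (rule finite_subset[OF _ finite_PiE[of UNIV "\<lambda>_. {-1, 0, 1 :: int}"]])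
       (auto simp: mixed_indices_def)
  then show ?thesis
    by (rule finite_imageD) (simp add: inj_on_def vec_nth_inject)
qed

definition growth_condition :: "(real ^ 'n) measure \<Rightarrow> bool" where
  "growth_condition \<mu> \<longleftrightarrow>
     (\<integral>\<^sup>+ t. ennreal (\<Prod>l\<in>UNIV. 1 / (1 + (t $ l)\<^sup>2)) \<partial>\<mu>) < \<infinity>"

text \<open>
  For Borel measures satisfying \<open>growth_condition\<close> the integrands below and the kernel are absolutely
  integrable, since each factor is \<open>O(1 / (1 + t\<^sup>2))\<close>; so the Bochner integrals are the genuine ones.
\<close>

definition nevanlinna_condition :: "(real ^ 'n) measure \<Rightarrow> bool" where
  "nevanlinna_condition \<mu> \<longleftrightarrow>
     (\<forall>z\<in>poly_upper_half_plane.
        (\<Sum>\<rho>\<in>mixed_indices. \<integral>t. (\<Prod>j\<in>UNIV. N_factor (\<rho> $ j) (z $ j) (t $ j)) \<partial>\<mu>) = 0)"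

definition represents ::
    "(complex ^ 'n \<Rightarrow> complex) \<Rightarrow> real \<Rightarrow> real ^ 'n \<Rightarrow> (real ^ 'n) measure \<Rightarrow> bool" where
  "represents q a b \<mu> \<longleftrightarrow>
     (\<forall>l. b $ l \<ge> 0) \<and>
     sets \<mu> = sets borel \<and>
     growth_condition \<mu> \<and>
     nevanlinna_condition \<mu> \<and>
     (\<forall>z\<in>poly_upper_half_plane.
        q z = of_real a + (\<Sum>l\<in>UNIV. of_real (b $ l) * z $ l)
              + 1 / of_real pi ^ CARD('n) * (\<integral>t. kernel_K z t \<partial>\<mu>))"

end

theory Submission
  imports Defs "HOL-Complex_Analysis.Complex_Analysis" "HOL-Probability.Probability"
begin

text \<open>
  The Cayley transform \<open>z \<mapsto> (z - \<i>) / (z + \<i>)\<close> in each coordinate turns half-planes into discs and the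
  real line into the unit circle without the point 1. Once the weight \<open>\<Prod> 1 / (1 + t\<^sub>l\<^sup>2)\<close> is moved into
  the measure, \<open>K\<^sub>n\<close> becomes \<open>\<i> (2 \<Prod> \<omega>\<^sub>l / (\<omega>\<^sub>l - \<zeta>\<^sub>l) - 1)\<close>, and the three factors \<open>N\<close> become, up to
  one common constant, \<open>E = \<zeta> / (\<omega> - \<zeta>)\<close>, 1 and the conjugate of \<open>E\<close>. The theorem thus concerns finite
  measures on the torus for which moments of mixed type cancel.

  A represented function is Herglotz-Nevanlinna: expand the product of the Poisson kernels
  \<open>1 + E + cnj E\<close>. The terms without the factor \<open>cnj E\<close> add up to \<open>\<Prod> (1 + E)\<close>, those without \<open>E\<close> to its
  conjugate, the constant 1 is counted twice, and the rest is the mixed sum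
  (\<open>prod_three_terms_eq_mixed_sum\<close>). So the real part of the kernel is the Poisson product minus the
  mixed sum, and under the condition on \<open>\<mu>\<close> the imaginary part of \<open>q\<close> is \<open>\<Sum> b\<^sub>l Im z\<^sub>l\<close> plus the
  Poisson integral of \<open>\<mu>\<close> (\<open>Im_of_represents\<close>). From this formula the parameters can be read off:
  \<open>a = Re q(\<i>,...,\<i>)\<close>, \<open>b\<^sub>l\<close> is the growth along the imaginary axis of the \<open>l\<close>-th variable, and the
  Poisson integral determines \<open>\<mu>\<close> on boxes, one coordinate at a time.

  For the existence of the representation let \<open>f = - \<i> q\<close> in disc coordinates, so \<open>Re f \<ge> 0\<close>, and let
  \<open>h(\<xi>) = f(r \<xi>)\<close> with \<open>r < 1\<close>. On the torus a factor \<open>cnj E\<close> annihilates \<open>h\<close> and a factor \<open>E\<close> annihilates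
  the conjugate of \<open>h\<close>; hence every single mixed moment of the density \<open>Re h\<close> vanishes
  (\<open>mixed_moment_Re_eq_0\<close>), while Cauchy's formula gives \<open>h\<close> as the integral of the kernel against
  \<open>Re h\<close> (\<open>herglotz_integral_Re\<close>). The densities have the common mass \<open>Re f(0)\<close>, and a weak limit as
  \<open>r \<rightarrow> 1\<close> keeps both properties. The limit is taken on the real line by Helly's theorem, after lifting
  the torus along a space-filling curve (\<open>torus_measures_weakly_compact\<close>).

  The limit may charge the faces \<open>\<omega>\<^sub>l = 1\<close>, the points at infinity. As \<open>r \<rightarrow> 1\<close>, the functions
  \<open>(1 - r) E(r, \<omega>\<^sub>l)\<close> converge boundedly to the indicator of the face, so mixed moments also vanish on a
  face once the factor of the coordinate \<open>l\<close> is taken out. It follows that two faces meet in a null set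
  and that on a face only the constant part of the remaining product survives
  (\<open>face_cauchy_integral\<close>). A face therefore contributes exactly \<open>b\<^sub>l z\<^sub>l\<close>, where \<open>b\<^sub>l\<close> is its mass,
  and the measure off the faces is transported to \<open>\<mu>\<close>.
\<close>

section \<open>Splitting a product over mixed indices\<close>

lemma sum_int_vec_eq_sum_fun:
  fixes f :: "('n::finite \<Rightarrow> int) \<Rightarrow> 'c::comm_monoid_add"
  shows "(\<Sum>\<rho>\<in>{\<rho>. \<forall>j. \<rho> $ j \<in> S}. f (vec_nth \<rho>)) = (\<Sum>g\<in>PiE UNIV (\<lambda>_. S). f g)"
  by (rule sum.reindex_bij_witness[where i = vec_lambda and j = vec_nth])
    (auto simp: PiE_def Pi_def)

lemma prod_sum_int_vec:
  fixes X :: "int \<Rightarrow> 'n::finite \<Rightarrow> 'c::comm_semiring_1"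
  assumes "finite S"
  shows "(\<Sum>\<rho>\<in>{\<rho>. \<forall>j. \<rho> $ j \<in> S}. \<Prod>j\<in>UNIV. X (\<rho> $ j) j) = (\<Prod>j\<in>UNIV. \<Sum>r\<in>S. X r j)"
proof -
  have "(\<Sum>\<rho>\<in>{\<rho>. \<forall>j. \<rho> $ j \<in> S}. \<Prod>j\<in>UNIV. X (\<rho> $ j) j)
      = (\<Sum>g\<in>PiE UNIV (\<lambda>_::'n. S). \<Prod>j\<in>UNIV. X (g j) j)"
    by (rule sum_int_vec_eq_sum_fun[where f = "\<lambda>g. \<Prod>j\<in>UNIV. X (g j) j"])
  also have "\<dots> = (\<Prod>j\<in>UNIV. \<Sum>r\<in>S. X r j)"
    using assms by (subst prod_sum_PiE) auto
  finally show ?thesis .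
qed

lemma finite_int_vec: "finite S \<Longrightarrow> finite {\<rho> :: int ^ 'n. \<forall>j. \<rho> $ j \<in> S}"
  by (rule finite_subset[OF _ finite_imageI[OF finite_PiE[of UNIV "\<lambda>_. S"], of vec_lambda]])
     (auto simp: image_iff PiE_def Pi_def intro!: exI[of _ "vec_nth _"] bexI[of _ "vec_nth _"])

text \<open>
  The product expands over all index vectors with entries \<open>-1, 0, 1\<close>. A vector that is not mixed omits
  \<open>1\<close> or omits \<open>-1\<close>; the two groups sum to the two products on the right and share the zero vector only.
\<close>

lemma prod_three_terms_eq_mixed_sum:
  fixes X :: "int \<Rightarrow> 'n::finite \<Rightarrow> 'c::comm_ring_1"
  shows "(\<Prod>j\<in>UNIV. X (-1) j + X 0 j + X 1 j)
       = (\<Sum>\<rho>\<in>mixed_indices. \<Prod>j\<in>UNIV. X (\<rho> $ j) j)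
         + (\<Prod>j\<in>UNIV. X (-1) j + X 0 j) + (\<Prod>j\<in>UNIV. X 0 j + X 1 j) - (\<Prod>j\<in>UNIV. X 0 j)"
proof -
  define V where "V S = {\<rho> :: int ^ 'n. \<forall>j. \<rho> $ j \<in> S}" for S
  define F where "F \<rho> = (\<Prod>j\<in>UNIV. X (\<rho> $ j) j)" for \<rho> :: "int ^ 'n"
  have fin [simp]: "finite (V S)" if "finite S" for S
    unfolding V_def using finite_int_vec[OF that] .
  have sumV: "sum F (V S) = (\<Prod>j\<in>UNIV. \<Sum>r\<in>S. X r j)" if "finite S" for S
    unfolding V_def F_def by (rule prod_sum_int_vec[OF that])
  have int: "V {-1,0} \<inter> V {0,1} = V {0}"
    unfolding V_def[of "{-1,0}"] V_def[of "{0,1}"] V_def[of "{0}"] Collect_conj_eq[symmetric] all_conj_distrib[symmetric]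
    by (intro Collect_cong all_cong1) auto
  have "V {-1,0,1} = mixed_indices \<union> (V {-1,0} \<union> V {0,1})"
    unfolding V_def mixed_indices_def by auto
  moreover have "\<rho> \<notin> V {-1,0} \<union> V {0,1}" if mixed: "\<rho> \<in> mixed_indices" for \<rho>
  proof -
    obtain i j where "\<rho> $ i = -1" "\<rho> $ j = 1"
      using mixed by (auto simp: mixed_indices_def)
    then have "\<rho> $ i \<notin> {0,1}" "\<rho> $ j \<notin> {-1,0}" by auto
    then show ?thesis unfolding V_def by blast
  qed
  then have "mixed_indices \<inter> (V {-1,0} \<union> V {0,1}) = {}"
    by blast
  ultimately have "sum F (V {-1,0,1}) = sum F mixed_indices + sum F (V {-1,0} \<union> V {0,1})"
    by (simp add: sum.union_disjoint finite_mixed_indices)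
  also have "sum F (V {-1,0} \<union> V {0,1}) = sum F (V {-1,0}) + sum F (V {0,1}) - sum F (V {0})"
    by (simp add: sum_Un int)
  finally show ?thesis
    by (simp add: sumV) (simp add: F_def algebra_simps)
qed

section \<open>Cayley transform and the kernels on the disc\<close>

definition cayley :: "complex \<Rightarrow> complex" where
  "cayley z = (z - \<i>) / (z + \<i>)"

definition inv_cayley :: "complex \<Rightarrow> complex" where
  "inv_cayley \<zeta> = \<i> * (1 + \<zeta>) / (1 - \<zeta>)"

text \<open>
  The Cauchy kernel \<open>\<omega> / (\<omega> - \<zeta>)\<close> without its constant term: on the unit circle it is
  \<open>\<Sum>\<^sub>k\<^sub>\<ge>\<^sub>1 (\<zeta> cnj \<omega>)\<^sup>k\<close>.
\<close>

definition cauchy_tail :: "complex \<Rightarrow> complex \<Rightarrow> complex" where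
  "cauchy_tail \<zeta> \<omega> = \<zeta> / (\<omega> - \<zeta>)"

text \<open>
  The image of the factors \<open>N\<^sub>r\<close> under the Cayley transform, with the same convention for \<open>r\<close>.
\<close>

definition disc_factor :: "int \<Rightarrow> complex \<Rightarrow> complex \<Rightarrow> complex" where
  "disc_factor r \<zeta> \<omega> = (if r = -1 then cauchy_tail \<zeta> \<omega> else if r = 0 then 1 else cnj (cauchy_tail \<zeta> \<omega>))"

lemma disc_factor_simps [simp]:
  "disc_factor (-1) \<zeta> \<omega> = cauchy_tail \<zeta> \<omega>" "disc_factor 0 \<zeta> \<omega> = 1"
  "disc_factor 1 \<zeta> \<omega> = cnj (cauchy_tail \<zeta> \<omega>)"
  by (simp_all add: disc_factor_def)

lemma of_real_plus_minus_i [simp]: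
  "complex_of_real t + \<i> \<noteq> 0" "complex_of_real t - \<i> \<noteq> 0"
  by (auto simp: complex_eq_iff)

lemma upper_half_planeD:
  assumes "z \<in> upper_half_plane"
  shows "z + \<i> \<noteq> 0" "complex_of_real t - z \<noteq> 0" "complex_of_real t - cnj z \<noteq> 0"
  using assms by (auto simp: upper_half_plane_def complex_eq_iff)

lemma norm_cayley_lt_1: "z \<in> upper_half_plane \<Longrightarrow> norm (cayley z) < 1"
proof -
  assume z: "z \<in> upper_half_plane"
  have "(norm (z - \<i>))\<^sup>2 < (norm (z + \<i>))\<^sup>2"
    using z unfolding cmod_power2 upper_half_plane_def by (simp add: power2_eq_square algebra_simps)
  then have "norm (z - \<i>) < norm (z + \<i>)"
    by (rule power2_less_imp_less) simp
  then show ?thesis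
    using upper_half_planeD(1)[OF z] by (simp add: cayley_def norm_divide)
qed

lemma norm_cayley_of_real [simp]: "norm (cayley (of_real t)) = 1"
proof -
  have "norm (complex_of_real t - \<i>) = norm (complex_of_real t + \<i>)"
    by (simp add: cmod_def)
  then show ?thesis by (simp add: cayley_def norm_divide)
qed

lemma cayley_inv_cayley: "\<zeta> \<noteq> 1 \<Longrightarrow> cayley (inv_cayley \<zeta>) = \<zeta>"
proof -
  assume "\<zeta> \<noteq> 1"
  then have *: "1 - \<zeta> \<noteq> 0" by auto
  have "inv_cayley \<zeta> - \<i> = 2 * \<i> * \<zeta> / (1 - \<zeta>)" "inv_cayley \<zeta> + \<i> = 2 * \<i> / (1 - \<zeta>)"
    using * by (auto simp: inv_cayley_def field_simps)
  then show ?thesis using * by (simp add: cayley_def)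
qed

lemma inv_cayley_cayley: "z + \<i> \<noteq> 0 \<Longrightarrow> inv_cayley (cayley z) = z"
proof -
  assume *: "z + \<i> \<noteq> 0"
  have "1 + cayley z = 2 * z / (z + \<i>)" "1 - cayley z = 2 * \<i> / (z + \<i>)"
    using * by (auto simp: cayley_def field_simps)
  then show ?thesis using * by (simp add: inv_cayley_def)
qed

lemma Im_inv_cayley:
  "Im (inv_cayley \<zeta>) = (1 - (norm \<zeta>)\<^sup>2) / (norm (1 - \<zeta>))\<^sup>2"
  unfolding inv_cayley_def Im_divide cmod_power2
  by (simp add: power2_eq_square algebra_simps)

lemma inv_cayley_upper_half_plane: "norm \<zeta> < 1 \<Longrightarrow> inv_cayley \<zeta> \<in> upper_half_plane"
proof -
  assume a: "norm \<zeta> < 1"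
  then have "1 - \<zeta> \<noteq> 0" by auto
  moreover have "(norm \<zeta>)\<^sup>2 < 1" using a by (simp add: power_less_one_iff)
  ultimately show ?thesis by (simp add: upper_half_plane_def Im_inv_cayley)
qed

lemma inv_cayley_unit_circle:
  assumes "norm \<omega> = 1" "\<omega> \<noteq> 1"
  shows "inv_cayley \<omega> = of_real (Re (inv_cayley \<omega>))"
  using assms by (simp add: complex_eq_iff Im_inv_cayley)

lemma norm_cauchy_tail_le:
  assumes "norm \<omega> = 1" "norm \<zeta> \<le> \<rho>" "\<rho> < 1"
  shows "norm (cauchy_tail \<zeta> \<omega>) \<le> 1 / (1 - \<rho>)"
proof -
  have "1 - \<rho> \<le> norm (\<omega> - \<zeta>)" using norm_triangle_ineq2[of \<omega> \<zeta>] assms by linarith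
  then show ?thesis
    unfolding cauchy_tail_def norm_divide using assms by (intro frac_le) auto
qed

lemma norm_disc_factor_le:
  assumes "norm \<omega> = 1" "norm \<zeta> < 1"
  shows "norm (disc_factor r \<zeta> \<omega>) \<le> 1 / (1 - norm \<zeta>)"
  using norm_cauchy_tail_le[OF assms(1) order_refl assms(2)] assms
  by (auto simp: disc_factor_def field_simps)

lemma one_plus_cauchy_tail:
  "\<omega> - \<zeta> \<noteq> 0 \<Longrightarrow> 1 + cauchy_tail \<zeta> \<omega> = \<omega> / (\<omega> - \<zeta>)"
  by (simp add: cauchy_tail_def field_simps)

lemma norm_one_plus_cauchy_tail_le:
  assumes "norm \<omega> = 1" "norm \<zeta> \<le> \<rho>" "\<rho> < 1"
  shows "norm (1 + cauchy_tail \<zeta> \<omega>) \<le> 1 / (1 - \<rho>)"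
proof -
  have nz: "\<omega> - \<zeta> \<noteq> 0" using assms by auto
  have "1 - \<rho> \<le> norm (\<omega> - \<zeta>)" using norm_triangle_ineq2[of \<omega> \<zeta>] assms by linarith
  then show ?thesis
    unfolding one_plus_cauchy_tail[OF nz] norm_divide using assms by (intro frac_le) auto
qed

text \<open>
  All three factors share the constant \<open>2 \<i> / (1 + t\<^sup>2)\<close>. For \<open>r = -1\<close> this is a computation with
  \<open>\<omega> - \<zeta> = 2 \<i> (t - z) / ((t + \<i>) (z + \<i>))\<close>; the factor for \<open>r = 1\<close> is minus the conjugate of the one for \<open>r = -1\<close>.
\<close>

lemma N_factor_eq_disc_factor:
  assumes z: "z \<in> upper_half_plane" and r: "r \<in> {-1,0,1}"
  shows "N_factor r z t = 2 * \<i> / of_real (1 + t\<^sup>2) * disc_factor r (cayley z) (cayley (of_real t))"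
proof -
  have t: "complex_of_real (1 + t\<^sup>2) = (of_real t - \<i>) * (of_real t + \<i>)"
    by (simp add: algebra_simps power2_eq_square)
  note nz = upper_half_planeD(1)[OF z] upper_half_planeD(2,3)[OF z, of t] of_real_plus_minus_i[of t]
  have tail: "cauchy_tail (cayley z) (cayley (of_real t)) = (z - \<i>) * (of_real t + \<i>) / (2 * \<i> * (of_real t - z))"
  proof -
    have "cayley (of_real t) - cayley z = 2 * \<i> * (of_real t - z) / ((of_real t + \<i>) * (z + \<i>))"
      using nz by (simp add: cayley_def divide_simps) (simp add: algebra_simps)
    then show ?thesis using nz by (simp add: cauchy_tail_def cayley_def)
  qed
  have m: "N_factor (-1) z t = 2 * \<i> / of_real (1 + t\<^sup>2) * cauchy_tail (cayley z) (cayley (of_real t))"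
    unfolding tail t N_factor_def using nz by (simp add: divide_simps)
  have "N_factor 1 z t = - cnj (N_factor (-1) z t)"
    by (simp add: N_factor_def)
  also have "\<dots> = 2 * \<i> / of_real (1 + t\<^sup>2) * disc_factor 1 (cayley z) (cayley (of_real t))"
    unfolding m by simp
  finally have p: "N_factor 1 z t = 2 * \<i> / of_real (1 + t\<^sup>2) * disc_factor 1 (cayley z) (cayley (of_real t))" .
  have "N_factor 0 z t = 2 * \<i> / of_real (1 + t\<^sup>2)"
    unfolding N_factor_def t using nz by (simp add: divide_simps)
  then show ?thesis using r m p by auto
qed

lemma N_factor_sum_minus_zero:
  "N_factor (-1) z t + N_factor 0 z t = 1 / (of_real t - z) - 1 / (of_real t + \<i>)"
  by (simp add: N_factor_def)

text \<open>
  The density of the finite measure that corresponds to \<open>\<mu>\<close> on the torus.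
\<close>

definition weight :: "real ^ 'n \<Rightarrow> real" where
  "weight t = (\<Prod>l\<in>UNIV. 1 / (1 + (t $ l)\<^sup>2))"

text \<open>
  The analogue on the polydisc of the one-variable Herglotz kernel \<open>(\<omega> + \<zeta>) / (\<omega> - \<zeta>)\<close>.
\<close>

definition herglotz_kernel :: "('n::finite \<Rightarrow> complex) \<Rightarrow> ('n \<Rightarrow> complex) \<Rightarrow> complex" where
  "herglotz_kernel \<zeta> \<omega> = 2 * (\<Prod>l\<in>UNIV. 1 + cauchy_tail (\<zeta> l) (\<omega> l)) - 1"

lemma prod_scaled_factor:
  fixes f g :: "'n::finite \<Rightarrow> complex" and t :: "real ^ 'n"
  assumes "\<And>l. f l = 2 * \<i> / of_real (1 + (t $ l)\<^sup>2) * g l"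
  shows "prod f UNIV = (2 * \<i>) ^ CARD('n) * of_real (weight t) * prod g UNIV"
  unfolding assms weight_def
  by (simp add: prod.distrib prod_dividef)

lemma prod_N_factor_eq:
  fixes z :: "complex ^ 'n" and \<rho> :: "int ^ 'n"
  assumes "z \<in> poly_upper_half_plane" "\<And>j. \<rho> $ j \<in> {-1,0,1}"
  shows "(\<Prod>j\<in>UNIV. N_factor (\<rho> $ j) (z $ j) (t $ j)) = (2 * \<i>) ^ CARD('n) * of_real (weight t) *
    (\<Prod>j\<in>UNIV. disc_factor (\<rho> $ j) (cayley (z $ j)) (cayley (of_real (t $ j))))"
  using assms by (intro prod_scaled_factor) (auto simp: poly_upper_half_plane_def N_factor_eq_disc_factor)

lemma kernel_K_eq_herglotz_kernel:
  fixes z :: "complex ^ 'n"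
  assumes z: "z \<in> poly_upper_half_plane"
  shows "kernel_K z t = \<i> * of_real (weight t) * herglotz_kernel (\<lambda>l. cayley (z $ l)) (\<lambda>l. cayley (of_real (t $ l)))"
proof -
  have z': "z $ l \<in> upper_half_plane" for l using z by (simp add: poly_upper_half_plane_def)
  have 1: "(\<Prod>l\<in>UNIV. 1 / (of_real (t $ l) - z $ l) - 1 / (of_real (t $ l) + \<i>)) =
    (2 * \<i>) ^ CARD('n) * of_real (weight t) * (\<Prod>l\<in>UNIV. 1 + cauchy_tail (cayley (z $ l)) (cayley (of_real (t $ l))))"
    unfolding N_factor_sum_minus_zero[symmetric]
    by (rule prod_scaled_factor) (simp add: N_factor_eq_disc_factor[OF z'] algebra_simps add_divide_distrib)
  have 2: "(\<Prod>l\<in>UNIV. 1 / (of_real (t $ l) - \<i>) - 1 / (of_real (t $ l) + \<i>)) =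
    (2 * \<i>) ^ CARD('n) * of_real (weight t) * (\<Prod>l\<in>(UNIV::'n set). 1)"
    by (rule prod_scaled_factor) (use N_factor_eq_disc_factor[OF z', of 0] in \<open>simp add: N_factor_def\<close>)
  show ?thesis
    unfolding kernel_K_def 1 2 herglotz_kernel_def by (simp add: algebra_simps)
qed

lemma weight_pos: "weight t > 0"
  unfolding weight_def by (intro prod_pos) (auto intro: add_pos_nonneg)

lemma weight_measurable [measurable]: "weight \<in> borel_measurable borel"
  unfolding weight_def by measurable

lemma Re_one_plus_two_cauchy_tail:
  assumes "norm \<omega> = 1" "norm \<zeta> < 1"
  shows "Re (1 + 2 * cauchy_tail \<zeta> \<omega>) = (1 - (norm \<zeta>)\<^sup>2) / (norm (\<omega> - \<zeta>))\<^sup>2"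
proof -
  have nz: "\<omega> - \<zeta> \<noteq> 0" using assms by auto
  have *: "1 + 2 * cauchy_tail \<zeta> \<omega> = (\<omega> + \<zeta>) / (\<omega> - \<zeta>)"
    using nz by (simp add: cauchy_tail_def field_simps)
  have "(Re \<omega>)\<^sup>2 + (Im \<omega>)\<^sup>2 = 1" using assms(1) by (metis cmod_power2 one_power2)
  then show ?thesis
    unfolding * Re_divide cmod_power2 by (simp add: power2_eq_square algebra_simps)
qed

text \<open>
  The nonnegative Poisson product and the real part of the holomorphic kernel differ by the mixed terms.
  In one variable there are none, and the two agree.
\<close>

lemma Re_herglotz_kernel:
  fixes \<zeta> :: "'n::finite \<Rightarrow> complex"
  shows "of_real (Re (herglotz_kernel \<zeta> \<omega>)) = complex_of_real (\<Prod>l\<in>UNIV. Re (1 + 2 * cauchy_tail (\<zeta> l) (\<omega> l)))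
     - (\<Sum>\<rho>\<in>mixed_indices. \<Prod>j\<in>UNIV. disc_factor (\<rho> $ j) (\<zeta> j) (\<omega> j))"
proof -
  define A where "A = (\<Prod>l\<in>UNIV. 1 + cauchy_tail (\<zeta> l) (\<omega> l))"
  have "of_real (Re (herglotz_kernel \<zeta> \<omega>)) = A + cnj A - 1"
    unfolding herglotz_kernel_def A_def[symmetric] complex_add_cnj by simp
  moreover have "complex_of_real (\<Prod>l\<in>UNIV. Re (1 + 2 * cauchy_tail (\<zeta> l) (\<omega> l)))
    = (\<Prod>l\<in>UNIV. disc_factor (-1) (\<zeta> l) (\<omega> l) + disc_factor 0 (\<zeta> l) (\<omega> l) + disc_factor 1 (\<zeta> l) (\<omega> l))"
    unfolding of_real_prod by (intro prod.cong) (auto simp: complex_eq_iff)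
  moreover have "cnj A = (\<Prod>l\<in>UNIV. disc_factor 0 (\<zeta> l) (\<omega> l) + disc_factor 1 (\<zeta> l) (\<omega> l))"
    unfolding A_def by simp
  moreover have "A = (\<Prod>l\<in>UNIV. disc_factor (-1) (\<zeta> l) (\<omega> l) + disc_factor 0 (\<zeta> l) (\<omega> l))"
    unfolding A_def by (simp add: add.commute)
  ultimately show ?thesis
    unfolding prod_three_terms_eq_mixed_sum[of "\<lambda>r l. disc_factor r (\<zeta> l) (\<omega> l)"] by simp
qed

section \<open>Finite measures on the torus\<close>

text \<open>
  Dividing all factors by \<open>C\<close> reduces the estimate to the case of factors bounded by 1.
\<close>

lemma norm_prod_diff_le:
  fixes f g :: "'i \<Rightarrow> complex"
  assumes "finite I" "C \<ge> 1" "\<And>i. i \<in> I \<Longrightarrow> norm (f i) \<le> C" "\<And>i. i \<in> I \<Longrightarrow> norm (g i) \<le> C"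
  shows "norm (prod f I - prod g I) \<le> C ^ card I * (\<Sum>i\<in>I. norm (f i - g i))"
proof -
  define c where "c = complex_of_real C"
  have c: "c \<noteq> 0" "norm c = C" using assms(2) by (auto simp: c_def)
  have "prod f I - prod g I = c ^ card I * ((\<Prod>i\<in>I. f i / c) - (\<Prod>i\<in>I. g i / c))"
    using c by (simp add: prod_dividef algebra_simps)
  also have "norm \<dots> = C ^ card I * norm ((\<Prod>i\<in>I. f i / c) - (\<Prod>i\<in>I. g i / c))"
    using c by (simp add: norm_mult norm_power)
  also have "\<dots> \<le> C ^ card I * (\<Sum>i\<in>I. norm (f i / c - g i / c))"
    using assms c by (intro mult_left_mono norm_prod_diff) (auto simp: norm_divide)
  also have "\<dots> \<le> C ^ card I * (\<Sum>i\<in>I. norm (f i - g i))"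
  proof (intro mult_left_mono sum_mono)
    fix i
    have "norm (f i / c - g i / c) = norm (f i - g i) / C"
      using c by (metis diff_divide_distrib norm_divide)
    also have "\<dots> \<le> norm (f i - g i)"
      using assms(2) mult_left_mono[of 1 C "norm (f i - g i)"] by (simp add: divide_le_eq)
    finally show "norm (f i / c - g i / c) \<le> norm (f i - g i)" .
  qed (use assms in auto)
  finally show ?thesis .
qed

text \<open>
  Differentiation under the integral sign. The Lipschitz bound on the factors passes to their product, so
  the difference quotients are uniformly bounded, and dominated convergence applies along each sequence
  tending to the point.
\<close>

lemma (in finite_measure) has_derivative_integral_prod:
  fixes \<kappa> :: "'n::finite \<Rightarrow> complex \<Rightarrow> 'a \<Rightarrow> complex" and z0 :: "complex ^ 'n"
  assumes deriv: "\<And>l x. x \<in> space M \<Longrightarrow> ((\<lambda>u. \<kappa> l u x) has_field_derivative \<kappa>' l x) (at (z0 $ l))"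
    and [measurable]: "\<And>l u. \<kappa> l u \<in> borel_measurable M" "\<And>l. \<kappa>' l \<in> borel_measurable M"
    and C: "C \<ge> 1" and L: "L \<ge> 0"
    and bound': "\<And>l x. x \<in> space M \<Longrightarrow> norm (\<kappa>' l x) \<le> L"
    and bound: "\<forall>\<^sub>F z in nhds z0. \<forall>l. \<forall>x\<in>space M. norm (\<kappa> l (z $ l) x) \<le> C \<and>
          norm (\<kappa> l (z $ l) x - \<kappa> l (z0 $ l) x) \<le> L * norm (z $ l - z0 $ l)"
  shows "((\<lambda>z. \<integral>x. (\<Prod>l\<in>UNIV. \<kappa> l (z $ l) x) \<partial>M) has_derivative
     (\<lambda>h. \<Sum>j\<in>UNIV. (\<integral>x. \<kappa>' j x * (\<Prod>l\<in>UNIV - {j}. \<kappa> l (z0 $ l) x) \<partial>M) * h $ j)) (at z0)"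
proof -
  define G where "G z x = (\<Prod>l\<in>UNIV. \<kappa> l (z $ l) x)" for z :: "complex ^ 'n" and x
  define d where "d j x = \<kappa>' j x * (\<Prod>l\<in>UNIV - {j}. \<kappa> l (z0 $ l) x)" for j x
  define D where "D h x = (\<Sum>j\<in>UNIV. d j x * h $ j)" for h :: "complex ^ 'n" and x
  have [measurable]: "G z \<in> borel_measurable M" "d j \<in> borel_measurable M" "D h \<in> borel_measurable M" for z j h
    unfolding G_def d_def D_def by measurable
  have at_z0: "norm (\<kappa> l (z0 $ l) x) \<le> C" if "x \<in> space M" for l x
    using eventually_nhds_x_imp_x[OF bound] that by auto
  have d_bound: "norm (d j x) \<le> L * C ^ CARD('n)" if x: "x \<in> space M" for j x
  proof -
    have "norm (\<Prod>l\<in>UNIV - {j}. \<kappa> l (z0 $ l) x) \<le> C ^ card (UNIV - {j})"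
      unfolding prod_norm[symmetric] using at_z0[OF x] by (intro prod_le_power) (use C in auto)
    also have "\<dots> \<le> C ^ CARD('n)" using C by (intro power_increasing card_mono) auto
    finally show ?thesis unfolding d_def norm_mult using bound'[OF x] L by (intro mult_mono) auto
  qed
  have d_int: "integrable M (d j)" for j
    by (rule integrable_const_bound[of _ "L * C ^ CARD('n)"]) (auto intro: d_bound)
  have D_int: "integrable M (D h)" for h unfolding D_def by (intro Bochner_Integration.integrable_sum integrable_mult_left d_int)
  have D_bound: "norm (D h x) \<le> CARD('n) * (L * C ^ CARD('n)) * norm h" if x: "x \<in> space M" for h x
  proof -
    have "norm (D h x) \<le> (\<Sum>j\<in>(UNIV::'n set). L * C ^ CARD('n) * norm h)"
      unfolding D_def by (intro sum_norm_le)
        (auto simp: norm_mult intro!: mult_mono d_bound x Finite_Cartesian_Product.norm_nth_le L mult_nonneg_nonneg zero_le_power order_trans[OF zero_le_one C])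
    then show ?thesis by simp
  qed
  have G_bound: "\<forall>\<^sub>F z in nhds z0. \<forall>x\<in>space M. norm (G z x) \<le> C ^ CARD('n) \<and>
      norm (G z x - G z0 x) \<le> CARD('n) * (L * C ^ CARD('n)) * norm (z - z0)"
    using bound
  proof eventually_elim
    case (elim z)
    show ?case
    proof (intro ballI conjI)
      fix x assume x: "x \<in> space M"
      show "norm (G z x) \<le> C ^ CARD('n)"
        unfolding G_def prod_norm[symmetric] using elim x by (intro prod_le_power) (use C in auto)
      have "norm (G z x - G z0 x) \<le> C ^ CARD('n) * (\<Sum>l\<in>UNIV. norm (\<kappa> l (z $ l) x - \<kappa> l (z0 $ l) x))"
        unfolding G_def using elim x at_z0 by (intro norm_prod_diff_le C) auto
      also have "\<dots> \<le> C ^ CARD('n) * (\<Sum>l\<in>(UNIV::'n set). L * norm (z - z0))"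
      proof (intro mult_left_mono sum_mono)
        fix l
        have "norm (\<kappa> l (z $ l) x - \<kappa> l (z0 $ l) x) \<le> L * norm (z $ l - z0 $ l)"
          using elim x by blast
        also have "\<dots> \<le> L * norm (z - z0)"
          using Finite_Cartesian_Product.norm_nth_le[of "z - z0" l] L by (intro mult_left_mono) auto
        finally show "norm (\<kappa> l (z $ l) x - \<kappa> l (z0 $ l) x) \<le> L * norm (z - z0)" .
      qed (use C in auto)
      finally show "norm (G z x - G z0 x) \<le> CARD('n) * (L * C ^ CARD('n)) * norm (z - z0)"
        by (simp add: algebra_simps)
    qed
  qed
  have G_deriv: "((\<lambda>z. G z x) has_derivative (\<lambda>h. D h x)) (at z0)" if x: "x \<in> space M" for x
  proof -
    have *: "((\<lambda>z. \<kappa> l (z $ l) x) has_derivative (\<lambda>h. \<kappa>' l x * h $ l)) (at z0)" for l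
      using has_derivative_compose[OF bounded_linear_imp_has_derivative[OF bounded_linear_vec_nth[of l], of "at z0"],
          OF deriv[OF x, of l, unfolded has_field_derivative_def]] by simp
    show ?thesis
      unfolding G_def D_def d_def
      by (rule has_derivative_eq_rhs[OF has_derivative_prod[OF *]]) (auto simp: mult_ac)
  qed
  have "((\<lambda>z. \<integral>x. G z x \<partial>M) has_derivative (\<lambda>h. \<integral>x. D h x \<partial>M)) (at z0)"
    unfolding has_derivative_at
  proof (intro conjI)
    have eq: "(\<lambda>h. \<integral>x. D h x \<partial>M) = (\<lambda>h. \<Sum>j\<in>UNIV. (\<integral>x. d j x \<partial>M) * h $ j)"
      unfolding D_def by (auto simp: d_int)
    show "bounded_linear (\<lambda>h. \<integral>x. D h x \<partial>M)"
      unfolding eq by (intro bounded_linear_sum bounded_linear_const_mult bounded_linear_vec_nth)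
    show "((\<lambda>h. norm ((\<integral>x. G (z0 + h) x \<partial>M) - (\<integral>x. G z0 x \<partial>M) - (\<integral>x. D h x \<partial>M)) / norm h) \<longlongrightarrow> 0) (at 0)"
      unfolding tendsto_at_iff_sequentially comp_def
    proof (intro allI impI)
      fix X :: "nat \<Rightarrow> complex ^ 'n"
      assume X: "\<forall>i. X i \<in> UNIV - {0}" "X \<longlonglongrightarrow> 0"
      have "(\<lambda>i. z0 + X i) \<longlonglongrightarrow> z0 + 0" by (intro tendsto_intros X)
      then have "filterlim (\<lambda>i. z0 + X i) (nhds z0) sequentially" by simp
      from eventually_compose_filterlim[OF G_bound this]
      obtain N where N: "\<And>i x. i \<ge> N \<Longrightarrow> x \<in> space M \<Longrightarrow> norm (G (z0 + X i) x) \<le> C ^ CARD('n) \<and>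
          norm (G (z0 + X i) x - G z0 x) \<le> CARD('n) * (L * C ^ CARD('n)) * norm (X i)"
        unfolding eventually_sequentially by auto
      define R where "R i x = (G (z0 + X i) x - G z0 x - D (X i) x) / of_real (norm (X i))" for i x
      have [measurable]: "R i \<in> borel_measurable M" for i unfolding R_def by measurable
      have G0: "integrable M (G z0)"
        using eventually_nhds_x_imp_x[OF G_bound]
        by (intro integrable_const_bound[of _ "C ^ CARD('n)"]) auto
      have Gi: "integrable M (G (z0 + X i))" if "i \<ge> N" for i
        by (intro integrable_const_bound[of _ "C ^ CARD('n)"]) (use N[OF that] in auto)
      have "(\<lambda>i. \<integral>x. R (i + N) x \<partial>M) \<longlonglongrightarrow> (\<integral>x. 0 \<partial>M)"
      proof (rule integral_dominated_convergence[where w = "\<lambda>_. 2 * (CARD('n) * (L * C ^ CARD('n)))"])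
        show "AE x in M. (\<lambda>i. R (i + N) x) \<longlonglongrightarrow> 0"
        proof (rule AE_I2)
          fix x assume x: "x \<in> space M"
          have "((\<lambda>h. norm (G (z0 + h) x - G z0 x - D h x) / norm h) \<longlongrightarrow> 0) (at 0)"
            using G_deriv[OF x] unfolding has_derivative_at by simp
          then have "(\<lambda>i. norm (G (z0 + X i) x - G z0 x - D (X i) x) / norm (X i)) \<longlonglongrightarrow> 0"
            unfolding tendsto_at_iff_sequentially comp_def using X by blast
          then have "(\<lambda>i. norm (R i x)) \<longlonglongrightarrow> 0" by (simp add: R_def norm_divide)
          then show "(\<lambda>i. R (i + N) x) \<longlonglongrightarrow> 0"
            by (intro LIMSEQ_ignore_initial_segment) (simp add: tendsto_norm_zero_iff)
        qed
        show "AE x in M. norm (R (i + N) x) \<le> 2 * (CARD('n) * (L * C ^ CARD('n)))" for i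
        proof (rule AE_I2)
          fix x assume x: "x \<in> space M"
          have "norm (G (z0 + X (i + N)) x - G z0 x - D (X (i + N)) x)
             \<le> 2 * (CARD('n) * (L * C ^ CARD('n))) * norm (X (i + N))"
            using N[of "i + N" x] D_bound[OF x, of "X (i + N)"] x
            by (intro order_trans[OF norm_triangle_ineq4]) (auto simp: algebra_simps)
          moreover have "X (i + N) \<noteq> 0" using X by auto
          ultimately show "norm (R (i + N) x) \<le> 2 * (CARD('n) * (L * C ^ CARD('n)))"
            unfolding R_def norm_divide by (simp add: divide_le_eq)
        qed
      qed auto
      then have "(\<lambda>i. norm (\<integral>x. R (i + N) x \<partial>M)) \<longlonglongrightarrow> 0" by (simp add: tendsto_norm_zero_iff)
      moreover have "(\<integral>x. R i x \<partial>M) = ((\<integral>x. G (z0 + X i) x \<partial>M) - (\<integral>x. G z0 x \<partial>M) - (\<integral>x. D (X i) x \<partial>M)) / of_real (norm (X i))"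
        if "i \<ge> N" for i
        unfolding R_def using Gi[OF that] G0 D_int by simp
      ultimately have "(\<lambda>i. norm ((\<integral>x. G (z0 + X (i + N)) x \<partial>M) - (\<integral>x. G z0 x \<partial>M) - (\<integral>x. D (X (i + N)) x \<partial>M)) / norm (X (i + N))) \<longlonglongrightarrow> 0"
        by (simp add: norm_divide)
      then show "(\<lambda>i. norm ((\<integral>x. G (z0 + X i) x \<partial>M) - (\<integral>x. G z0 x \<partial>M) - (\<integral>x. D (X i) x \<partial>M)) / norm (X i)) \<longlonglongrightarrow> 0"
        by (rule LIMSEQ_offset)
    qed
  qed
  then show ?thesis
    unfolding G_def D_def by (simp add: d_int flip: d_def)
qed

lemma open_poly_upper_half_plane: "open (poly_upper_half_plane :: (complex ^ 'n) set)"
proof -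
  have *: "(poly_upper_half_plane :: (complex ^ 'n) set) = (\<Inter>l. {z. 0 < Im (z $ l)})"
    by (auto simp: poly_upper_half_plane_def upper_half_plane_def)
  show ?thesis unfolding * by (intro open_INT ballI open_Collect_less continuous_intros finite)
qed

text \<open>
  A measure on the torus is carried by an arbitrary finite measure space with unimodular coordinate
  functions \<open>w l\<close>. Two spaces occur: \<open>\<real>\<^sup>n\<close> with the Cayley transforms of the coordinates, and the real
  line with a curve that fills the torus.
\<close>

locale torus_measure = finite_measure M for M :: "'a measure" +
  fixes w :: "'n::finite \<Rightarrow> 'a \<Rightarrow> complex"
  assumes w_measurable [measurable]: "\<And>l. w l \<in> borel_measurable M"
    and norm_w: "\<And>l x. x \<in> space M \<Longrightarrow> norm (w l x) = 1"
begin

lemma disc_factor_measurable [measurable]: "(\<lambda>x. disc_factor r \<zeta> (w l x)) \<in> borel_measurable M"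
proof -
  have "cnj \<in> borel_measurable borel"
    by (intro borel_measurable_continuous_onI continuous_intros)
  then show ?thesis unfolding disc_factor_def cauchy_tail_def by measurable
qed

lemma cauchy_tail_measurable [measurable]: "(\<lambda>x. cauchy_tail \<zeta> (w l x)) \<in> borel_measurable M"
  using disc_factor_measurable[of "-1"] by simp

lemma herglotz_kernel_measurable [measurable]: "(\<lambda>x. herglotz_kernel \<zeta> (\<lambda>l. w l x)) \<in> borel_measurable M"
  unfolding herglotz_kernel_def by measurable

lemma bounded_prod_disc_factor:
  assumes "\<And>j. norm (\<zeta> j) < 1" "x \<in> space M"
  shows "norm (\<Prod>j\<in>J. disc_factor (\<rho> j) (\<zeta> j) (w j x)) \<le> (\<Prod>j\<in>J. 1 / (1 - norm (\<zeta> j)))"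
  unfolding prod_norm[symmetric] using assms
  by (intro prod_mono) (auto intro!: norm_disc_factor_le norm_w)

lemma integrable_prod_disc_factor:
  assumes "\<And>j. norm (\<zeta> j) < 1"
  shows "integrable M (\<lambda>x. \<Prod>j\<in>J. disc_factor (\<rho> j) (\<zeta> j) (w j x))"
  using bounded_prod_disc_factor[OF assms]
  by (intro integrable_const_bound[of _ "\<Prod>j\<in>J. 1 / (1 - norm (\<zeta> j))"]) auto

lemma bounded_prod_cauchy:
  assumes "\<And>j. norm (\<zeta> j) < 1" "x \<in> space M"
  shows "norm (\<Prod>j\<in>J. 1 + cauchy_tail (\<zeta> j) (w j x)) \<le> (\<Prod>j\<in>J. 1 / (1 - norm (\<zeta> j)))"
  unfolding prod_norm[symmetric] using assms
  by (intro prod_mono) (auto intro!: norm_one_plus_cauchy_tail_le norm_w)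

lemma integrable_prod_cauchy:
  assumes "\<And>j. norm (\<zeta> j) < 1"
  shows "integrable M (\<lambda>x. \<Prod>j\<in>J. 1 + cauchy_tail (\<zeta> j) (w j x))"
  using bounded_prod_cauchy[OF assms]
  by (intro integrable_const_bound[of _ "\<Prod>j\<in>J. 1 / (1 - norm (\<zeta> j))"]) auto

lemma integrable_herglotz_kernel:
  assumes "\<And>j. norm (\<zeta> j) < 1"
  shows "integrable M (\<lambda>x. herglotz_kernel \<zeta> (\<lambda>l. w l x))"
  unfolding herglotz_kernel_def using integrable_prod_cauchy[OF assms] by simp

text \<open>
  Near a point of the half-plane product the Cayley transforms stay in a disc of radius \<open>\<rho> < 1\<close>, where
  the kernel and its derivative are bounded uniformly in the torus variable.
\<close>

lemma holomorphic_integral_herglotz_kernel: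
  "holomorphic_several_on (\<lambda>z. \<integral>x. herglotz_kernel (\<lambda>l. cayley (z $ l)) (\<lambda>l. w l x) \<partial>M) poly_upper_half_plane"
  unfolding holomorphic_several_on_def
proof
  fix z0 :: "complex ^ 'n" assume z0: "z0 \<in> poly_upper_half_plane"
  then have z0': "z0 $ l \<in> upper_half_plane" for l by (simp add: poly_upper_half_plane_def)
  \<comment> \<open>The radius \<open>\<rho>\<close> lies strictly between all \<open>\<bar>cayley (z0 $ l)\<bar>\<close> and 1.\<close>
  define m where "m = Max (range (\<lambda>l. norm (cayley (z0 $ l))))"
  define \<rho> where "\<rho> = (1 + m) / 2"
  have "m < 1" unfolding m_def by (auto simp: norm_cayley_lt_1 z0')
  then have \<rho>: "m < \<rho>" "\<rho> < 1" by (simp_all add: \<rho>_def field_simps)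
  have "norm (cayley (z0 $ l)) \<le> m" for l unfolding m_def by (intro Max_ge) auto
  then have \<rho>l: "norm (cayley (z0 $ l)) < \<rho>" for l using \<rho>(1) by (rule le_less_trans)
  have \<rho>0: "0 < \<rho>" using \<rho>l norm_ge_zero by (meson le_less_trans)
  define C where "C = 1 / (1 - \<rho>)"
  have C: "C \<ge> 1" using \<rho> \<rho>0 by (simp add: C_def)
  define \<kappa> where "\<kappa> l u x = 1 + cauchy_tail (cayley u) (w l x)" for l u x
  define \<kappa>' where "\<kappa>' l x = w l x / (w l x - cayley (z0 $ l))\<^sup>2 * (2 * \<i> / (z0 $ l + \<i>)\<^sup>2)" for l x
  have diff: "norm (\<kappa> l u x - \<kappa> l v x) \<le> (2 * C\<^sup>2) * norm (u - v)" and \<kappa>C: "norm (\<kappa> l u x) \<le> C"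
    if x: "x \<in> space M" and u: "u \<in> upper_half_plane" "norm (cayley u) \<le> \<rho>"
      and v: "v \<in> upper_half_plane" "norm (cayley v) \<le> \<rho>" for l u v x
  proof -
    define a where "a = w l x"
    have a: "norm a = 1" using norm_w[OF x] by (simp add: a_def)
    have n1: "norm (1 / (a - cayley u)) \<le> C" if "norm (cayley u) \<le> \<rho>" for u
    proof -
      have "1 - \<rho> \<le> norm (a - cayley u)" using norm_triangle_ineq2[of a "cayley u"] a that by linarith
      then show ?thesis unfolding C_def norm_divide using \<rho> by (intro frac_le) auto
    qed
    have nz: "a - cayley u \<noteq> 0" "a - cayley v \<noteq> 0"
      using a u v \<rho> by auto
    show "norm (\<kappa> l u x) \<le> C"
      unfolding \<kappa>_def C_def using a_def a u \<rho> by (intro norm_one_plus_cauchy_tail_le) auto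
    have eq: "\<kappa> l u x - \<kappa> l v x = a * (1 / (a - cayley u)) * (1 / (a - cayley v)) * (cayley u - cayley v)"
      unfolding \<kappa>_def a_def[symmetric] one_plus_cauchy_tail[OF nz(1)] one_plus_cauchy_tail[OF nz(2)]
      using nz by (simp add: field_simps)
    have "norm (1 / (a - cayley u)) * norm (1 / (a - cayley v)) \<le> C * C"
      using u v C by (intro mult_mono n1) auto
    then have "norm (\<kappa> l u x - \<kappa> l v x) \<le> C * C * norm (cayley u - cayley v)"
      unfolding eq norm_mult a mult_1 by (intro mult_right_mono) auto
    moreover have "norm (cayley u - cayley v) \<le> 2 * norm (u - v)"
    proof -
      have nzi: "u + \<i> \<noteq> 0" "v + \<i> \<noteq> 0" using u v upper_half_planeD by auto
      have ge1: "norm (p + \<i>) \<ge> 1" if "p \<in> upper_half_plane" for p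
        using abs_Im_le_cmod[of "p + \<i>"] that by (simp add: upper_half_plane_def)
      have "cayley u - cayley v = 2 * \<i> * (u - v) / ((u + \<i>) * (v + \<i>))"
        unfolding cayley_def using nzi by (simp add: divide_simps) (simp add: algebra_simps)
      also have "norm \<dots> = 2 * norm (u - v) / (norm (u + \<i>) * norm (v + \<i>))"
        by (simp add: norm_mult norm_divide)
      also have "\<dots> \<le> 2 * norm (u - v) / 1"
        using mult_mono[OF ge1[OF u(1)] ge1[OF v(1)]] by (intro divide_left_mono) auto
      finally show ?thesis by simp
    qed
    ultimately show "norm (\<kappa> l u x - \<kappa> l v x) \<le> (2 * C\<^sup>2) * norm (u - v)"
    proof -
      assume 1: "norm (\<kappa> l u x - \<kappa> l v x) \<le> C * C * norm (cayley u - cayley v)"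
        and "norm (cayley u - cayley v) \<le> 2 * norm (u - v)"
      then have "C * C * norm (cayley u - cayley v) \<le> C * C * (2 * norm (u - v))"
        by (intro mult_left_mono) auto
      from order_trans[OF 1 this] show ?thesis by (simp only: power2_eq_square ac_simps)
    qed
  qed
  have deriv: "((\<lambda>u. \<kappa> l u x) has_field_derivative \<kappa>' l x) (at (z0 $ l))" if x: "x \<in> space M" for l x
  proof -
    have nz: "w l x - cayley (z0 $ l) \<noteq> 0" "z0 $ l + \<i> \<noteq> 0"
      using norm_w[OF x, of l] norm_cayley_lt_1[OF z0', of l] upper_half_planeD(1)[OF z0', of l] by auto
    have 1: "(cayley has_field_derivative 2 * \<i> / (z0 $ l + \<i>)\<^sup>2) (at (z0 $ l))"
      unfolding cayley_def[abs_def] using nz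
      by (auto intro!: derivative_eq_intros simp: divide_simps power2_eq_square)
    have 2: "((\<lambda>\<zeta>. 1 + cauchy_tail \<zeta> (w l x)) has_field_derivative w l x / (w l x - cayley (z0 $ l))\<^sup>2) (at (cayley (z0 $ l)))"
      unfolding cauchy_tail_def[abs_def]
      by (rule derivative_eq_intros refl nz)+ (use nz in \<open>simp add: power2_eq_square\<close>)
    show ?thesis unfolding \<kappa>_def \<kappa>'_def by (rule DERIV_chain2[OF 2 1])
  qed
  have ev: "\<forall>\<^sub>F z in nhds z0. \<forall>l. z $ l \<in> upper_half_plane \<and> norm (cayley (z $ l)) \<le> \<rho>"
  proof (intro eventually_all_finite eventually_conj)
    fix l
    have "((\<lambda>z. Im (z $ l)) \<longlongrightarrow> Im (z0 $ l)) (nhds z0)"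
      by (intro tendsto_intros filterlim_ident)
    then show "\<forall>\<^sub>F z in nhds z0. z $ l \<in> upper_half_plane"
      using z0'[of l] unfolding upper_half_plane_def by (auto dest: order_tendstoD(1))
    have "((\<lambda>z. norm (cayley (z $ l))) \<longlongrightarrow> norm (cayley (z0 $ l))) (nhds z0)"
      unfolding cayley_def using upper_half_planeD(1)[OF z0', of l]
      by (intro tendsto_intros filterlim_ident)
    from order_tendstoD(2)[OF this \<rho>l] show "\<forall>\<^sub>F z in nhds z0. norm (cayley (z $ l)) \<le> \<rho>"
      by (rule eventually_mono) simp
  qed
  have \<kappa>'_le: "norm (\<kappa>' l x) \<le> 2 * C\<^sup>2" if x: "x \<in> space M" for l x
  proof -
    have "1 - \<rho> \<le> norm (w l x - cayley (z0 $ l))"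
      using norm_triangle_ineq2[of "w l x" "cayley (z0 $ l)"] norm_w[OF x, of l] \<rho>l[of l] by linarith
    then have "1 / norm (w l x - cayley (z0 $ l)) \<le> C" unfolding C_def using \<rho> by (intro frac_le) auto
    then have *: "(1 / norm (w l x - cayley (z0 $ l)))\<^sup>2 \<le> C\<^sup>2" by (intro power_mono) auto
    have "1 \<le> norm (z0 $ l + \<i>)"
      using abs_Im_le_cmod[of "z0 $ l + \<i>"] z0'[of l] by (simp add: upper_half_plane_def)
    then have "1 \<le> (norm (z0 $ l + \<i>))\<^sup>2" by simp
    then have "2 / (norm (z0 $ l + \<i>))\<^sup>2 \<le> 2" by (simp add: divide_le_eq)
    from mult_mono[OF * this] show ?thesis
      using norm_w[OF x, of l] by (simp add: \<kappa>'_def norm_mult norm_divide norm_power power_divide mult.commute)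
  qed
  have "((\<lambda>z. \<integral>x. (\<Prod>l\<in>UNIV. \<kappa> l (z $ l) x) \<partial>M) has_derivative
     (\<lambda>h. \<Sum>j\<in>UNIV. (\<integral>x. \<kappa>' j x * (\<Prod>l\<in>UNIV - {j}. \<kappa> l (z0 $ l) x) \<partial>M) * h $ j)) (at z0)"
  proof (rule has_derivative_integral_prod[OF deriv _ _ C _ \<kappa>'_le])
    show "\<forall>\<^sub>F z in nhds z0. \<forall>l. \<forall>x\<in>space M. norm (\<kappa> l (z $ l) x) \<le> C \<and>
          norm (\<kappa> l (z $ l) x - \<kappa> l (z0 $ l) x) \<le> 2 * C\<^sup>2 * norm (z $ l - z0 $ l)"
      using ev by eventually_elim
        (use diff[OF _ _ _ z0' less_imp_le[OF \<rho>l]] \<kappa>C[OF _ _ _ z0' less_imp_le[OF \<rho>l]] in blast)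
  qed (auto simp: \<kappa>_def \<kappa>'_def)
  then have "((\<lambda>z. 2 * (\<integral>x. (\<Prod>l\<in>UNIV. \<kappa> l (z $ l) x) \<partial>M) - of_real (measure M (space M))) has_derivative
     (\<lambda>h. 2 * (\<Sum>j\<in>UNIV. (\<integral>x. \<kappa>' j x * (\<Prod>l\<in>UNIV - {j}. \<kappa> l (z0 $ l) x) \<partial>M) * h $ j) - 0)) (at z0)"
    by (intro derivative_intros)
  then have "((\<lambda>z. \<integral>x. herglotz_kernel (\<lambda>l. cayley (z $ l)) (\<lambda>l. w l x) \<partial>M) has_derivative
     (\<lambda>h. \<Sum>j\<in>UNIV. (\<chi> j. 2 * (\<integral>x. \<kappa>' j x * (\<Prod>l\<in>UNIV - {j}. \<kappa> l (z0 $ l) x) \<partial>M)) $ j * h $ j)) (at z0)"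
  proof (rule has_derivative_transform_within_open[THEN has_derivative_eq_rhs])
    show "open (poly_upper_half_plane :: (complex ^ 'n) set)"
      by (rule open_poly_upper_half_plane)
    fix z :: "complex ^ 'n" assume "z \<in> poly_upper_half_plane"
    then have "norm (cayley (z $ l)) < 1" for l by (simp add: poly_upper_half_plane_def norm_cayley_lt_1)
    from integrable_prod_cauchy[OF this]
    show "2 * (\<integral>x. (\<Prod>l\<in>UNIV. \<kappa> l (z $ l) x) \<partial>M) - of_real (measure M (space M)) =
       (\<integral>x. herglotz_kernel (\<lambda>l. cayley (z $ l)) (\<lambda>l. w l x) \<partial>M)"
      unfolding herglotz_kernel_def \<kappa>_def by (simp add: scaleR_conv_of_real)
  qed (use z0 in \<open>auto simp: sum_distrib_left mult_ac\<close>)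
  then show "\<exists>D :: complex ^ 'n. ((\<lambda>z. \<integral>x. herglotz_kernel (\<lambda>l. cayley (z $ l)) (\<lambda>l. w l x) \<partial>M) has_derivative
     (\<lambda>h. \<Sum>j\<in>UNIV. D $ j * h $ j)) (at z0)" by (rule exI)
qed

end

section \<open>Representations define Herglotz-Nevanlinna functions\<close>

definition normalized_measure :: "(real ^ 'n) measure \<Rightarrow> (real ^ 'n) measure" where
  "normalized_measure \<mu> = density \<mu> (\<lambda>t. ennreal (weight t))"

definition line_to_circle :: "'n::finite \<Rightarrow> real ^ 'n \<Rightarrow> complex" where
  "line_to_circle l t = cayley (of_real (t $ l))"

lemma line_to_circle_measurable [measurable]: "line_to_circle l \<in> borel_measurable borel"
proof -
  have "continuous_on UNIV (line_to_circle l)"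
    unfolding line_to_circle_def[abs_def] cayley_def by (intro continuous_intros) auto
  then show ?thesis by (rule borel_measurable_continuous_onI)
qed

lemma sets_normalized_measure: "sets (normalized_measure \<mu>) = sets \<mu>"
  by (simp add: normalized_measure_def)

lemma torus_measure_normalized_measure:
  assumes sets [measurable_cong]: "sets \<mu> = sets borel" and "growth_condition \<mu>"
  shows "torus_measure (normalized_measure \<mu>) line_to_circle"
proof -
  have "emeasure (normalized_measure \<mu>) (space (normalized_measure \<mu>)) = (\<integral>\<^sup>+t. ennreal (weight t) \<partial>\<mu>)"
    unfolding normalized_measure_def by (subst emeasure_density) (auto intro!: nn_integral_cong)
  also have "\<dots> < \<infinity>" using assms(2) by (simp add: growth_condition_def weight_def)
  finally have "finite_measure (normalized_measure \<mu>)" by (intro finite_measureI) auto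
  moreover have [measurable_cong]: "sets (normalized_measure \<mu>) = sets borel" by (simp add: sets_normalized_measure sets)
  have "line_to_circle l \<in> borel_measurable (normalized_measure \<mu>)" for l by measurable
  ultimately show ?thesis
    by (intro torus_measure.intro torus_measure_axioms.intro) (auto simp: line_to_circle_def)
qed

lemma integral_normalized_measure:
  fixes G :: "real ^ 'n \<Rightarrow> complex"
  assumes [measurable_cong]: "sets \<mu> = sets borel" and [measurable]: "G \<in> borel_measurable borel"
  shows "(\<integral>t. of_real (weight t) * G t \<partial>\<mu>) = (\<integral>t. G t \<partial>normalized_measure \<mu>)"
  unfolding normalized_measure_def
  by (subst integral_density) (auto simp: weight_pos less_imp_le scaleR_conv_of_real)

lemma nn_integral_normalized_measure:
  assumes [measurable_cong]: "sets \<mu> = sets borel" and [measurable]: "G \<in> borel_measurable borel"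
  shows "(\<integral>\<^sup>+t. ennreal (weight t) * G t \<partial>\<mu>) = (\<integral>\<^sup>+t. G t \<partial>normalized_measure \<mu>)"
  unfolding normalized_measure_def by (subst nn_integral_density) auto

lemma disc_functions_measurable [measurable]:
  "(\<lambda>t. disc_factor r \<zeta> (line_to_circle l t)) \<in> borel_measurable borel"
  "(\<lambda>t. cauchy_tail \<zeta> (line_to_circle l t)) \<in> borel_measurable borel"
  "(\<lambda>t. herglotz_kernel \<eta> (\<lambda>l. line_to_circle l t)) \<in> borel_measurable borel"
proof -
  have [measurable]: "cnj \<in> borel_measurable borel"
    by (intro borel_measurable_continuous_onI continuous_intros)
  show "(\<lambda>t. disc_factor r \<zeta> (line_to_circle l t)) \<in> borel_measurable borel"
    unfolding disc_factor_def cauchy_tail_def by measurable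
  show [measurable]: "(\<lambda>t. cauchy_tail \<zeta> (line_to_circle l t)) \<in> borel_measurable borel" for l \<zeta>
    unfolding cauchy_tail_def by measurable
  show "(\<lambda>t. herglotz_kernel \<eta> (\<lambda>l. line_to_circle l t)) \<in> borel_measurable borel"
    unfolding herglotz_kernel_def by measurable
qed

lemma integral_kernel_K:
  fixes z :: "complex ^ 'n"
  assumes sets: "sets \<mu> = sets borel" and z: "z \<in> poly_upper_half_plane"
  shows "(\<integral>t. kernel_K z t \<partial>\<mu>) = \<i> * (\<integral>t. herglotz_kernel (\<lambda>l. cayley (z $ l)) (\<lambda>l. line_to_circle l t) \<partial>normalized_measure \<mu>)"
proof -
  have "(\<integral>t. kernel_K z t \<partial>\<mu>) = (\<integral>t. \<i> * (of_real (weight t) * herglotz_kernel (\<lambda>l. cayley (z $ l)) (\<lambda>l. line_to_circle l t)) \<partial>\<mu>)"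
    by (simp add: kernel_K_eq_herglotz_kernel[OF z] line_to_circle_def mult.assoc)
  then show ?thesis
    by (simp only: integral_mult_right_zero) (subst integral_normalized_measure[OF sets], auto)
qed

text \<open>
  The constant \<open>2 \<i>\<close> appears once for each coordinate in each term of the sum and factors out.
\<close>

lemma nevanlinna_condition_iff:
  fixes \<mu> :: "(real ^ 'n) measure"
  assumes sets: "sets \<mu> = sets borel"
  shows "nevanlinna_condition \<mu> \<longleftrightarrow> (\<forall>z\<in>poly_upper_half_plane.
    (\<Sum>\<rho>\<in>mixed_indices. \<integral>t. (\<Prod>j\<in>UNIV. disc_factor (\<rho> $ j) (cayley (z $ j)) (line_to_circle j t)) \<partial>normalized_measure \<mu>) = 0)"
proof -
  have "(\<Sum>\<rho>\<in>mixed_indices. \<integral>t. (\<Prod>j\<in>UNIV. N_factor (\<rho> $ j) (z $ j) (t $ j)) \<partial>\<mu>)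
     = (2 * \<i>) ^ CARD('n) * (\<Sum>\<rho>\<in>mixed_indices. \<integral>t. (\<Prod>j\<in>UNIV. disc_factor (\<rho> $ j) (cayley (z $ j)) (line_to_circle j t)) \<partial>normalized_measure \<mu>)"
    if z: "z \<in> poly_upper_half_plane" for z :: "complex ^ 'n"
    unfolding sum_distrib_left
  proof (rule sum.cong[OF refl])
    fix \<rho> :: "int ^ 'n" assume "\<rho> \<in> mixed_indices"
    then have \<rho>: "\<rho> $ j \<in> {-1,0,1}" for j unfolding mixed_indices_def by blast
    have "(\<integral>t. (\<Prod>j\<in>UNIV. N_factor (\<rho> $ j) (z $ j) (t $ j)) \<partial>\<mu>)
      = (\<integral>t. (2 * \<i>) ^ CARD('n) * (of_real (weight t) * (\<Prod>j\<in>UNIV. disc_factor (\<rho> $ j) (cayley (z $ j)) (line_to_circle j t))) \<partial>\<mu>)"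
      using prod_N_factor_eq[OF z \<rho>] by (simp add: line_to_circle_def mult.assoc)
    then show "(\<integral>t. (\<Prod>j\<in>UNIV. N_factor (\<rho> $ j) (z $ j) (t $ j)) \<partial>\<mu>)
      = (2 * \<i>) ^ CARD('n) * (\<integral>t. (\<Prod>j\<in>UNIV. disc_factor (\<rho> $ j) (cayley (z $ j)) (line_to_circle j t)) \<partial>normalized_measure \<mu>)"
      by (simp only: integral_mult_right_zero) (subst integral_normalized_measure[OF sets], auto)
  qed
  then show ?thesis unfolding nevanlinna_condition_def by auto
qed

definition disc_poisson :: "complex \<Rightarrow> complex \<Rightarrow> real" where
  "disc_poisson \<zeta> \<omega> = Re (1 + 2 * cauchy_tail \<zeta> \<omega>)"

text \<open>
  The mixed terms of \<open>Re_herglotz_kernel\<close> integrate to zero, so only the Poisson product is left.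
\<close>

lemma (in torus_measure) Re_integral_herglotz_kernel:
  fixes \<zeta> :: "'n \<Rightarrow> complex"
  assumes \<zeta>: "\<And>j. norm (\<zeta> j) < 1"
    and mixed: "(\<Sum>\<rho>\<in>mixed_indices. \<integral>x. (\<Prod>j\<in>UNIV. disc_factor (\<rho> $ j) (\<zeta> j) (w j x)) \<partial>M) = 0"
  shows "integrable M (\<lambda>x. \<Prod>l\<in>UNIV. disc_poisson (\<zeta> l) (w l x))"
    and "Re (\<integral>x. herglotz_kernel \<zeta> (\<lambda>l. w l x) \<partial>M) = (\<integral>x. (\<Prod>l\<in>UNIV. disc_poisson (\<zeta> l) (w l x)) \<partial>M)"
proof -
  define S where "S x = (\<Sum>\<rho>\<in>mixed_indices. \<Prod>j\<in>UNIV. disc_factor (\<rho> $ j) (\<zeta> j) (w j x))" for x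
  define P where "P x = (\<Prod>l\<in>UNIV. disc_poisson (\<zeta> l) (w l x))" for x
  have int: "integrable M (\<lambda>x. herglotz_kernel \<zeta> (\<lambda>l. w l x))" by (rule integrable_herglotz_kernel[OF \<zeta>])
  have intS: "integrable M S"
    unfolding S_def by (intro Bochner_Integration.integrable_sum integrable_prod_disc_factor \<zeta>)
  have S0: "(\<integral>x. S x \<partial>M) = 0"
    unfolding S_def using mixed by (subst Bochner_Integration.integral_sum) (auto intro: integrable_prod_disc_factor \<zeta>)
  have eq: "complex_of_real (Re (herglotz_kernel \<zeta> (\<lambda>l. w l x))) + S x = of_real (P x)" for x
    unfolding Re_herglotz_kernel S_def P_def disc_poisson_def by simp
  have intR: "integrable M (\<lambda>x. complex_of_real (Re (herglotz_kernel \<zeta> (\<lambda>l. w l x))))"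
    using integrable_Re[OF int] by (rule integrable_of_real)
  have "integrable M (\<lambda>x. complex_of_real (P x))"
    unfolding eq[symmetric] by (intro Bochner_Integration.integrable_add intR intS)
  from integrable_Re[OF this] show "integrable M (\<lambda>x. \<Prod>l\<in>UNIV. disc_poisson (\<zeta> l) (w l x))"
    by (simp only: Re_complex_of_real P_def)
  have "complex_of_real (\<integral>x. P x \<partial>M) = (\<integral>x. complex_of_real (P x) \<partial>M)" by simp
  also have "\<dots> = (\<integral>x. complex_of_real (Re (herglotz_kernel \<zeta> (\<lambda>l. w l x))) \<partial>M) + 0"
    unfolding eq[symmetric] S0[symmetric] by (intro Bochner_Integration.integral_add intR intS)
  also have "\<dots> = of_real (Re (\<integral>x. herglotz_kernel \<zeta> (\<lambda>l. w l x) \<partial>M))"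
    using integral_Re[OF int] by simp
  finally show "Re (\<integral>x. herglotz_kernel \<zeta> (\<lambda>l. w l x) \<partial>M) = (\<integral>x. (\<Prod>l\<in>UNIV. disc_poisson (\<zeta> l) (w l x)) \<partial>M)"
    by (simp only: of_real_eq_iff P_def)
qed

lemma disc_poisson_nonneg:
  assumes "norm \<omega> = 1" "norm \<zeta> < 1"
  shows "0 \<le> disc_poisson \<zeta> \<omega>"
proof -
  have "(norm \<zeta>)\<^sup>2 \<le> 1" using assms by (simp add: power_le_one)
  then show ?thesis unfolding disc_poisson_def Re_one_plus_two_cauchy_tail[OF assms] by simp
qed

lemma cayley_poly_upper_half_plane: "z \<in> poly_upper_half_plane \<Longrightarrow> norm (cayley (z $ l)) < 1"
  by (simp add: poly_upper_half_plane_def norm_cayley_lt_1)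

lemma Im_of_represents:
  fixes q :: "complex ^ 'n \<Rightarrow> complex"
  assumes rep: "represents q a b \<mu>" and z: "z \<in> poly_upper_half_plane"
  shows "integrable (normalized_measure \<mu>) (\<lambda>t. \<Prod>l\<in>UNIV. disc_poisson (cayley (z $ l)) (line_to_circle l t))"
    and "Im (q z) = (\<Sum>l\<in>UNIV. b $ l * Im (z $ l))
       + 1 / pi ^ CARD('n) * (\<integral>t. (\<Prod>l\<in>UNIV. disc_poisson (cayley (z $ l)) (line_to_circle l t)) \<partial>normalized_measure \<mu>)"
proof -
  have sets: "sets \<mu> = sets borel" and "growth_condition \<mu>" and nev: "nevanlinna_condition \<mu>"
    and q: "q z = of_real a + (\<Sum>l\<in>UNIV. of_real (b $ l) * z $ l) + 1 / of_real pi ^ CARD('n) * (\<integral>t. kernel_K z t \<partial>\<mu>)"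
    using rep z unfolding represents_def by auto
  interpret torus_measure "normalized_measure \<mu>" line_to_circle
    by (rule torus_measure_normalized_measure) fact+
  have \<zeta>: "norm (cayley (z $ j)) < 1" for j using z by (rule cayley_poly_upper_half_plane)
  have mixed: "(\<Sum>\<rho>\<in>mixed_indices. \<integral>t. (\<Prod>j\<in>UNIV. disc_factor (\<rho> $ j) (cayley (z $ j)) (line_to_circle j t)) \<partial>normalized_measure \<mu>) = 0"
    using nev z unfolding nevanlinna_condition_iff[OF sets] by blast
  note R = Re_integral_herglotz_kernel[where \<zeta> = "\<lambda>j. cayley (z $ j)", OF \<zeta> mixed]
  show "integrable (normalized_measure \<mu>) (\<lambda>t. \<Prod>l\<in>UNIV. disc_poisson (cayley (z $ l)) (line_to_circle l t))"
    by (rule R(1))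
  have "1 / complex_of_real pi ^ CARD('n) = of_real (1 / pi ^ CARD('n))" by simp
  then show "Im (q z) = (\<Sum>l\<in>UNIV. b $ l * Im (z $ l))
       + 1 / pi ^ CARD('n) * (\<integral>t. (\<Prod>l\<in>UNIV. disc_poisson (cayley (z $ l)) (line_to_circle l t)) \<partial>normalized_measure \<mu>)"
    unfolding q integral_kernel_K[OF sets z] R(2)[symmetric]
    by (simp only: plus_complex.sel Im_complex_of_real Im_sum times_complex.sel Re_complex_of_real imaginary_unit.sel) simp
qed

lemma represents_imp_herglotz_nevanlinna:
  fixes q :: "complex ^ 'n \<Rightarrow> complex"
  assumes rep: "represents q a b \<mu>"
  shows "herglotz_nevanlinna q"
  unfolding herglotz_nevanlinna_def
proof (intro conjI ballI)
  have sets: "sets \<mu> = sets borel" and "growth_condition \<mu>"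
    and q: "\<And>z. z \<in> poly_upper_half_plane \<Longrightarrow> q z = of_real a + (\<Sum>l\<in>UNIV. of_real (b $ l) * z $ l) + 1 / of_real pi ^ CARD('n) * (\<integral>t. kernel_K z t \<partial>\<mu>)"
    and b: "\<And>l. 0 \<le> b $ l"
    using rep unfolding represents_def by auto
  interpret torus_measure "normalized_measure \<mu>" line_to_circle
    by (rule torus_measure_normalized_measure) fact+
  define F where "F z = (\<integral>t. herglotz_kernel (\<lambda>l. cayley (z $ l)) (\<lambda>l. line_to_circle l t) \<partial>normalized_measure \<mu>)" for z :: "complex ^ 'n"
  define c where "c = \<i> / of_real pi ^ CARD('n)"
  show "holomorphic_several_on q poly_upper_half_plane"
    unfolding holomorphic_several_on_def
  proof
    fix z0 :: "complex ^ 'n" assume z0: "z0 \<in> poly_upper_half_plane"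
    obtain D :: "complex ^ 'n" where D: "(F has_derivative (\<lambda>h. \<Sum>j\<in>UNIV. D $ j * h $ j)) (at z0)"
      using holomorphic_integral_herglotz_kernel z0 unfolding holomorphic_several_on_def F_def by blast
    have "((\<lambda>z. of_real a + (\<Sum>l\<in>UNIV. of_real (b $ l) * z $ l) + c * F z) has_derivative
       (\<lambda>h. 0 + (\<Sum>l\<in>UNIV. of_real (b $ l) * h $ l) + c * (\<Sum>j\<in>UNIV. D $ j * h $ j))) (at z0)"
      by (intro derivative_intros D bounded_linear_imp_has_derivative bounded_linear_vec_nth)
    then have "(q has_derivative (\<lambda>h. \<Sum>j\<in>UNIV. (\<chi> j. of_real (b $ j) + c * D $ j) $ j * h $ j)) (at z0)"
    proof (rule has_derivative_transform_within_open[THEN has_derivative_eq_rhs])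
      show "open (poly_upper_half_plane :: (complex ^ 'n) set)"
        by (rule open_poly_upper_half_plane)
    qed (use z0 in \<open>auto simp: q F_def c_def integral_kernel_K[OF sets] sum_distrib_left sum.distrib[symmetric] algebra_simps\<close>)
    then show "\<exists>D :: complex ^ 'n. (q has_derivative (\<lambda>h. \<Sum>j\<in>UNIV. D $ j * h $ j)) (at z0)"
      by (rule exI)
  qed
  fix z :: "complex ^ 'n" assume z: "z \<in> poly_upper_half_plane"
  have Im: "0 < Im (z $ l)" for l using z by (simp add: poly_upper_half_plane_def upper_half_plane_def)
  show "0 \<le> Im (q z)"
    unfolding Im_of_represents(2)[OF rep z]
    by (intro add_nonneg_nonneg sum_nonneg mult_nonneg_nonneg b less_imp_le[OF Im] integral_nonneg_AE AE_I2 prod_nonneg disc_poisson_nonneg)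
       (auto intro: norm_w cayley_poly_upper_half_plane z)
qed

section \<open>Uniqueness of the parameters\<close>

definition poisson :: "complex \<Rightarrow> real \<Rightarrow> real" where
  "poisson z t = Im z / ((Re z - t)\<^sup>2 + (Im z)\<^sup>2)"

lemma poisson_nonneg: "z \<in> upper_half_plane \<Longrightarrow> 0 \<le> poisson z t"
  by (simp add: poisson_def upper_half_plane_def)

lemma poisson_measurable [measurable]: "poisson z \<in> borel_measurable borel"
  unfolding poisson_def[abs_def] by measurable

lemma poisson_eq_disc:
  assumes z: "z \<in> upper_half_plane"
  shows "poisson z t = Re (1 + 2 * cauchy_tail (cayley z) (cayley (of_real t))) / (1 + t\<^sup>2)"
proof -
  let ?E = "cauchy_tail (cayley z) (cayley (of_real t))"
  have t: "1 + t\<^sup>2 > 0" by (simp add: add_pos_nonneg)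
  have y: "(Re z - t)\<^sup>2 + (Im z)\<^sup>2 > 0" using z by (simp add: upper_half_plane_def sum_power2_gt_zero_iff)
  have "N_factor (-1) z t + N_factor 0 z t + N_factor 1 z t
      = 2 * \<i> / of_real (1 + t\<^sup>2) * (?E + 1 + cnj ?E)"
    using N_factor_eq_disc_factor[OF z, of _ t] by (simp add: algebra_simps add_divide_distrib)
  also have "?E + 1 + cnj ?E = of_real (Re (1 + 2 * ?E))"
    by (simp add: complex_eq_iff)
  also have "N_factor (-1) z t + N_factor 0 z t + N_factor 1 z t = 1 / (of_real t - z) - 1 / (of_real t - cnj z)"
    by (simp add: N_factor_def)
  also have "\<dots> = 2 * \<i> * of_real (poisson z t)"
  proof -
    have "(of_real t - z) * (of_real t - cnj z) = of_real ((Re z - t)\<^sup>2 + (Im z)\<^sup>2)"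
      by (simp add: complex_eq_iff power2_eq_square algebra_simps)
    moreover have "1 / (of_real t - z) - 1 / (of_real t - cnj z) = (z - cnj z) / ((of_real t - z) * (of_real t - cnj z))"
      using upper_half_planeD(2,3)[OF z, of t] by (simp add: divide_simps)
    moreover have "z - cnj z = 2 * \<i> * of_real (Im z)" by (simp add: complex_eq_iff)
    ultimately show ?thesis unfolding poisson_def by simp
  qed
  finally have "2 * \<i> * complex_of_real (poisson z t) = 2 * \<i> * of_real (Re (1 + 2 * ?E) / (1 + t\<^sup>2))"
    by simp
  then show ?thesis by (simp only: mult_cancel_left of_real_eq_iff) simp
qed

text \<open>
  The Poisson kernel of height \<open>y = 1 / (k + 1)\<^sup>2\<close> integrated over \<open>[a - 1 / (k + 1), b + 1 / (k + 1)]\<close>. The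
  margin \<open>1 / (k + 1)\<close> is chosen to be small but much larger than \<open>y\<close>; hence the limit at an end point of
  \<open>[a, b]\<close> is \<open>\<pi>\<close>, as in the interior, and not \<open>\<pi> / 2\<close>.
\<close>

definition interval_smoothing :: "real \<Rightarrow> real \<Rightarrow> nat \<Rightarrow> real \<Rightarrow> real" where
  "interval_smoothing a b k t =
     arctan ((b - t) * (real k + 1)\<^sup>2 + (real k + 1)) - arctan ((a - t) * (real k + 1)\<^sup>2 - (real k + 1))"

lemma interval_smoothing_measurable [measurable]: "interval_smoothing a b k \<in> borel_measurable borel"
proof -
  have "continuous_on UNIV (interval_smoothing a b k)"
    unfolding interval_smoothing_def[abs_def] by (intro continuous_intros)
  then show ?thesis by (rule borel_measurable_continuous_onI)
qed

lemma poisson_has_derivative: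
  assumes "y > 0"
  shows "((\<lambda>x. arctan ((x - t) / y)) has_real_derivative poisson (Complex x y) t) (at x)"
proof -
  have "((\<lambda>x. arctan ((x - t) / y)) has_real_derivative (1 / y) / (1 + ((x - t) / y)\<^sup>2)) (at x)"
    using assms by (auto intro!: derivative_eq_intros simp: divide_inverse)
  also have "(1 / y) / (1 + ((x - t) / y)\<^sup>2) = poisson (Complex x y) t"
    using assms sum_power2_gt_zero_iff[of y "x - t"]
    by (simp add: poisson_def power_divide divide_simps) (simp add: power2_eq_square algebra_simps)
  finally show ?thesis .
qed

lemma interval_smoothing_eq:
  fixes a b :: real and k :: nat
  defines "d \<equiv> 1 / (real k + 1)"
  shows "interval_smoothing a b k t = arctan ((b + d - t) / d\<^sup>2) - arctan ((a - d - t) / d\<^sup>2)"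
proof -
  have "(b + d - t) / d\<^sup>2 = (b - t) * (real k + 1)\<^sup>2 + (real k + 1)" "(a - d - t) / d\<^sup>2 = (a - t) * (real k + 1)\<^sup>2 - (real k + 1)"
    unfolding d_def by (simp_all add: field_simps power2_eq_square)
  then show ?thesis by (simp add: interval_smoothing_def)
qed

lemma interval_smoothing_limit:
  assumes "a \<le> b"
  shows "(\<lambda>k. interval_smoothing a b k t) \<longlonglongrightarrow> pi * indicator {a..b} t"
proof -
  have pos: "(\<lambda>k. arctan (c * (real k + 1)\<^sup>2 + (real k + 1))) \<longlonglongrightarrow> pi / 2" if "c \<ge> 0" for c
  proof (cases "c = 0")
    case True
    then show ?thesis by simp real_asymp
  next
    case False
    then have "c > 0" using that by simp
    then show ?thesis by real_asymp
  qed
  have neg: "(\<lambda>k. arctan (c * (real k + 1)\<^sup>2 + (real k + 1))) \<longlonglongrightarrow> - pi / 2" if "c < 0" for c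
    using that by real_asymp
  have A: "(\<lambda>k. arctan ((b - t) * (real k + 1)\<^sup>2 + (real k + 1))) \<longlonglongrightarrow> (if t \<le> b then pi / 2 else - pi / 2)"
    using pos[of "b - t"] neg[of "b - t"] by auto
  have "(\<lambda>k. - arctan ((t - a) * (real k + 1)\<^sup>2 + (real k + 1))) \<longlonglongrightarrow> - (if a \<le> t then pi / 2 else - pi / 2)"
    by (intro tendsto_minus) (use pos[of "t - a"] neg[of "t - a"] in auto)
  also have "(\<lambda>k. - arctan ((t - a) * (real k + 1)\<^sup>2 + (real k + 1))) = (\<lambda>k. arctan ((a - t) * (real k + 1)\<^sup>2 - (real k + 1)))"
    by (simp add: arctan_minus[symmetric] algebra_simps del: arctan_minus)
  finally have "(\<lambda>k. interval_smoothing a b k t) \<longlonglongrightarrow> (if t \<le> b then pi / 2 else - pi / 2) - (- (if a \<le> t then pi / 2 else - pi / 2))"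
    unfolding interval_smoothing_def by (intro tendsto_diff A)
  then show ?thesis using assms by (auto simp: indicator_def split: if_splits)
qed

text \<open>
  Near the interval the bound \<open>\<pi>\<close> is enough. Far away the mean value theorem turns the difference of
  arctangents into a value of the Poisson kernel, which decays like \<open>1 / t\<^sup>2\<close>.
\<close>

lemma interval_smoothing_bound:
  assumes ab: "a \<le> b"
  obtains B where "\<And>k t. 0 \<le> interval_smoothing a b k t" "\<And>k t. interval_smoothing a b k t * (1 + t\<^sup>2) \<le> B"
proof
  \<comment> \<open>The enlarged interval is contained in \<open>[-S, S]\<close>.\<close>
  define S where "S = \<bar>a\<bar> + \<bar>b\<bar> + 1"
  fix k :: nat and t :: real
  define d where "d = 1 / (real k + 1)"
  have d: "0 < d" "d \<le> 1" by (simp_all add: d_def)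
  have d2: "0 < d\<^sup>2" "d\<^sup>2 \<le> 1" using d by (auto simp: power_le_one)
  have eq: "interval_smoothing a b k t = arctan ((b + d - t) / d\<^sup>2) - arctan ((a - d - t) / d\<^sup>2)"
    unfolding d_def by (rule interval_smoothing_eq)
  have "a - d < b + d" using ab d by simp
  from MVT2[OF this, of "\<lambda>x. arctan ((x - t) / d\<^sup>2)" "\<lambda>x. poisson (Complex x (d\<^sup>2)) t"] poisson_has_derivative[OF d2(1)]
  obtain x where x: "a - d < x" "x < b + d" and
    mvt: "interval_smoothing a b k t = (b - a + 2 * d) * poisson (Complex x (d\<^sup>2)) t"
    unfolding eq by (auto simp: algebra_simps)
  show nonneg: "0 \<le> interval_smoothing a b k t"
    unfolding mvt using ab d d2 by (auto intro!: mult_nonneg_nonneg poisson_nonneg simp: upper_half_plane_def)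
  have le_pi: "interval_smoothing a b k t \<le> pi"
    unfolding interval_smoothing_def
    using arctan_bounded[of "(b - t) * (real k + 1)\<^sup>2 + (real k + 1)"] arctan_bounded[of "(a - t) * (real k + 1)\<^sup>2 - (real k + 1)"]
    by linarith
  show "interval_smoothing a b k t * (1 + t\<^sup>2) \<le> pi * (1 + (2 * S)\<^sup>2) + (b - a + 2) * 8"
  proof (cases "\<bar>t\<bar> \<le> 2 * S")
    case True
    then have "\<bar>t\<bar>\<^sup>2 \<le> (2 * S)\<^sup>2" by (intro power_mono) auto
    then have "t\<^sup>2 \<le> (2 * S)\<^sup>2" by simp
    then have "interval_smoothing a b k t * (1 + t\<^sup>2) \<le> pi * (1 + (2 * S)\<^sup>2)"
      using le_pi nonneg by (intro mult_mono) auto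
    then show ?thesis using ab by simp
  next
    case False
    have "\<bar>x\<bar> \<le> S" using x d unfolding S_def by linarith
    then have "\<bar>t\<bar> / 2 \<le> \<bar>x - t\<bar>" using False abs_triangle_ineq2[of t x] by (simp add: abs_minus_commute)
    then have "(\<bar>t\<bar> / 2)\<^sup>2 \<le> (\<bar>x - t\<bar>)\<^sup>2" by (intro power_mono) auto
    then have xt: "t\<^sup>2 / 4 \<le> (x - t)\<^sup>2" by (simp add: power_divide)
    have "1 \<le> S" by (simp add: S_def)
    then have "\<bar>1\<bar> \<le> \<bar>t\<bar>" using False by simp
    then have t1: "1 \<le> t\<^sup>2" using abs_le_square_iff[of 1 t] by simp
    have "poisson (Complex x (d\<^sup>2)) t \<le> 1 / (t\<^sup>2 / 4)"
      unfolding poisson_def complex.sel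
    proof (rule frac_le)
      show "t\<^sup>2 / 4 \<le> (x - t)\<^sup>2 + (d\<^sup>2)\<^sup>2" using xt zero_le_power2[of "d\<^sup>2"] by linarith
    qed (use t1 d2 in auto)
    moreover have "1 + t\<^sup>2 \<le> 2 * t\<^sup>2" using t1 by simp
    ultimately have "poisson (Complex x (d\<^sup>2)) t * (1 + t\<^sup>2) \<le> 1 / (t\<^sup>2 / 4) * (2 * t\<^sup>2)"
      by (intro mult_mono) auto
    also have "\<dots> = 8" using t1 by auto
    finally have "(b - a + 2 * d) * (poisson (Complex x (d\<^sup>2)) t * (1 + t\<^sup>2)) \<le> (b - a + 2) * 8"
      using ab d by (intro mult_mono) (auto intro!: mult_nonneg_nonneg poisson_nonneg simp: upper_half_plane_def)
    then show ?thesis unfolding mvt by (simp add: mult.assoc add_increasing)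
  qed
qed

lemma poisson_smoothing_Fubini:
  fixes N :: "real measure" and k :: nat
  defines "d \<equiv> 1 / (real k + 1)"
  assumes "finite_measure N" and [measurable_cong]: "sets N = sets borel" and ab: "a \<le> b"
  shows "(\<integral>\<^sup>+t. ennreal (interval_smoothing a b k t * (1 + t\<^sup>2)) \<partial>N) =
    (\<integral>\<^sup>+x. (\<integral>\<^sup>+t. ennreal (poisson (Complex x (d\<^sup>2)) t * (1 + t\<^sup>2)) \<partial>N) * indicator {a - d..b + d} x \<partial>lborel)"
proof -
  interpret N: finite_measure N by fact
  interpret P: pair_sigma_finite N lborel by unfold_locales
  have d: "0 < d" "0 < d\<^sup>2" by (simp_all add: d_def)
  have [measurable]: "(\<lambda>(t, x). poisson (Complex x (d\<^sup>2)) t) \<in> borel_measurable (N \<Otimes>\<^sub>M lborel)"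
    unfolding poisson_def by simp
  have [measurable]: "(\<lambda>x. poisson (Complex x (d\<^sup>2)) t) \<in> borel_measurable borel" for t
    unfolding poisson_def by simp
  have "(\<integral>\<^sup>+x. (\<integral>\<^sup>+t. ennreal (poisson (Complex x (d\<^sup>2)) t * (1 + t\<^sup>2)) \<partial>N) * indicator {a - d..b + d} x \<partial>lborel)
    = (\<integral>\<^sup>+x. (\<integral>\<^sup>+t. ennreal (poisson (Complex x (d\<^sup>2)) t * (1 + t\<^sup>2)) * indicator {a - d..b + d} x \<partial>N) \<partial>lborel)"
    by (intro nn_integral_cong nn_integral_multc[symmetric]) measurable
  also have "\<dots> = (\<integral>\<^sup>+t. (\<integral>\<^sup>+x. ennreal (poisson (Complex x (d\<^sup>2)) t * (1 + t\<^sup>2)) * indicator {a - d..b + d} x \<partial>lborel) \<partial>N)"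
    by (intro P.Fubini') measurable
  also have "\<dots> = (\<integral>\<^sup>+t. ennreal (interval_smoothing a b k t * (1 + t\<^sup>2)) \<partial>N)"
  proof (intro nn_integral_cong)
    fix t
    have ge0: "0 \<le> poisson (Complex x (d\<^sup>2)) t" for x
      using d by (intro poisson_nonneg) (simp add: upper_half_plane_def)
    have "(\<integral>\<^sup>+x. ennreal (poisson (Complex x (d\<^sup>2)) t * (1 + t\<^sup>2)) * indicator {a - d..b + d} x \<partial>lborel)
      = (\<integral>\<^sup>+x. ennreal (1 + t\<^sup>2) * (ennreal (poisson (Complex x (d\<^sup>2)) t) * indicator {a - d..b + d} x) \<partial>lborel)"
      using ge0 by (intro nn_integral_cong) (auto simp: ennreal_mult mult_ac)
    also have "\<dots> = ennreal (1 + t\<^sup>2) * (\<integral>\<^sup>+x. ennreal (poisson (Complex x (d\<^sup>2)) t) * indicator {a - d..b + d} x \<partial>lborel)"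
      by (intro nn_integral_cmult) measurable
    also have "(\<integral>\<^sup>+x. ennreal (poisson (Complex x (d\<^sup>2)) t) * indicator {a - d..b + d} x \<partial>lborel)
        = ennreal (arctan ((b + d - t) / d\<^sup>2) - arctan ((a - d - t) / d\<^sup>2))"
      by (rule nn_integral_FTC_Icc) (use poisson_has_derivative[OF d(2)] ge0 ab d in auto)
    also have "\<dots> = ennreal (interval_smoothing a b k t)"
      unfolding d_def interval_smoothing_eq ..
    finally show "(\<integral>\<^sup>+x. ennreal (poisson (Complex x (d\<^sup>2)) t * (1 + t\<^sup>2)) * indicator {a - d..b + d} x \<partial>lborel)
       = ennreal (interval_smoothing a b k t * (1 + t\<^sup>2))"
      using interval_smoothing_bound[OF ab] by (metis ennreal_mult'' mult.commute zero_le_power2 add_nonneg_nonneg zero_le_one)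
  qed
  finally show ?thesis ..
qed

lemma poisson_smoothing_limit:
  fixes N :: "real measure"
  assumes "finite_measure N" and [measurable_cong]: "sets N = sets borel" and ab: "a \<le> b"
  shows "(\<lambda>k. \<integral>\<^sup>+t. ennreal (interval_smoothing a b k t * (1 + t\<^sup>2)) \<partial>N)
    \<longlonglongrightarrow> (\<integral>\<^sup>+t. ennreal (pi * indicator {a..b} t * (1 + t\<^sup>2)) \<partial>N)"
proof -
  interpret N: finite_measure N by fact
  obtain B where B: "\<And>k t. 0 \<le> interval_smoothing a b k t" "\<And>k t. interval_smoothing a b k t * (1 + t\<^sup>2) \<le> B"
    using interval_smoothing_bound[OF ab] by blast
  show ?thesis
  proof (rule nn_integral_dominated_convergence[where w = "\<lambda>_. ennreal B"])
    show "AE t in N. (\<lambda>k. ennreal (interval_smoothing a b k t * (1 + t\<^sup>2))) \<longlonglongrightarrow> ennreal (pi * indicator {a..b} t * (1 + t\<^sup>2))"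
      by (intro AE_I2 tendsto_ennrealI tendsto_mult interval_smoothing_limit ab tendsto_const)
    show "(\<integral>\<^sup>+t. ennreal B \<partial>N) < \<infinity>"
      by (simp add: N.emeasure_eq_measure ennreal_mult_less_top)
  qed (use B in \<open>auto intro!: ennreal_leI\<close>)
qed

text \<open>
  Inversion of the Poisson transform on the line: integrate the equality over an interval of real parts,
  exchange the integrals and let the height tend to zero.
\<close>

lemma poisson_determines_intervals:
  fixes N N' :: "real measure"
  assumes fin: "finite_measure N" "finite_measure N'" and sets: "sets N = sets borel" "sets N' = sets borel"
    and eq: "\<And>z. z \<in> upper_half_plane \<Longrightarrow>
       (\<integral>\<^sup>+t. ennreal (poisson z t * (1 + t\<^sup>2)) \<partial>N) = (\<integral>\<^sup>+t. ennreal (poisson z t * (1 + t\<^sup>2)) \<partial>N')"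
  shows "(\<integral>\<^sup>+t. ennreal (indicator {a..b} t * (1 + t\<^sup>2)) \<partial>N) = (\<integral>\<^sup>+t. ennreal (indicator {a..b} t * (1 + t\<^sup>2)) \<partial>N')"
proof (cases "a \<le> b")
  case ab: True
  have [measurable_cong]: "sets N = sets borel" "sets N' = sets borel" by fact+
  have "(\<integral>\<^sup>+t. ennreal (interval_smoothing a b k t * (1 + t\<^sup>2)) \<partial>N) = (\<integral>\<^sup>+t. ennreal (interval_smoothing a b k t * (1 + t\<^sup>2)) \<partial>N')" for k
    unfolding poisson_smoothing_Fubini[OF fin(1) sets(1) ab] poisson_smoothing_Fubini[OF fin(2) sets(2) ab]
    by (subst eq) (auto simp: upper_half_plane_def)
  then have "(\<integral>\<^sup>+t. ennreal (pi * indicator {a..b} t * (1 + t\<^sup>2)) \<partial>N) = (\<integral>\<^sup>+t. ennreal (pi * indicator {a..b} t * (1 + t\<^sup>2)) \<partial>N')"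
    using LIMSEQ_unique[OF poisson_smoothing_limit[OF fin(1) sets(1) ab]] poisson_smoothing_limit[OF fin(2) sets(2) ab] by simp
  moreover have "(\<integral>\<^sup>+t. ennreal (pi * indicator {a..b} t * (1 + t\<^sup>2)) \<partial>K) = ennreal pi * (\<integral>\<^sup>+t. ennreal (indicator {a..b} t * (1 + t\<^sup>2)) \<partial>K)"
    if [measurable_cong]: "sets K = sets borel" for K :: "real measure"
    by (subst nn_integral_cmult[symmetric]) (auto simp: ennreal_mult mult.assoc)
  ultimately show ?thesis
    using sets by (simp add: ennreal_mult_cancel_left)
qed simp

lemma disc_poisson_cayley:
  "z \<in> upper_half_plane \<Longrightarrow> disc_poisson (cayley z) (line_to_circle l t) = poisson z (t $ l) * (1 + (t $ l)\<^sup>2)"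
  using add_pos_nonneg[of 1 "(t $ l)\<^sup>2"] by (simp add: poisson_eq_disc disc_poisson_def line_to_circle_def)

text \<open>
  At \<open>(\<i>,...,\<i>)\<close> the transformed point is the origin, where the kernel of the torus is 1; so the integral
  of \<open>K\<^sub>n\<close> is purely imaginary.
\<close>

lemma represents_constant_term:
  fixes q :: "complex ^ 'n \<Rightarrow> complex"
  assumes rep: "represents q a b \<mu>"
  shows "a = Re (q (\<chi> l. \<i>))"
proof -
  let ?z = "(\<chi> l. \<i>) :: complex ^ 'n"
  have z: "?z \<in> poly_upper_half_plane" by (simp add: poly_upper_half_plane_def upper_half_plane_def)
  have sets: "sets \<mu> = sets borel"
    and q: "q ?z = of_real a + (\<Sum>l\<in>UNIV. of_real (b $ l) * ?z $ l) + 1 / of_real pi ^ CARD('n) * (\<integral>t. kernel_K ?z t \<partial>\<mu>)"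
    using rep z unfolding represents_def by auto
  have K: "(\<integral>t. kernel_K ?z t \<partial>\<mu>) = \<i> * of_real (measure (normalized_measure \<mu>) (space (normalized_measure \<mu>)))"
    unfolding integral_kernel_K[OF sets z] by (simp add: herglotz_kernel_def cauchy_tail_def cayley_def scaleR_conv_of_real)
  have "1 / complex_of_real pi ^ CARD('n) = of_real (1 / pi ^ CARD('n))" by simp
  then show ?thesis unfolding q K by (simp del: of_real_divide of_real_power)
qed

text \<open>
  After division by \<open>y = Im z\<^sub>l\<close> the Poisson product is \<open>(1 + t\<^sub>l\<^sup>2) / (t\<^sub>l\<^sup>2 + y\<^sup>2)\<close> with respect to the finite
  measure; this is at most 1 and tends to 0.
\<close>

lemma represents_linear_term:
  fixes q :: "complex ^ 'n \<Rightarrow> complex"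
  assumes rep: "represents q a b \<mu>"
  shows "(\<lambda>k. Im (q (\<chi> j. if j = l then \<i> * of_real (real k + 1) else \<i>)) / (real k + 1)) \<longlonglongrightarrow> b $ l"
proof -
  have sets: "sets \<mu> = sets borel" and "growth_condition \<mu>"
    using rep unfolding represents_def by auto
  interpret torus_measure "normalized_measure \<mu>" line_to_circle
    by (rule torus_measure_normalized_measure) fact+
  have [measurable_cong]: "sets (normalized_measure \<mu>) = sets borel" by (simp add: sets_normalized_measure sets)
  define z :: "nat \<Rightarrow> complex ^ 'n" where "z k = (\<chi> j. if j = l then \<i> * of_real (real k + 1) else \<i>)" for k
  have z: "z k \<in> poly_upper_half_plane" for k by (auto simp: z_def poly_upper_half_plane_def upper_half_plane_def)
  define H where "H k t = (1 + (t $ l)\<^sup>2) / ((t $ l)\<^sup>2 + (real k + 1)\<^sup>2)" for k and t :: "real ^ 'n"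
  have [measurable]: "H k \<in> borel_measurable borel" for k unfolding H_def by measurable
  have prod_eq: "(\<Prod>j\<in>UNIV. disc_poisson (cayley (z k $ j)) (line_to_circle j t)) = (real k + 1) * H k t" for k t
  proof -
    have "(\<Prod>j\<in>UNIV. disc_poisson (cayley (z k $ j)) (line_to_circle j t))
      = disc_poisson (cayley (z k $ l)) (line_to_circle l t) * (\<Prod>j\<in>UNIV - {l}. 1)"
      by (subst prod.remove[of _ l]) (auto simp: z_def disc_poisson_def cauchy_tail_def cayley_def intro!: prod.neutral)
    then show ?thesis
      by (simp add: disc_poisson_cayley z_def upper_half_plane_def poisson_def H_def)
  qed
  have "Im (q (z k)) / (real k + 1) = b $ l + (\<Sum>j\<in>UNIV - {l}. b $ j) * (1 / (real k + 1)) + 1 / pi ^ CARD('n) * (\<integral>t. H k t \<partial>normalized_measure \<mu>)" for k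
  proof -
    have "(\<Sum>j\<in>UNIV. b $ j * Im (z k $ j)) = b $ l * (real k + 1) + (\<Sum>j\<in>UNIV - {l}. b $ j)"
      by (subst sum.remove[of _ l]) (auto simp: z_def)
    then have "Im (q (z k)) = b $ l * (real k + 1) + (\<Sum>j\<in>UNIV - {l}. b $ j) + 1 / pi ^ CARD('n) * ((real k + 1) * (\<integral>t. H k t \<partial>normalized_measure \<mu>))"
      unfolding Im_of_represents(2)[OF rep z] prod_eq by simp
    moreover have "real k + 1 \<noteq> 0" by simp
    ultimately show ?thesis by (simp only: add_divide_distrib) simp
  qed
  moreover have "(\<lambda>k. b $ l + (\<Sum>j\<in>UNIV - {l}. b $ j) * (1 / (real k + 1)) + 1 / pi ^ CARD('n) * (\<integral>t. H k t \<partial>normalized_measure \<mu>))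
    \<longlonglongrightarrow> b $ l + (\<Sum>j\<in>UNIV - {l}. b $ j) * 0 + 1 / pi ^ CARD('n) * (\<integral>t. 0 \<partial>normalized_measure \<mu>)"
  proof (intro tendsto_add tendsto_mult tendsto_const integral_dominated_convergence[where w = "\<lambda>_. 1"])
    show "(\<lambda>k. 1 / (real k + 1)) \<longlonglongrightarrow> 0" by real_asymp
    show "AE t in normalized_measure \<mu>. (\<lambda>k. H k t) \<longlonglongrightarrow> 0"
      unfolding H_def by (intro AE_I2) real_asymp
    show "AE t in normalized_measure \<mu>. norm (H k t) \<le> 1" for k
    proof (intro AE_I2)
      fix t :: "real ^ 'n"
      have "1 \<le> (real k + 1)\<^sup>2" by simp
      then have "1 + (t $ l)\<^sup>2 \<le> (t $ l)\<^sup>2 + (real k + 1)\<^sup>2" "0 < (t $ l)\<^sup>2 + (real k + 1)\<^sup>2" by (auto intro: add_nonneg_pos)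
      then show "norm (H k t) \<le> 1" by (simp add: H_def divide_le_eq)
    qed
  qed auto
  ultimately show ?thesis by (simp add: z_def)
qed

text \<open>
  Poisson kernels are exchanged for indicators of intervals one coordinate at a time. In each step the
  remaining factors serve as a density, and the image under the chosen coordinate is a finite measure on
  the line, to which \<open>poisson_determines_intervals\<close> applies.
\<close>

lemma poisson_integrals_determine_intervals:
  fixes \<mu> \<mu>' :: "(real ^ 'n) measure"
  assumes sets: "sets \<mu> = sets borel" "sets \<mu>' = sets borel"
    and growth: "growth_condition \<mu>" "growth_condition \<mu>'"
    and eq: "\<And>z :: 'n \<Rightarrow> complex. (\<And>l. z l \<in> upper_half_plane) \<Longrightarrow>
       (\<integral>\<^sup>+t. ennreal (\<Prod>l\<in>UNIV. poisson (z l) (t $ l)) \<partial>\<mu>) = (\<integral>\<^sup>+t. ennreal (\<Prod>l\<in>UNIV. poisson (z l) (t $ l)) \<partial>\<mu>')"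
    and z: "\<And>l. z l \<in> upper_half_plane"
  shows "(\<integral>\<^sup>+t. ennreal (\<Prod>l\<in>UNIV. if l \<in> J then indicator {a l..b l} (t $ l) else poisson (z l) (t $ l)) \<partial>\<mu>)
    = (\<integral>\<^sup>+t. ennreal (\<Prod>l\<in>UNIV. if l \<in> J then indicator {a l..b l} (t $ l) else poisson (z l) (t $ l)) \<partial>\<mu>')"
  using finite[of J] z
proof (induction J arbitrary: z rule: finite_induct)
  case empty
  then show ?case using eq by simp
next
  case (insert m J)
  define \<phi> where "\<phi> l s = (if l \<in> J then indicator {a l..b l} s else poisson (z l) s)" for l s
  have [measurable]: "\<phi> l \<in> borel_measurable borel" for l unfolding \<phi>_def by measurable
  have \<phi>0: "0 \<le> \<phi> l s" for l s using insert.prems by (simp add: \<phi>_def poisson_nonneg)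
  have "\<exists>C. \<forall>s. \<phi> l s \<le> C * (1 / (1 + s\<^sup>2))" for l
  proof (cases "l \<in> J")
    case True
    have "indicator {a l..b l} s \<le> (1 + (\<bar>a l\<bar> + \<bar>b l\<bar>)\<^sup>2) * (1 / (1 + s\<^sup>2))" for s
    proof (cases "s \<in> {a l..b l}")
      case True
      then have "\<bar>s\<bar>\<^sup>2 \<le> (\<bar>a l\<bar> + \<bar>b l\<bar>)\<^sup>2" by (intro power_mono) auto
      then have "1 \<le> (1 + (\<bar>a l\<bar> + \<bar>b l\<bar>)\<^sup>2) / (1 + s\<^sup>2)"
        using add_pos_nonneg[of 1 "s\<^sup>2"] by (simp add: le_divide_eq)
      then show ?thesis using True by simp
    qed simp
    then show ?thesis using True by (auto simp: \<phi>_def)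
  next
    case False
    define \<rho> where "\<rho> = norm (cayley (z l))"
    have \<rho>: "\<rho> < 1" unfolding \<rho>_def using insert.prems by (rule norm_cayley_lt_1)
    have "poisson (z l) s \<le> (1 + 2 * (1 / (1 - \<rho>))) * (1 / (1 + s\<^sup>2))" for s
    proof -
      have "Re (1 + 2 * cauchy_tail (cayley (z l)) (cayley (of_real s))) \<le> 1 + 2 * (1 / (1 - \<rho>))"
        using complex_Re_le_cmod[of "cauchy_tail (cayley (z l)) (cayley (of_real s))"]
          norm_cauchy_tail_le[of "cayley (of_real s)" "cayley (z l)" \<rho>] \<rho> by (simp add: \<rho>_def)
      then show ?thesis
        unfolding poisson_eq_disc[OF insert.prems] using add_pos_nonneg[of 1 "s\<^sup>2"] by (simp add: divide_right_mono)
    qed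
    then show ?thesis using False by (auto simp: \<phi>_def)
  qed
  then obtain C where C: "\<And>l s. \<phi> l s \<le> C l * (1 / (1 + s\<^sup>2))" by metis
  define g where "g t = (\<Prod>l\<in>UNIV - {m}. \<phi> l (t $ l))" for t :: "real ^ 'n"
  have [measurable]: "g \<in> borel_measurable borel" unfolding g_def by measurable
  have g0: "0 \<le> g t" for t unfolding g_def by (intro prod_nonneg \<phi>0)
  define G where "G t = g t / (1 + (t $ m)\<^sup>2)" for t :: "real ^ 'n"
  have [measurable]: "G \<in> borel_measurable borel" unfolding G_def by measurable
  have pos: "1 + s\<^sup>2 > 0" for s :: real by (simp add: add_pos_nonneg)
  have G0: "0 \<le> G t" for t unfolding G_def using g0 pos by (simp add: less_imp_le)
  have G_le: "G t \<le> (\<Prod>l\<in>UNIV - {m}. C l) * weight t" for t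
  proof -
    have "g t \<le> (\<Prod>l\<in>UNIV - {m}. C l * (1 / (1 + (t $ l)\<^sup>2)))"
      unfolding g_def by (intro prod_mono conjI \<phi>0 C)
    then have "G t \<le> (\<Prod>l\<in>UNIV - {m}. C l * (1 / (1 + (t $ l)\<^sup>2))) / (1 + (t $ m)\<^sup>2)"
      unfolding G_def using pos by (simp add: divide_right_mono less_imp_le)
    also have "\<dots> = (\<Prod>l\<in>UNIV - {m}. C l) * weight t"
      unfolding weight_def prod.distrib by (subst prod.remove[of UNIV m]) (auto simp: mult_ac)
    finally show ?thesis .
  qed
  \<comment> \<open>The factor \<open>1 / (1 + t\<^sub>m\<^sup>2)\<close> in \<open>G\<close> makes the image measure finite.\<close>
  define N where "N \<nu> = distr (density \<nu> (\<lambda>t. ennreal (G t))) borel (\<lambda>t. t $ m)" for \<nu> :: "(real ^ 'n) measure"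
  have fin: "finite_measure (N \<nu>)" if [measurable_cong]: "sets \<nu> = sets borel" and "growth_condition \<nu>" for \<nu>
  proof (rule finite_measureI)
    have "emeasure (N \<nu>) (space (N \<nu>)) = (\<integral>\<^sup>+t. ennreal (G t) \<partial>\<nu>)"
      unfolding N_def by (subst emeasure_distr) (auto simp: emeasure_density intro!: nn_integral_cong)
    also have "\<dots> \<le> (\<integral>\<^sup>+t. ennreal (\<Prod>l\<in>UNIV - {m}. C l) * ennreal (weight t) \<partial>\<nu>)"
    proof (intro nn_integral_mono)
      fix t
      have "ennreal (G t) \<le> ennreal ((\<Prod>l\<in>UNIV - {m}. C l) * weight t)" by (intro ennreal_leI G_le)
      also have "\<dots> = ennreal (\<Prod>l\<in>UNIV - {m}. C l) * ennreal (weight t)"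
        using weight_pos[of t] by (intro ennreal_mult'') auto
      finally show "ennreal (G t) \<le> ennreal (\<Prod>l\<in>UNIV - {m}. C l) * ennreal (weight t)" .
    qed
    also have "\<dots> = ennreal (\<Prod>l\<in>UNIV - {m}. C l) * (\<integral>\<^sup>+t. ennreal (weight t) \<partial>\<nu>)"
      by (intro nn_integral_cmult) measurable
    also have "\<dots> < \<infinity>"
      using \<open>growth_condition \<nu>\<close> unfolding growth_condition_def weight_def by (simp add: ennreal_mult_less_top)
    finally show "emeasure (N \<nu>) (space (N \<nu>)) \<noteq> \<infinity>" by simp
  qed
  have N_int: "(\<integral>\<^sup>+s. ennreal (f s * (1 + s\<^sup>2)) \<partial>N \<nu>) = (\<integral>\<^sup>+t. ennreal (f (t $ m) * g t) \<partial>\<nu>)"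
    if [measurable_cong]: "sets \<nu> = sets borel" and [measurable]: "f \<in> borel_measurable borel" for \<nu> and f :: "real \<Rightarrow> real"
  proof -
    have "(\<integral>\<^sup>+s. ennreal (f s * (1 + s\<^sup>2)) \<partial>N \<nu>) = (\<integral>\<^sup>+t. ennreal (G t) * ennreal (f (t $ m) * (1 + (t $ m)\<^sup>2)) \<partial>\<nu>)"
      unfolding N_def by (subst nn_integral_distr) (auto simp: nn_integral_density)
    also have "\<dots> = (\<integral>\<^sup>+t. ennreal (f (t $ m) * g t) \<partial>\<nu>)"
    proof (intro nn_integral_cong)
      fix t
      have "ennreal (G t) * ennreal (f (t $ m) * (1 + (t $ m)\<^sup>2)) = ennreal (G t * (f (t $ m) * (1 + (t $ m)\<^sup>2)))"
        using G0 by (simp add: ennreal_mult')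
      also have "G t * (f (t $ m) * (1 + (t $ m)\<^sup>2)) = f (t $ m) * g t"
        unfolding G_def using pos[of "t $ m"] by simp
      finally show "ennreal (G t) * ennreal (f (t $ m) * (1 + (t $ m)\<^sup>2)) = ennreal (f (t $ m) * g t)" .
    qed
    finally show ?thesis .
  qed
  have prod_eq: "(\<Prod>l\<in>UNIV. if l \<in> J then indicator {a l..b l} (t $ l) else poisson ((z(m := \<zeta>)) l) (t $ l)) = poisson \<zeta> (t $ m) * g t" for \<zeta> t
  proof -
    have "g t = (\<Prod>l\<in>UNIV - {m}. if l \<in> J then indicator {a l..b l} (t $ l) else poisson ((z(m := \<zeta>)) l) (t $ l))"
      unfolding g_def by (intro prod.cong) (auto simp: \<phi>_def)
    then show ?thesis using insert.hyps by (subst prod.remove[of _ m]) auto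
  qed
  have prod_eq': "(\<Prod>l\<in>UNIV. if l \<in> insert m J then indicator {a l..b l} (t $ l) else poisson (z l) (t $ l)) = indicator {a m..b m} (t $ m) * g t" for t
  proof -
    have "g t = (\<Prod>l\<in>UNIV - {m}. if l \<in> insert m J then indicator {a l..b l} (t $ l) else poisson (z l) (t $ l))"
      unfolding g_def by (intro prod.cong) (auto simp: \<phi>_def)
    then show ?thesis by (subst prod.remove[of _ m]) auto
  qed
  have "(\<integral>\<^sup>+s. ennreal (indicator {a m..b m} s * (1 + s\<^sup>2)) \<partial>N \<mu>) = (\<integral>\<^sup>+s. ennreal (indicator {a m..b m} s * (1 + s\<^sup>2)) \<partial>N \<mu>')"
  proof (rule poisson_determines_intervals)
    fix \<zeta> assume "\<zeta> \<in> upper_half_plane"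
    then show "(\<integral>\<^sup>+s. ennreal (poisson \<zeta> s * (1 + s\<^sup>2)) \<partial>N \<mu>) = (\<integral>\<^sup>+s. ennreal (poisson \<zeta> s * (1 + s\<^sup>2)) \<partial>N \<mu>')"
      using insert.IH[of "z(m := \<zeta>)"] insert.prems unfolding N_int[OF sets(1) poisson_measurable] N_int[OF sets(2) poisson_measurable] prod_eq
      by simp
  qed (use fin sets growth in \<open>auto simp: N_def\<close>)
  then show ?case
    unfolding prod_eq' by (subst (asm) (1 2) N_int) (use sets in auto)
qed

lemma poisson_integrals_determine_measure:
  fixes \<mu> \<mu>' :: "(real ^ 'n) measure"
  assumes sets: "sets \<mu> = sets borel" "sets \<mu>' = sets borel"
    and growth: "growth_condition \<mu>" "growth_condition \<mu>'"
    and eq: "\<And>z :: 'n \<Rightarrow> complex. (\<And>l. z l \<in> upper_half_plane) \<Longrightarrow>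
       (\<integral>\<^sup>+t. ennreal (\<Prod>l\<in>UNIV. poisson (z l) (t $ l)) \<partial>\<mu>) = (\<integral>\<^sup>+t. ennreal (\<Prod>l\<in>UNIV. poisson (z l) (t $ l)) \<partial>\<mu>')"
  shows "\<mu> = \<mu>'"
proof -
  have [measurable_cong]: "sets \<mu> = sets borel" "sets \<mu>' = sets borel" by fact+
  have prod_ind: "(\<Prod>l\<in>UNIV. if l \<in> UNIV then indicator {a $ l..b $ l} (t $ l) else poisson \<i> (t $ l)) = indicat_real {a..b} t" for a b t :: "real ^ 'n"
  proof (cases "t \<in> {a..b}")
    case True
    then show ?thesis by (simp add: less_eq_vec_def)
  next
    case False
    then obtain l where "t $ l \<notin> {a $ l..b $ l}" by (auto simp: less_eq_vec_def)
    then have "(\<Prod>l\<in>UNIV. if l \<in> UNIV then indicator {a $ l..b $ l} (t $ l) else poisson \<i> (t $ l)) = 0"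
      by (intro prod_zero finite bexI[of _ l]) auto
    then show ?thesis using False by simp
  qed
  have box: "emeasure \<mu> {a..b} = emeasure \<mu>' {a..b}" for a b
  proof -
    have "(\<integral>\<^sup>+t. ennreal (indicator {a..b} t) \<partial>\<mu>) = (\<integral>\<^sup>+t. ennreal (indicator {a..b} t) \<partial>\<mu>')"
      using poisson_integrals_determine_intervals[OF sets growth eq, of "\<lambda>_. \<i>" UNIV "vec_nth a" "vec_nth b"]
      unfolding prod_ind by (simp add: upper_half_plane_def)
    then show ?thesis by (simp add: ennreal_indicator sets)
  qed
  show ?thesis
  proof (rule measure_eqI_generator_eq)
    let ?E = "range (\<lambda>(a, b). {a..b :: real ^ 'n})"
    have "{a..b} \<inter> {c..d} = {(\<chi> l. max (a $ l) (c $ l))..(\<chi> l. min (b $ l) (d $ l))}" for a b c d :: "real ^ 'n"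
      by (auto simp: less_eq_vec_def)
    then show "Int_stable ?E" unfolding Int_stable_def by fastforce
    show "sets \<mu> = sigma_sets UNIV ?E" "sets \<mu>' = sigma_sets UNIV ?E"
      unfolding sets by (subst borel_eq_atLeastAtMost, simp)+
    let ?A = "\<lambda>i::nat. {(\<chi> _. - real i)..(\<chi> _. real i)} :: (real ^ 'n) set"
    show "range ?A \<subseteq> ?E" by auto
    show "(\<Union>i. ?A i) = UNIV"
    proof (intro equalityI subset_UNIV subsetI)
      fix t :: "real ^ 'n"
      obtain i :: nat where i: "norm t \<le> real i" using real_arch_simple by blast
      have "\<bar>t $ l\<bar> \<le> real i" for l using component_le_norm_cart[of t l] i by linarith
      then show "t \<in> (\<Union>i. ?A i)" by (auto simp: less_eq_vec_def abs_le_iff minus_le_iff intro!: exI[of _ i])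
    qed
    show "emeasure \<mu> (?A i) \<noteq> \<infinity>" for i
    proof -
      have "indicator (?A i) t \<le> ennreal ((1 + (real i)\<^sup>2) ^ CARD('n)) * ennreal (weight t)" for t :: "real ^ 'n"
      proof (cases "t \<in> ?A i")
        case True
        have "1 \<le> (1 + (real i)\<^sup>2) * (1 / (1 + (t $ l)\<^sup>2))" for l
        proof -
          have "\<bar>t $ l\<bar> \<le> real i" using True by (auto simp: less_eq_vec_def abs_le_iff minus_le_iff)
          then have "\<bar>t $ l\<bar>\<^sup>2 \<le> (real i)\<^sup>2" by (intro power_mono) auto
          then show ?thesis using add_pos_nonneg[of 1 "(t $ l)\<^sup>2"] by (simp add: le_divide_eq)
        qed
        then have "1 \<le> (\<Prod>l\<in>(UNIV::'n set). (1 + (real i)\<^sup>2) * (1 / (1 + (t $ l)\<^sup>2)))"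
          by (intro prod_ge_1) auto
        also have "\<dots> = (1 + (real i)\<^sup>2) ^ CARD('n) * weight t" unfolding weight_def prod.distrib by simp
        finally have "ennreal 1 \<le> ennreal ((1 + (real i)\<^sup>2) ^ CARD('n) * weight t)" by (intro ennreal_leI)
        then show ?thesis using True weight_pos[of t] by (simp add: ennreal_mult'')
      qed simp
      then have "(\<integral>\<^sup>+t. indicator (?A i) t \<partial>\<mu>) \<le> (\<integral>\<^sup>+t. ennreal ((1 + (real i)\<^sup>2) ^ CARD('n)) * ennreal (weight t) \<partial>\<mu>)"
        by (intro nn_integral_mono)
      then have "emeasure \<mu> (?A i) \<le> (\<integral>\<^sup>+t. ennreal ((1 + (real i)\<^sup>2) ^ CARD('n)) * ennreal (weight t) \<partial>\<mu>)"
        by (simp add: sets del: ennreal_power)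
      also have "\<dots> = ennreal ((1 + (real i)\<^sup>2) ^ CARD('n)) * (\<integral>\<^sup>+t. ennreal (weight t) \<partial>\<mu>)"
        by (intro nn_integral_cmult) measurable
      also have "\<dots> < \<infinity>"
        using growth(1) unfolding growth_condition_def weight_def by (simp add: ennreal_mult_less_top del: ennreal_power)
      finally show ?thesis by simp
    qed
  qed (use box in auto)
qed

lemma represents_unique:
  fixes q :: "complex ^ 'n \<Rightarrow> complex"
  assumes rep: "represents q a b \<mu>" "represents q a' b' \<mu>'"
  shows "a = a' \<and> b = b' \<and> \<mu> = \<mu>'"
proof (intro conjI)
  show "a = a'" using represents_constant_term[OF rep(1)] represents_constant_term[OF rep(2)] by simp
  show b: "b = b'"
    unfolding vec_eq_iff
  proof
    fix l show "b $ l = b' $ l"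
      using LIMSEQ_unique[OF represents_linear_term[OF rep(1)] represents_linear_term[OF rep(2)]] .
  qed
  have sets: "sets \<mu> = sets borel" "sets \<mu>' = sets borel"
    and growth: "growth_condition \<mu>" "growth_condition \<mu>'"
    using rep by (auto simp: represents_def)
  show "\<mu> = \<mu>'"
  proof (rule poisson_integrals_determine_measure[OF sets growth])
    fix z' :: "'n \<Rightarrow> complex" assume z': "\<And>l. z' l \<in> upper_half_plane"
    define z where "z = (\<chi> l. z' l)"
    have z: "z \<in> poly_upper_half_plane" using z' by (simp add: z_def poly_upper_half_plane_def)
    define P where "P t = (\<Prod>l\<in>UNIV. disc_poisson (cayley (z $ l)) (line_to_circle l t))" for t
    have [measurable]: "P \<in> borel_measurable borel" unfolding P_def disc_poisson_def by measurable
    have P0: "0 \<le> P t" for t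
      unfolding P_def using z by (intro prod_nonneg disc_poisson_nonneg) (auto simp: line_to_circle_def cayley_poly_upper_half_plane)
    have *: "(\<integral>\<^sup>+t. ennreal (\<Prod>l\<in>UNIV. poisson (z' l) (t $ l)) \<partial>\<nu>) = ennreal (\<integral>t. P t \<partial>normalized_measure \<nu>)"
      if "represents q \<alpha> \<beta> \<nu>" for \<alpha> \<beta> \<nu>
    proof -
      have sets: "sets \<nu> = sets borel" using that by (simp add: represents_def)
      have "(\<Prod>l\<in>UNIV. poisson (z' l) (t $ l)) = weight t * P t" for t
      proof -
        have "1 + (t $ l)\<^sup>2 \<noteq> 0" for l using add_pos_nonneg[of 1 "(t $ l)\<^sup>2"] by simp
        then show ?thesis
          unfolding weight_def P_def prod.distrib[symmetric] by (intro prod.cong) (auto simp: disc_poisson_cayley z' z_def)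
      qed
      then have "(\<integral>\<^sup>+t. ennreal (\<Prod>l\<in>UNIV. poisson (z' l) (t $ l)) \<partial>\<nu>) = (\<integral>\<^sup>+t. ennreal (weight t) * ennreal (P t) \<partial>\<nu>)"
        using P0 by (simp add: ennreal_mult less_imp_le[OF weight_pos])
      also have "\<dots> = (\<integral>\<^sup>+t. ennreal (P t) \<partial>normalized_measure \<nu>)"
        by (rule nn_integral_normalized_measure[OF sets]) measurable
      also have "\<dots> = ennreal (\<integral>t. P t \<partial>normalized_measure \<nu>)"
        using Im_of_represents(1)[OF that z] P0 unfolding P_def[symmetric] by (intro nn_integral_eq_integral) auto
      finally show ?thesis .
    qed
    have "(\<integral>t. P t \<partial>normalized_measure \<mu>) = (\<integral>t. P t \<partial>normalized_measure \<mu>')"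
      using Im_of_represents(2)[OF rep(1) z] Im_of_represents(2)[OF rep(2) z] unfolding P_def[symmetric] b by simp
    then show "(\<integral>\<^sup>+t. ennreal (\<Prod>l\<in>UNIV. poisson (z' l) (t $ l)) \<partial>\<mu>) = (\<integral>\<^sup>+t. ennreal (\<Prod>l\<in>UNIV. poisson (z' l) (t $ l)) \<partial>\<mu>')"
      unfolding *[OF rep(1)] *[OF rep(2)] by simp
  qed
qed

section \<open>Cauchy formulas on the torus\<close>

text \<open>
  The circle is parametrized by \<open>[0, 1]\<close>, so that Lebesgue measure there is normalized arc length.
\<close>

definition circle_point :: "real \<Rightarrow> complex" where
  "circle_point x = cis (2 * pi * x)"

lemma norm_circle_point [simp]: "norm (circle_point x) = 1"
  by (simp add: circle_point_def)

lemma continuous_circle_point: "continuous_on A circle_point"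
  unfolding circle_point_def[abs_def] by (intro continuous_intros)

lemma circle_point_measurable [measurable]: "circle_point \<in> borel_measurable borel"
  by (intro borel_measurable_continuous_onI continuous_circle_point)

definition angle_measure :: "real measure" where
  "angle_measure = density lborel (\<lambda>x. ennreal (indicator {0..1} x))"

lemma sets_angle_measure [simp, measurable_cong]: "sets angle_measure = sets borel"
  by (simp add: angle_measure_def)

lemma space_angle_measure [simp]: "space angle_measure = UNIV"
  by (simp add: angle_measure_def)

lemma prob_space_angle_measure: "prob_space angle_measure"
  by (rule prob_spaceI) (simp add: angle_measure_def emeasure_density ennreal_indicator)

interpretation angle: prob_space angle_measure
  by (rule prob_space_angle_measure)

lemma integral_angle_measure:
  fixes f :: "real \<Rightarrow> complex"
  assumes f: "continuous_on UNIV f" and I: "(f has_integral I) {0..1}"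
  shows "(\<integral>x. f x \<partial>angle_measure) = I"
proof -
  have [measurable]: "f \<in> borel_measurable borel" using f by (rule borel_measurable_continuous_onI)
  have "set_integrable lborel {0..1} f"
    by (rule borel_integrable_atLeastAtMost') (rule continuous_on_subset[OF f], simp)
  from set_borel_integral_eq_integral(2)[OF this] have "(\<integral>x. indicator {0..1} x *\<^sub>R f x \<partial>lborel) = integral {0..1} f"
    by (simp add: set_lebesgue_integral_def)
  then show ?thesis
    unfolding angle_measure_def using I by (subst integral_density) (auto simp: integral_unique)
qed

lemma cauchy_mean:
  assumes g: "continuous_on (cball 0 1) g" "g holomorphic_on ball 0 1" and \<zeta>: "norm \<zeta> < 1"
  shows "(\<integral>x. (1 + cauchy_tail \<zeta> (circle_point x)) * g (circle_point x) \<partial>angle_measure) = g \<zeta>"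
proof (rule integral_angle_measure)
  have nz: "circle_point x - \<zeta> \<noteq> 0" for x
    using \<zeta> norm_circle_point[of x] by auto
  show "continuous_on UNIV (\<lambda>x. (1 + cauchy_tail \<zeta> (circle_point x)) * g (circle_point x))"
    unfolding cauchy_tail_def using nz
    by (intro continuous_intros continuous_circle_point continuous_on_compose2[OF g(1) continuous_circle_point]) auto
  have "((\<lambda>u. g u / (u - \<zeta>)) has_contour_integral (2 * of_real pi * \<i> * g \<zeta>)) (circlepath 0 1)"
    using \<zeta> by (intro Cauchy_integral_circlepath g) auto
  then have "((\<lambda>x. g (circlepath 0 1 x) / (circlepath 0 1 x - \<zeta>) * vector_derivative (circlepath 0 1) (at x within {0..1}))
      has_integral (2 * of_real pi * \<i> * g \<zeta>)) {0..1}"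
    unfolding has_contour_integral_def .
  then have "((\<lambda>x. 2 * of_real pi * \<i> * ((1 + cauchy_tail \<zeta> (circle_point x)) * g (circle_point x)))
      has_integral (2 * of_real pi * \<i> * g \<zeta>)) {0..1}"
  proof (rule has_integral_eq[rotated])
    fix x :: real assume x: "x \<in> {0..1}"
    have e: "exp (2 * of_real pi * \<i> * of_real x) = circle_point x"
      by (simp add: circle_point_def cis_conv_exp mult_ac)
    have "circlepath 0 1 x = circle_point x" by (simp add: circlepath e)
    moreover have "vector_derivative (circlepath 0 1) (at x within {0..1}) = 2 * of_real pi * \<i> * circle_point x"
      using x by (simp add: vector_derivative_circlepath01 e)
    ultimately show "g (circlepath 0 1 x) / (circlepath 0 1 x - \<zeta>) * vector_derivative (circlepath 0 1) (at x within {0..1})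
       = 2 * of_real pi * \<i> * ((1 + cauchy_tail \<zeta> (circle_point x)) * g (circle_point x))"
      unfolding one_plus_cauchy_tail[OF nz] by simp
  qed
  from has_integral_mult_right[OF this, of "1 / (2 * of_real pi * \<i>)"]
  show "((\<lambda>x. (1 + cauchy_tail \<zeta> (circle_point x)) * g (circle_point x)) has_integral g \<zeta>) {0..1}"
    by simp
qed

lemma circle_mean:
  assumes g: "continuous_on (cball 0 1) g" "g holomorphic_on ball 0 1"
  shows "(\<integral>x. g (circle_point x) \<partial>angle_measure) = g 0"
  using cauchy_mean[OF g, of 0] by (simp add: cauchy_tail_def)

lemma cnj_cauchy_tail_circle:
  assumes \<xi>: "norm \<xi> = 1" and \<zeta>: "norm \<zeta> < 1"
  shows "cnj (cauchy_tail \<zeta> \<xi>) = cnj \<zeta> * \<xi> / (1 - cnj \<zeta> * \<xi>)"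
proof -
  have 1: "\<xi> * cnj \<xi> = 1" using \<xi> by (simp add: complex_norm_square[symmetric])
  then have "\<xi> * (cnj \<xi> - cnj \<zeta>) = 1 - cnj \<zeta> * \<xi>" by (simp add: algebra_simps)
  moreover have "\<xi> \<noteq> 0" using \<xi> by auto
  ultimately have "cnj \<zeta> * \<xi> / (1 - cnj \<zeta> * \<xi>) = cnj \<zeta> / (cnj \<xi> - cnj \<zeta>)"
    by (metis mult.commute mult_divide_mult_cancel_left_if)
  then show ?thesis by (simp add: cauchy_tail_def)
qed

text \<open>
  On the circle \<open>cnj \<omega> = 1 / \<omega>\<close>, so the conjugate of the tail is the boundary value of a holomorphic function
  that vanishes at the origin.
\<close>

lemma conjugate_tail_mean:
  assumes g: "continuous_on (cball 0 1) g" "g holomorphic_on ball 0 1" and \<zeta>: "norm \<zeta> < 1"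
  shows "(\<integral>x. cnj (cauchy_tail \<zeta> (circle_point x)) * g (circle_point x) \<partial>angle_measure) = 0"
proof -
  define k where "k \<xi> = cnj \<zeta> * \<xi> / (1 - cnj \<zeta> * \<xi>) * g \<xi>" for \<xi>
  have nz: "1 - cnj \<zeta> * \<xi> \<noteq> 0" if "norm \<xi> \<le> 1" for \<xi>
  proof -
    have "norm (cnj \<zeta> * \<xi>) \<le> norm \<zeta> * 1" unfolding norm_mult using that by (intro mult_mono) auto
    then have "norm (cnj \<zeta> * \<xi>) < 1" using \<zeta> by simp
    then show ?thesis by auto
  qed
  have "(\<integral>x. k (circle_point x) \<partial>angle_measure) = k 0"
  proof (rule circle_mean)
    show "continuous_on (cball 0 1) k"
      unfolding k_def[abs_def] using nz by (intro continuous_intros g) auto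
    show "k holomorphic_on ball 0 1"
      unfolding k_def[abs_def] using nz by (intro holomorphic_intros g) auto
  qed
  then show ?thesis by (simp add: k_def cnj_cauchy_tail_circle[OF norm_circle_point \<zeta>])
qed

definition closed_polydisc :: "('n \<Rightarrow> complex) set" where
  "closed_polydisc = {\<xi>. \<forall>l. norm (\<xi> l) \<le> 1}"

text \<open>
  Continuity and holomorphy are stated along coordinate discs, where the one-variable Cauchy formula acts;
  measurability and boundedness make Fubini's theorem applicable.
\<close>

definition polydisc_algebra :: "(('n::finite \<Rightarrow> complex) \<Rightarrow> complex) \<Rightarrow> bool" where
  "polydisc_algebra h \<longleftrightarrow> h \<in> borel_measurable borel \<and> (\<exists>B. \<forall>\<xi>\<in>closed_polydisc. norm (h \<xi>) \<le> B) \<and>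
     (\<forall>\<xi>\<in>closed_polydisc. \<forall>l. continuous_on (cball 0 1) (\<lambda>u. h (\<xi>(l := u))) \<and> (\<lambda>u. h (\<xi>(l := u))) holomorphic_on ball 0 1)"

definition torus_angles :: "'n set \<Rightarrow> ('n \<Rightarrow> real) measure" where
  "torus_angles J = PiM J (\<lambda>_. angle_measure)"

interpretation angles: product_sigma_finite "\<lambda>_. angle_measure" by unfold_locales

lemma prob_space_torus_angles: "prob_space (torus_angles J)"
  unfolding torus_angles_def by (rule prob_space_PiM) (rule prob_space_angle_measure)

lemma partial_circle_points_measurable:
  "(\<lambda>x l. if l \<in> J then circle_point (x l) else p l) \<in> measurable (torus_angles J) (borel :: ('n::finite \<Rightarrow> complex) measure)"
proof -
  have "(\<lambda>x l. if l \<in> J then circle_point (x l) else p l) \<in> measurable (torus_angles J) (PiM UNIV (\<lambda>_::'n. borel :: complex measure))"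
  proof (rule measurable_PiM_single')
    fix l :: 'n
    show "(\<lambda>x. if l \<in> J then circle_point (x l) else p l) \<in> borel_measurable (torus_angles J)"
      unfolding torus_angles_def by (cases "l \<in> J") simp_all
  qed auto
  then show ?thesis by (simp add: measurable_cong_sets[OF refl sets_PiM_equal_borel])
qed

text \<open>
  The coordinates outside \<open>J\<close> are frozen at \<open>p\<close>. In each step the new coordinate is integrated first, with
  a one-variable kernel \<open>Y\<close> that reproduces the value at \<open>e\<close>; this moves the frozen point.
\<close>

lemma iterated_mean:
  fixes Y :: "'n::finite \<Rightarrow> real \<Rightarrow> complex"
  assumes h: "polydisc_algebra h"
    and Y [measurable]: "\<And>l. Y l \<in> borel_measurable borel" and YB: "\<And>l x. norm (Y l x) \<le> B l"
    and eval: "\<And>l g. continuous_on (cball 0 1) g \<Longrightarrow> g holomorphic_on ball 0 1 \<Longrightarrow>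
        (\<integral>x. Y l x * g (circle_point x) \<partial>angle_measure) = g (e l)"
    and e: "\<And>l. norm (e l) \<le> 1" and p: "\<And>l. norm (p l) \<le> 1"
  shows "(\<integral>x. (\<Prod>l\<in>J. Y l (x l)) * h (\<lambda>l. if l \<in> J then circle_point (x l) else p l) \<partial>torus_angles J)
     = h (\<lambda>l. if l \<in> J then e l else p l)"
  using finite[of J] p
proof (induction J arbitrary: p rule: finite_induct)
  case empty
  interpret prob_space "torus_angles {} :: ('n \<Rightarrow> real) measure" by (rule prob_space_torus_angles)
  show ?case by (simp add: prob_space)
next
  case (insert i J)
  interpret prob_space "torus_angles (insert i J)" by (rule prob_space_torus_angles)
  have [measurable]: "h \<in> borel_measurable borel" using h by (simp add: polydisc_algebra_def)
  obtain C where C: "\<And>\<xi>. \<xi> \<in> closed_polydisc \<Longrightarrow> norm (h \<xi>) \<le> C" using h by (auto simp: polydisc_algebra_def)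
  define f where "f x = (\<Prod>l\<in>insert i J. Y l (x l)) * h (\<lambda>l. if l \<in> insert i J then circle_point (x l) else p l)" for x
  have "integrable (torus_angles (insert i J)) f"
  proof (rule integrable_const_bound[where B = "(\<Prod>l\<in>insert i J. B l) * C"])
    have B0: "0 \<le> B l" for l using YB[of l 0] norm_ge_zero order_trans by blast
    show "AE x in torus_angles (insert i J). norm (f x) \<le> (\<Prod>l\<in>insert i J. B l) * C"
    proof (rule AE_I2)
      fix x
      have "(\<lambda>l. if l \<in> insert i J then circle_point (x l) else p l) \<in> closed_polydisc"
        using insert.prems by (auto simp: closed_polydisc_def)
      from C[OF this] show "norm (f x) \<le> (\<Prod>l\<in>insert i J. B l) * C"
        unfolding f_def norm_mult prod_norm[symmetric]
        by (intro mult_mono prod_mono prod_nonneg) (auto simp: YB B0)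
    qed
    have [measurable]: "(\<lambda>x. x l) \<in> borel_measurable (torus_angles (insert i J))" if "l \<in> insert i J" for l
      using that measurable_component_singleton[of l "insert i J" "\<lambda>_. angle_measure"] unfolding torus_angles_def by simp
    have "(\<lambda>x. \<Prod>l\<in>insert i J. Y l (x l)) \<in> borel_measurable (torus_angles (insert i J))"
      by (intro borel_measurable_prod) measurable
    moreover have "(\<lambda>x. h (\<lambda>l. if l \<in> insert i J then circle_point (x l) else p l)) \<in> borel_measurable (torus_angles (insert i J))"
      by (rule measurable_compose[OF partial_circle_points_measurable]) measurable
    ultimately show "f \<in> borel_measurable (torus_angles (insert i J))"
      unfolding f_def by (rule borel_measurable_times)
  qed
  then have "(\<integral>x. f x \<partial>torus_angles (insert i J)) = (\<integral>x. (\<integral>y. f (x(i := y)) \<partial>angle_measure) \<partial>torus_angles J)"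
    unfolding torus_angles_def using insert.hyps by (intro angles.product_integral_insert) auto
  also have "\<dots> = (\<integral>x. (\<Prod>l\<in>J. Y l (x l)) * h (\<lambda>l. if l \<in> J then circle_point (x l) else (p(i := e i)) l) \<partial>torus_angles J)"
  proof (rule Bochner_Integration.integral_cong[OF refl])
    fix x :: "'n \<Rightarrow> real"
    define \<xi> where "\<xi> = (\<lambda>l. if l \<in> J then circle_point (x l) else p l)"
    have "\<xi> \<in> closed_polydisc" using insert.prems by (auto simp: \<xi>_def closed_polydisc_def)
    then have g: "continuous_on (cball 0 1) (\<lambda>u. h (\<xi>(i := u)))" "(\<lambda>u. h (\<xi>(i := u))) holomorphic_on ball 0 1"
      using h by (auto simp: polydisc_algebra_def)
    have "f (x(i := y)) = (\<Prod>l\<in>J. Y l (x l)) * (Y i y * h (\<xi>(i := circle_point y)))" for y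
    proof -
      have "(\<Prod>l\<in>J. Y l ((x(i := y)) l)) = (\<Prod>l\<in>J. Y l (x l))"
        using insert.hyps by (intro prod.cong) auto
      moreover have "(\<lambda>l. if l \<in> insert i J then circle_point ((x(i := y)) l) else p l) = \<xi>(i := circle_point y)"
        using insert.hyps by (auto simp: \<xi>_def)
      ultimately show ?thesis
        unfolding f_def using insert.hyps by (simp only: prod.insert) (simp add: mult_ac)
    qed
    then have "(\<integral>y. f (x(i := y)) \<partial>angle_measure) = (\<Prod>l\<in>J. Y l (x l)) * h (\<xi>(i := e i))"
      using eval[OF g] by simp
    also have "\<xi>(i := e i) = (\<lambda>l. if l \<in> J then circle_point (x l) else (p(i := e i)) l)"
      using insert.hyps by (auto simp: \<xi>_def)
    finally show "(\<integral>y. f (x(i := y)) \<partial>angle_measure) = (\<Prod>l\<in>J. Y l (x l)) * h (\<lambda>l. if l \<in> J then circle_point (x l) else (p(i := e i)) l)" .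
  qed
  also have "\<dots> = h (\<lambda>l. if l \<in> J then e l else (p(i := e i)) l)"
    using insert.prems e by (intro insert.IH) auto
  also have "(\<lambda>l. if l \<in> J then e l else (p(i := e i)) l) = (\<lambda>l. if l \<in> insert i J then e l else p l)"
    using insert.hyps by auto
  finally show ?case unfolding f_def .
qed

lemma torus_mean:
  fixes Y :: "'n::finite \<Rightarrow> real \<Rightarrow> complex"
  assumes h: "polydisc_algebra h"
    and Y: "\<And>l. Y l \<in> borel_measurable borel" and YB: "\<And>l x. norm (Y l x) \<le> B l"
    and eval: "\<And>l g. continuous_on (cball 0 1) g \<Longrightarrow> g holomorphic_on ball 0 1 \<Longrightarrow>
        (\<integral>x. Y l x * g (circle_point x) \<partial>angle_measure) = g (e l)"
    and e: "\<And>l. norm (e l) \<le> 1"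
  shows "(\<integral>x. (\<Prod>l\<in>UNIV. Y l (x l)) * h (\<lambda>l. circle_point (x l)) \<partial>torus_angles UNIV) = h e"
  using iterated_mean[OF h Y YB eval e, of "\<lambda>_. 0" UNIV] by simp

lemma disc_function_circle_measurable [measurable]:
  "(\<lambda>x. cauchy_tail \<zeta> (circle_point x)) \<in> borel_measurable borel"
  "(\<lambda>x. disc_factor r \<zeta> (circle_point x)) \<in> borel_measurable borel"
proof -
  have [measurable]: "cnj \<in> borel_measurable borel"
    by (intro borel_measurable_continuous_onI continuous_intros)
  show "(\<lambda>x. cauchy_tail \<zeta> (circle_point x)) \<in> borel_measurable borel"
    unfolding cauchy_tail_def by measurable
  show "(\<lambda>x. disc_factor r \<zeta> (circle_point x)) \<in> borel_measurable borel"
    unfolding disc_factor_def cauchy_tail_def by measurable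
qed

lemma component_torus_angles_measurable [measurable]: "(\<lambda>x. x l) \<in> borel_measurable (torus_angles UNIV)"
  using measurable_component_singleton[of l UNIV "\<lambda>_. angle_measure"] unfolding torus_angles_def by simp

lemma circle_points_measurable:
  "(\<lambda>x l. circle_point (x l)) \<in> measurable (torus_angles UNIV) (borel :: ('n::finite \<Rightarrow> complex) measure)"
  using partial_circle_points_measurable[of UNIV] by simp

lemma integrable_torus_polydisc_algebra:
  fixes Y :: "('n::finite \<Rightarrow> real) \<Rightarrow> complex"
  assumes h: "polydisc_algebra h" and [measurable]: "Y \<in> borel_measurable (torus_angles UNIV)" and Y: "\<And>x. norm (Y x) \<le> B"
  shows "integrable (torus_angles UNIV) (\<lambda>x. Y x * h (\<lambda>l. circle_point (x l)))"
proof -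
  interpret prob_space "torus_angles UNIV :: ('n \<Rightarrow> real) measure" by (rule prob_space_torus_angles)
  obtain C where C: "\<And>\<xi>. \<xi> \<in> closed_polydisc \<Longrightarrow> norm (h \<xi>) \<le> C" using h by (auto simp: polydisc_algebra_def)
  have [measurable]: "h \<in> borel_measurable borel" using h by (simp add: polydisc_algebra_def)
  have [measurable]: "(\<lambda>x. h (\<lambda>l. circle_point (x l))) \<in> borel_measurable (torus_angles UNIV)"
    by (rule measurable_compose[OF circle_points_measurable]) measurable
  have "0 \<le> B" using order_trans[OF norm_ge_zero Y] .
  then have "norm (Y x * h (\<lambda>l. circle_point (x l))) \<le> B * C" for x
    unfolding norm_mult by (intro mult_mono Y C) (auto simp: closed_polydisc_def)
  then show ?thesis
    by (intro integrable_const_bound[where B = "B * C"]) auto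
qed

lemma norm_prod_disc_factor_circle:
  fixes \<zeta> :: "'n::finite \<Rightarrow> complex"
  assumes "\<And>l. norm (\<zeta> l) < 1"
  shows "norm (\<Prod>l\<in>J. disc_factor (\<rho> l) (\<zeta> l) (circle_point (x l))) \<le> (\<Prod>l\<in>J. 1 / (1 - norm (\<zeta> l)))"
  unfolding prod_norm[symmetric] using assms by (intro prod_mono) (auto intro!: norm_disc_factor_le)

lemma prod_disc_factor_circle_measurable [measurable]:
  "(\<lambda>x. \<Prod>l\<in>UNIV. disc_factor (\<rho> l) (\<zeta> l) (circle_point (x l))) \<in> borel_measurable (torus_angles (UNIV :: 'n::finite set))"
  by (intro borel_measurable_prod measurable_compose[OF component_torus_angles_measurable]) measurable

text \<open>
  Integrating first over a coordinate with index 1 already gives zero.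
\<close>

lemma antiholomorphic_moment_eq_0:
  fixes \<zeta> :: "'n::finite \<Rightarrow> complex"
  assumes h: "polydisc_algebra h" and \<zeta>: "\<And>l. norm (\<zeta> l) < 1" and \<rho>: "\<rho> i = 1"
  shows "(\<integral>x. (\<Prod>l\<in>UNIV. disc_factor (\<rho> l) (\<zeta> l) (circle_point (x l))) * h (\<lambda>l. circle_point (x l)) \<partial>torus_angles UNIV) = 0"
proof -
  define J where "J = UNIV - {i}"
  have J: "insert i J = UNIV" "i \<notin> J" "finite J" by (auto simp: J_def)
  define f where "f x = (\<Prod>l\<in>UNIV. disc_factor (\<rho> l) (\<zeta> l) (circle_point (x l))) * h (\<lambda>l. circle_point (x l))" for x
  have "integrable (torus_angles UNIV) f"
    unfolding f_def using norm_prod_disc_factor_circle[OF \<zeta>] by (intro integrable_torus_polydisc_algebra[OF h]) measurable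
  then have "(\<integral>x. f x \<partial>torus_angles UNIV) = (\<integral>x. (\<integral>y. f (x(i := y)) \<partial>angle_measure) \<partial>torus_angles J)"
    unfolding torus_angles_def J(1)[symmetric] using J(2,3) by (intro angles.product_integral_insert) auto
  also have "\<dots> = (\<integral>x. 0 \<partial>torus_angles J)"
  proof (rule Bochner_Integration.integral_cong[OF refl])
    fix x :: "'n \<Rightarrow> real"
    define \<xi> where "\<xi> = (\<lambda>l. circle_point (x l))"
    have "\<xi> \<in> closed_polydisc" by (auto simp: \<xi>_def closed_polydisc_def)
    then have g: "continuous_on (cball 0 1) (\<lambda>u. h (\<xi>(i := u)))" "(\<lambda>u. h (\<xi>(i := u))) holomorphic_on ball 0 1"
      using h by (auto simp: polydisc_algebra_def)
    have "f (x(i := y)) = (\<Prod>l\<in>J. disc_factor (\<rho> l) (\<zeta> l) (circle_point (x l))) * (cnj (cauchy_tail (\<zeta> i) (circle_point y)) * h (\<xi>(i := circle_point y)))" for y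
    proof -
      have "(\<Prod>l\<in>UNIV. disc_factor (\<rho> l) (\<zeta> l) (circle_point ((x(i := y)) l)))
        = cnj (cauchy_tail (\<zeta> i) (circle_point y)) * (\<Prod>l\<in>J. disc_factor (\<rho> l) (\<zeta> l) (circle_point (x l)))"
        unfolding J_def using \<rho> by (subst prod.remove[of _ i]) (auto intro!: prod.cong)
      moreover have "(\<lambda>l. circle_point ((x(i := y)) l)) = \<xi>(i := circle_point y)" by (auto simp: \<xi>_def)
      ultimately show ?thesis unfolding f_def by (simp add: mult_ac)
    qed
    then show "(\<integral>y. f (x(i := y)) \<partial>angle_measure) = 0"
      using conjugate_tail_mean[OF g \<zeta>[of i]] by simp
  qed
  finally show ?thesis by (simp add: f_def)
qed

lemma integral_plus_cnj:
  fixes F G :: "'a \<Rightarrow> complex"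
  assumes "integrable M F" "integrable M G"
  shows "integrable M (\<lambda>x. F x + cnj (G x))" "(\<integral>x. F x + cnj (G x) \<partial>M) = (\<integral>x. F x \<partial>M) + cnj (\<integral>x. G x \<partial>M)"
  using assms by simp_all

text \<open>
  Write \<open>2 Re h = h + cnj h\<close>. An index 1 makes the moment of \<open>h\<close> vanish. Conjugation exchanges the indices
  1 and \<open>-1\<close>, so an index \<open>-1\<close> makes the moment of \<open>cnj h\<close> vanish.
\<close>

lemma mixed_moment_Re_eq_0:
  fixes \<zeta> :: "'n::finite \<Rightarrow> complex" and \<rho> :: "int ^ 'n"
  assumes h: "polydisc_algebra h" and \<zeta>: "\<And>l. norm (\<zeta> l) < 1" and \<rho>: "\<rho> \<in> mixed_indices"
  shows "(\<integral>x. (\<Prod>l\<in>UNIV. disc_factor (\<rho> $ l) (\<zeta> l) (circle_point (x l))) * of_real (Re (h (\<lambda>l. circle_point (x l)))) \<partial>torus_angles UNIV) = 0"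
proof -
  obtain i j where ij: "\<rho> $ i = 1" "\<rho> $ j = -1" and *: "\<And>l. \<rho> $ l \<in> {-1,0,1}"
    using \<rho> unfolding mixed_indices_def by blast
  define X where "X \<rho> x = (\<Prod>l\<in>UNIV. disc_factor (\<rho> l) (\<zeta> l) (circle_point (x l)))" for \<rho> :: "'n \<Rightarrow> int" and x
  define H where "H x = h (\<lambda>l. circle_point (x l))" for x
  have int: "integrable (torus_angles UNIV) (\<lambda>x. X \<rho> x * H x)" for \<rho>
    unfolding X_def H_def using norm_prod_disc_factor_circle[OF \<zeta>] by (intro integrable_torus_polydisc_algebra[OF h]) measurable
  have zero: "(\<integral>x. X \<rho> x * H x \<partial>torus_angles UNIV) = 0" if "\<rho> i = 1" for \<rho> i
    unfolding X_def H_def by (rule antiholomorphic_moment_eq_0[where i = i and \<rho> = \<rho>, OF h \<zeta> that])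
  have "disc_factor (\<rho> $ l) (\<zeta> l) \<xi> = cnj (disc_factor (- (\<rho> $ l)) (\<zeta> l) \<xi>)" for l \<xi>
    using *[of l] by auto
  then have cX: "X (vec_nth \<rho>) x = cnj (X (\<lambda>l. - (\<rho> $ l)) x)" for x
    unfolding X_def cnj_prod by simp
  have "X (vec_nth \<rho>) x * of_real (Re (H x)) = (X (vec_nth \<rho>) x * H x + cnj (X (\<lambda>l. - (\<rho> $ l)) x * H x)) / 2" for x
  proof -
    have r: "complex_of_real (Re (H x)) = (H x + cnj (H x)) / 2" by (simp add: complex_add_cnj)
    show ?thesis unfolding r cX by (simp add: algebra_simps add_divide_distrib)
  qed
  then have "(\<integral>x. X (vec_nth \<rho>) x * of_real (Re (H x)) \<partial>torus_angles UNIV)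
    = ((\<integral>x. X (vec_nth \<rho>) x * H x \<partial>torus_angles UNIV) + cnj (\<integral>x. X (\<lambda>l. - (\<rho> $ l)) x * H x \<partial>torus_angles UNIV)) / 2"
    by (simp only: integral_divide_zero integral_plus_cnj[OF int int])
  also have "\<dots> = 0"
    using zero[of "vec_nth \<rho>" i] zero[of "\<lambda>l. - (\<rho> $ l)" j] ij by simp
  finally show ?thesis unfolding X_def H_def .
qed

lemma norm_prod_cauchy_circle:
  fixes \<zeta> :: "'n::finite \<Rightarrow> complex"
  assumes "\<And>l. norm (\<zeta> l) < 1"
  shows "norm (\<Prod>l\<in>J. 1 + cauchy_tail (\<zeta> l) (circle_point (x l))) \<le> (\<Prod>l\<in>J. 1 / (1 - norm (\<zeta> l)))"
  unfolding prod_norm[symmetric] using assms by (intro prod_mono) (auto intro!: norm_one_plus_cauchy_tail_le)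

lemma prod_cauchy_circle_measurable [measurable]:
  "(\<lambda>x. \<Prod>l\<in>UNIV. 1 + cauchy_tail (\<zeta> l) (circle_point (x l))) \<in> borel_measurable (torus_angles (UNIV :: 'n::finite set))"
  by (intro borel_measurable_prod borel_measurable_add borel_measurable_const measurable_compose[OF component_torus_angles_measurable]) measurable

text \<open>
  Write \<open>2 Re h = h + cnj h\<close>. Against the Cauchy product \<open>h\<close> gives \<open>h(\<zeta>)\<close>, while \<open>cnj h\<close> gives only
  \<open>cnj (h(0))\<close>, because the conjugated Cauchy kernel reproduces holomorphic functions at 0. The constant \<open>-1\<close> of the
  kernel removes the mean \<open>Re h(0)\<close>, which leaves \<open>h(\<zeta>)\<close> up to the imaginary part at 0.
\<close>

lemma herglotz_integral_Re:
  fixes \<zeta> :: "'n::finite \<Rightarrow> complex"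
  assumes h: "polydisc_algebra h" and \<zeta>: "\<And>l. norm (\<zeta> l) < 1"
  shows "(\<integral>x. herglotz_kernel \<zeta> (\<lambda>l. circle_point (x l)) * of_real (Re (h (\<lambda>l. circle_point (x l)))) \<partial>torus_angles UNIV)
    = h \<zeta> - \<i> * of_real (Im (h (\<lambda>_. 0)))"
proof -
  define P where "P x = (\<Prod>l\<in>UNIV. 1 + cauchy_tail (\<zeta> l) (circle_point (x l)))" for x
  define H where "H x = h (\<lambda>l. circle_point (x l))" for x
  have P: "P \<in> borel_measurable (torus_angles UNIV)" unfolding P_def by measurable
  have "cnj \<in> borel_measurable borel"
    by (intro borel_measurable_continuous_onI continuous_intros)
  with P have cP: "(\<lambda>x. cnj (P x)) \<in> borel_measurable (torus_angles UNIV)"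
    by (rule measurable_compose)
  have PB: "norm (P x) \<le> (\<Prod>l\<in>UNIV. 1 / (1 - norm (\<zeta> l)))" for x
    unfolding P_def by (rule norm_prod_cauchy_circle[OF \<zeta>])
  have int: "integrable (torus_angles UNIV) (\<lambda>x. P x * H x)" "integrable (torus_angles UNIV) (\<lambda>x. cnj (P x) * H x)"
      "integrable (torus_angles UNIV) H"
    unfolding H_def using integrable_torus_polydisc_algebra[OF h P PB] integrable_torus_polydisc_algebra[OF h cP, of "\<Prod>l\<in>UNIV. 1 / (1 - norm (\<zeta> l))"] PB
      integrable_torus_polydisc_algebra[OF h, of "\<lambda>_. 1" 1] by auto
  have B: "norm (1 + cauchy_tail (\<zeta> l) (circle_point x)) \<le> 1 / (1 - norm (\<zeta> l))" for l x
    by (rule norm_one_plus_cauchy_tail_le) (auto simp: \<zeta>)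
  have 1: "(\<integral>x. P x * H x \<partial>torus_angles UNIV) = h \<zeta>"
    unfolding P_def H_def using \<zeta> B
    by (intro torus_mean[OF h, where B = "\<lambda>l. 1 / (1 - norm (\<zeta> l))"] cauchy_mean) (auto intro: less_imp_le)
  have 2: "(\<integral>x. cnj (P x) * H x \<partial>torus_angles UNIV) = h (\<lambda>_. 0)"
  proof -
    define Y where "Y l x = 1 + cnj (cauchy_tail (\<zeta> l) (circle_point x))" for l x
    have Yeq: "Y l x = cnj (1 + cauchy_tail (\<zeta> l) (circle_point x))" for l x by (simp add: Y_def)
    have cont: "continuous_on UNIV (Y l)" for l
      unfolding Y_def[abs_def] cauchy_tail_def using \<zeta>[of l] norm_circle_point
      by (intro continuous_intros continuous_circle_point) (metis eq_iff_diff_eq_0 less_irrefl)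
    have ev: "(\<integral>x. Y l x * g (circle_point x) \<partial>angle_measure) = g 0"
      if g: "continuous_on (cball 0 1) g" "g holomorphic_on ball 0 1" for l g
    proof -
      have cg: "continuous_on UNIV (\<lambda>x. g (circle_point x))"
        by (rule continuous_on_compose2[OF g(1) continuous_circle_point]) auto
      then have mg: "(\<lambda>x. g (circle_point x)) \<in> borel_measurable borel" by (rule borel_measurable_continuous_onI)
      have mY: "Y l \<in> borel_measurable borel" by (rule borel_measurable_continuous_onI[OF cont])
      have "compact (g ` cball 0 1)" by (intro compact_continuous_image g compact_cball)
      then obtain C where C: "\<And>u. norm u \<le> 1 \<Longrightarrow> norm (g u) \<le> C"
        using compact_imp_bounded bounded_iff by (metis imageI mem_cball_0)
      have ig: "integrable angle_measure (\<lambda>x. g (circle_point x))"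
        by (rule angle.integrable_const_bound[where B = C]) (use C mg in \<open>auto cong: measurable_cong_sets\<close>)
      have "integrable angle_measure (\<lambda>x. Y l x * g (circle_point x))"
      proof (rule angle.integrable_const_bound[where B = "1 / (1 - norm (\<zeta> l)) * C"])
        show "AE x in angle_measure. norm (Y l x * g (circle_point x)) \<le> 1 / (1 - norm (\<zeta> l)) * C"
          unfolding norm_mult Yeq complex_mod_cnj using \<zeta>[of l] by (intro AE_I2 mult_mono B C) auto
        show "(\<lambda>x. Y l x * g (circle_point x)) \<in> borel_measurable angle_measure"
          using borel_measurable_times[OF mY mg] by (simp cong: measurable_cong_sets)
      qed
      from Bochner_Integration.integral_diff[OF this ig]
      have "(\<integral>x. Y l x * g (circle_point x) \<partial>angle_measure) - (\<integral>x. g (circle_point x) \<partial>angle_measure)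
         = (\<integral>x. cnj (cauchy_tail (\<zeta> l) (circle_point x)) * g (circle_point x) \<partial>angle_measure)"
        by (simp add: Y_def algebra_simps)
      then show ?thesis using conjugate_tail_mean[OF g \<zeta>[of l]] circle_mean[OF g] by simp
    qed
    have "(\<integral>x. (\<Prod>l\<in>UNIV. Y l (x l)) * h (\<lambda>l. circle_point (x l)) \<partial>torus_angles UNIV) = h (\<lambda>_. 0)"
    proof (rule torus_mean[OF h])
      show "norm (Y l x) \<le> 1 / (1 - norm (\<zeta> l))" for l x unfolding Yeq complex_mod_cnj by (rule B)
    qed (use ev borel_measurable_continuous_onI[OF cont] in auto)
    then show ?thesis unfolding P_def H_def cnj_prod Yeq .
  qed
  have 3: "(\<integral>x. H x \<partial>torus_angles UNIV) = h (\<lambda>_. 0)"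
    using torus_mean[OF h, of "\<lambda>_ _. 1" "\<lambda>_. 1" "\<lambda>_. 0"] circle_mean unfolding H_def by simp
  have "herglotz_kernel \<zeta> (\<lambda>l. circle_point (x l)) * of_real (Re (H x))
     = P x * H x + cnj (cnj (P x) * H x) - (H x + cnj (H x)) / 2" for x
  proof -
    have r: "complex_of_real (Re (H x)) = (H x + cnj (H x)) / 2" by (simp add: complex_add_cnj)
    have k: "herglotz_kernel \<zeta> (\<lambda>l. circle_point (x l)) = 2 * P x - 1" by (simp add: herglotz_kernel_def P_def)
    show ?thesis unfolding r k by (simp add: algebra_simps add_divide_distrib)
  qed
  then have "(\<integral>x. herglotz_kernel \<zeta> (\<lambda>l. circle_point (x l)) * of_real (Re (H x)) \<partial>torus_angles UNIV)
    = (\<integral>x. P x * H x + cnj (cnj (P x) * H x) \<partial>torus_angles UNIV) - (\<integral>x. (H x + cnj (H x)) / 2 \<partial>torus_angles UNIV)"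
    using integral_plus_cnj(1)[OF int(1,2)] integral_plus_cnj(1)[OF int(3,3)]
    by (simp only:) (rule Bochner_Integration.integral_diff, simp_all only: integrable_divide_zero simp_thms)
  also have "\<dots> = h \<zeta> + cnj (h (\<lambda>_. 0)) - (h (\<lambda>_. 0) + cnj (h (\<lambda>_. 0))) / 2"
    by (simp only: integral_divide_zero integral_plus_cnj[OF int(1,2)] integral_plus_cnj[OF int(3,3)] 1 2 3)
  also have "\<dots> = h \<zeta> - \<i> * of_real (Im (h (\<lambda>_. 0)))"
    by (simp add: complex_eq_iff)
  finally show ?thesis unfolding H_def .
qed

section \<open>Weak compactness of measures on the torus\<close>

text \<open>
  With the digits \<open>\<lfloor>2\<^sup>k\<^sup>+\<^sup>1 x\<rfloor> mod 2\<close> the \<open>N\<close>-th partial sum is \<open>\<lfloor>2\<^sup>N x\<rfloor> / 2\<^sup>N\<close>.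
\<close>

lemma binary_expansion:
  fixes x :: real
  assumes x: "0 \<le> x" "x < 1"
  obtains a :: "nat \<Rightarrow> nat" where "\<And>k. a k \<in> {0,1}" "(\<lambda>k. real (a k) / 2 ^ Suc k) sums x"
proof -
  define a where "a k = nat (\<lfloor>2 ^ Suc k * x\<rfloor> mod 2)" for k
  have a01: "a k \<in> {0,1}" for k
  proof -
    have "\<lfloor>2 ^ Suc k * x\<rfloor> mod 2 \<in> {0,1}" by auto
    then show ?thesis by (auto simp: a_def)
  qed
  have partial: "(\<Sum>k<N. real (a k) / 2 ^ Suc k) = of_int \<lfloor>2 ^ N * x\<rfloor> / 2 ^ N" for N
  proof (induction N)
    case 0
    have "\<lfloor>x\<rfloor> = 0" using x by (simp add: floor_eq_iff)
    then show ?case by simp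
  next
    case (Suc N)
    define y where "y = 2 ^ N * x"
    have "\<lfloor>2 * y\<rfloor> = 2 * \<lfloor>y\<rfloor> \<or> \<lfloor>2 * y\<rfloor> = 2 * \<lfloor>y\<rfloor> + 1" by linarith
    then have "\<lfloor>2 * y\<rfloor> = 2 * \<lfloor>y\<rfloor> + \<lfloor>2 * y\<rfloor> mod 2" by (elim disjE) (simp_all only:, simp_all)
    moreover have "real (a N) = of_int (\<lfloor>2 * y\<rfloor> mod 2)" by (simp add: a_def y_def mult.assoc)
    ultimately have *: "of_int \<lfloor>2 * y\<rfloor> = 2 * of_int \<lfloor>y\<rfloor> + real (a N)"
      by (metis of_int_add of_int_mult of_int_numeral)
    have "(\<Sum>k<Suc N. real (a k) / 2 ^ Suc k) = of_int \<lfloor>y\<rfloor> / 2 ^ N + real (a N) / 2 ^ Suc N"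
      by (simp only: sum.lessThan_Suc Suc.IH y_def)
    also have "\<dots> = of_int \<lfloor>2 * y\<rfloor> / 2 ^ Suc N" unfolding * by (simp add: field_simps)
    also have "2 * y = 2 ^ Suc N * x" by (simp add: y_def)
    finally show ?case .
  qed
  have "(\<lambda>N. of_int \<lfloor>2 ^ N * x\<rfloor> / 2 ^ N) \<longlonglongrightarrow> x"
  proof (rule tendsto_sandwich)
    show "\<forall>\<^sub>F N in sequentially. x - (1 / 2) ^ N \<le> of_int \<lfloor>2 ^ N * x\<rfloor> / 2 ^ N"
    proof (intro always_eventually allI)
      fix N :: nat
      have "2 ^ N * x - 1 \<le> of_int \<lfloor>2 ^ N * x\<rfloor>" by linarith
      then have "(2 ^ N * x - 1) / 2 ^ N \<le> of_int \<lfloor>2 ^ N * x\<rfloor> / 2 ^ N" by (intro divide_right_mono) auto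
      then show "x - (1 / 2) ^ N \<le> of_int \<lfloor>2 ^ N * x\<rfloor> / 2 ^ N" by (simp add: diff_divide_distrib power_one_over)
    qed
    show "\<forall>\<^sub>F N in sequentially. of_int \<lfloor>2 ^ N * x\<rfloor> / 2 ^ N \<le> x"
      by (intro always_eventually allI) (simp add: field_simps)
    have "(\<lambda>N. x - (1 / 2 :: real) ^ N) \<longlonglongrightarrow> x - 0" by (intro tendsto_intros LIMSEQ_realpow_zero) auto
    then show "(\<lambda>N. x - (1 / 2 :: real) ^ N) \<longlonglongrightarrow> x" by simp
  qed simp
  then have "(\<lambda>k. real (a k) / 2 ^ Suc k) sums x" unfolding sums_def partial .
  with a01 show thesis by (rule that)
qed

text \<open>
  A continuous function of period 2 that is 0 on \<open>[0, 1/3]\<close> and 1 on \<open>[2/3, 1]\<close>.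
\<close>

definition bump :: "real \<Rightarrow> real" where
  "bump t = max 0 (min 1 (1 / 2 - cos (pi * t)))"

lemma bump_range: "0 \<le> bump t" "bump t \<le> 1"
  by (auto simp: bump_def)

lemma continuous_bump: "continuous_on A bump"
  unfolding bump_def[abs_def] by (intro continuous_intros)

lemma bump_shift: "bump (2 * real n + t) = bump t"
proof -
  have "pi * (2 * real n + t) = 2 * real n * pi + pi * t" by (simp add: algebra_simps)
  then have "cos (pi * (2 * real n + t)) = cos (pi * t)" by (simp add: cos_add)
  then show ?thesis by (simp add: bump_def)
qed

lemma bump_eq_0: "0 \<le> t \<Longrightarrow> t \<le> 1 / 3 \<Longrightarrow> bump t = 0"
proof -
  assume "0 \<le> t" "t \<le> 1 / 3"
  then have "cos (pi / 3) \<le> cos (pi * t)" by (intro cos_monotone_0_pi_le) auto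
  then show ?thesis by (simp add: bump_def cos_60)
qed

lemma bump_eq_1: "2 / 3 \<le> t \<Longrightarrow> t \<le> 1 \<Longrightarrow> bump t = 1"
proof -
  assume t: "2 / 3 \<le> t" "t \<le> 1"
  then have "cos (pi * t) \<le> cos (pi * (2 / 3))" by (intro cos_monotone_0_pi_le) auto
  also have "pi * (2 / 3) = pi - pi / 3" by simp
  also have "cos (pi - pi / 3) = - (1 / 2)" by (simp only: cos_pi_minus cos_60)
  finally show ?thesis by (simp add: bump_def)
qed

text \<open>
  Multiplication by \<open>3\<^sup>M\<close> shifts the ternary digits, all equal to 0 or 2. The digits in front of the point
  form an even integer, which the period absorbs; the first digit behind the point decides between
  \<open>[0, 1/3]\<close> and \<open>[2/3, 1]\<close>.
\<close>

lemma bump_recovers_ternary_digit: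
  fixes b :: "nat \<Rightarrow> nat"
  assumes b: "\<And>m. b m \<in> {0,1}"
  defines "t \<equiv> (\<Sum>m. 2 * real (b m) / 3 ^ Suc m)"
  shows "bump (3 ^ M * t) = real (b M)" "0 \<le> t" "t \<le> 1"
proof -
  define f where "f m = 2 * real (b m) / 3 ^ Suc m" for m
  have f0: "0 \<le> f m" for m by (simp add: f_def)
  have fle: "f m \<le> 2 / 3 * (1 / 3) ^ m" for m
    using b[of m] by (auto simp: f_def field_simps)
  have geo: "summable (\<lambda>m. 2 / 3 * (1 / 3 :: real) ^ m)" by (intro summable_mult summable_geometric) auto
  have sum_geo: "(\<Sum>m. 2 / 3 * (1 / 3 :: real) ^ m) = 1"
    by (subst suminf_mult) (auto simp: suminf_geometric summable_geometric)
  have sf: "summable f"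
    by (rule summable_comparison_test'[OF geo, of 0]) (use f0 fle in auto)
  have t: "t = suminf f" unfolding t_def f_def ..
  show "0 \<le> t" unfolding t using f0 sf by (intro suminf_nonneg)
  have "suminf f \<le> (\<Sum>m. 2 / 3 * (1 / 3 :: real) ^ m)" using fle sf geo by (intro suminf_le)
  then show "t \<le> 1" unfolding t sum_geo .
  define R where "R = 3 ^ M * (\<Sum>m. f (m + Suc M))"
  have sR: "summable (\<lambda>m. f (m + Suc M))" using sf by (subst summable_iff_shift)
  have R0: "0 \<le> R" unfolding R_def using f0 sR by (intro mult_nonneg_nonneg suminf_nonneg) auto
  have R1: "R \<le> 1 / 3"
  proof -
    have "(\<Sum>m. f (m + Suc M)) \<le> (\<Sum>m. (1 / 3) ^ Suc M * (2 / 3 * (1 / 3) ^ m))"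
    proof (rule suminf_le[OF _ sR])
      show "f (m + Suc M) \<le> (1 / 3) ^ Suc M * (2 / 3 * (1 / 3) ^ m)" for m
        using fle[of "m + Suc M"] by (simp add: power_add mult_ac)
      show "summable (\<lambda>m. (1 / 3 :: real) ^ Suc M * (2 / 3 * (1 / 3) ^ m))" by (intro summable_mult geo)
    qed
    also have "\<dots> = (1 / 3) ^ Suc M" using geo sum_geo by (subst suminf_mult) auto
    finally have "R \<le> 3 ^ M * (1 / 3) ^ Suc M" unfolding R_def by (intro mult_left_mono) auto
    also have "\<dots> = 1 / 3" by (simp add: power_divide)
    finally show ?thesis .
  qed
  \<comment> \<open>Half of the even integer formed by the digits in front of the point.\<close>
  define n where "n = (\<Sum>m<M. b m * 3 ^ (M - Suc m))"
  have "3 ^ M * (\<Sum>m<M. f m) = 2 * real n"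
  proof -
    have "3 ^ M * f m = 2 * (real (b m) * 3 ^ (M - Suc m))" if "m < M" for m
    proof -
      have "(3::real) ^ M = 3 ^ Suc m * 3 ^ (M - Suc m)" using that by (simp add: power_add[symmetric] del: power_Suc)
      then show ?thesis by (simp add: f_def)
    qed
    then show ?thesis by (simp add: n_def sum_distrib_left)
  qed
  moreover have "3 ^ M * f M = 2 / 3 * real (b M)" by (simp add: f_def)
  moreover have "t = (\<Sum>m. f (m + Suc M)) + (\<Sum>m<Suc M. f m)"
    unfolding t by (rule suminf_split_initial_segment[OF sf])
  ultimately have eq: "3 ^ M * t = 2 * real n + (2 / 3 * real (b M) + R)"
    by (simp add: R_def algebra_simps)
  show "bump (3 ^ M * t) = real (b M)"
    unfolding eq bump_shift using b[of M] R0 R1 by (auto intro!: bump_eq_0 bump_eq_1)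
qed

text \<open>
  Schoenberg's space-filling curve. The ternary digits of \<open>t\<close> are distributed among the coordinates by
  the encoding of pairs (position, coordinate) as natural numbers, and are read as binary digits.
\<close>

definition schoenberg_curve :: "real \<Rightarrow> 'n::finite \<Rightarrow> real" where
  "schoenberg_curve t l = (\<Sum>k. bump (3 ^ to_nat (k :: nat, l) * t) / 2 ^ Suc k)"

lemma continuous_schoenberg_curve: "continuous_on UNIV (\<lambda>t. schoenberg_curve t (l :: 'n::finite))"
proof -
  have "uniform_limit UNIV (\<lambda>N t. \<Sum>k<N. bump (3 ^ to_nat (k, l) * t) / 2 ^ Suc k) (\<lambda>t. schoenberg_curve t l) sequentially"
    unfolding schoenberg_curve_def
  proof (rule Weierstrass_m_test)
    show "norm (bump (3 ^ to_nat (k, l) * t) / 2 ^ Suc k) \<le> (1 / 2) ^ Suc k" for k :: nat and t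
      using bump_range[of "3 ^ to_nat (k, l) * t"] by (simp add: field_simps)
    show "summable (\<lambda>k. (1 / 2 :: real) ^ Suc k)" by (subst summable_Suc_iff) (simp add: summable_geometric)
  qed
  moreover have "continuous_on UNIV (\<lambda>t. \<Sum>k<N. bump (3 ^ to_nat (k, l) * t) / 2 ^ Suc k)" for N
    by (intro continuous_intros continuous_on_compose2[OF continuous_bump]) auto
  ultimately show ?thesis
    by (intro uniform_limit_theorem) auto
qed

text \<open>
  Interleave the binary digits of all coordinates and read them as ternary digits 0 and 2.
\<close>

lemma schoenberg_curve_surj:
  fixes \<theta> :: "'n::finite \<Rightarrow> real"
  assumes "\<And>l. 0 \<le> \<theta> l \<and> \<theta> l < 1"
  obtains t where "0 \<le> t" "t \<le> 1" "schoenberg_curve t = \<theta>"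
proof -
  have "\<exists>a :: nat \<Rightarrow> nat. (\<forall>k. a k \<in> {0,1}) \<and> (\<lambda>k. real (a k) / 2 ^ Suc k) sums \<theta> l" for l
    using binary_expansion[of "\<theta> l"] assms[of l] by metis
  then obtain a where a: "\<And>l k. (a l k :: nat) \<in> {0,1}" "\<And>l. (\<lambda>k. real (a l k) / 2 ^ Suc k) sums \<theta> l"
    by metis
  define b where "b m = (case from_nat m of (k :: nat, l :: 'n) \<Rightarrow> a l k)" for m
  have b: "b m \<in> {0,1}" for m unfolding b_def using a(1) by (auto split: prod.split)
  define t where "t = (\<Sum>m. 2 * real (b m) / 3 ^ Suc m)"
  have "schoenberg_curve t l = \<theta> l" for l
  proof -
    have "bump (3 ^ to_nat (k, l) * t) = real (a l k)" for k
      unfolding t_def bump_recovers_ternary_digit(1)[OF b] by (simp add: b_def)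
    then show ?thesis unfolding schoenberg_curve_def using sums_unique[OF a(2)[of l]] by simp
  qed
  moreover have "0 \<le> t" "t \<le> 1" unfolding t_def using bump_recovers_ternary_digit(2,3)[OF b] by auto
  ultimately show thesis by (intro that[of t]) auto
qed

text \<open>
  A right inverse of the curve: the first time at which a point is reached.
\<close>

definition curve_section :: "('n::finite \<Rightarrow> real) \<Rightarrow> real" where
  "curve_section \<theta> = (if \<theta> \<in> schoenberg_curve ` {0..1} then Inf {t\<in>{0..1}. schoenberg_curve t = \<theta>} else 0)"

lemma continuous_schoenberg_curve_fun: "continuous_on A (schoenberg_curve :: real \<Rightarrow> 'n::finite \<Rightarrow> real)"
  by (rule continuous_on_subset[OF continuous_on_coordinatewise_then_product[OF continuous_schoenberg_curve]]) auto

lemma curve_section: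
  fixes \<theta> :: "'n::finite \<Rightarrow> real"
  assumes \<theta>: "\<theta> \<in> schoenberg_curve ` {0..1}"
  shows "curve_section \<theta> \<in> {0..1}" "schoenberg_curve (curve_section \<theta>) = \<theta>"
proof -
  let ?F = "{t\<in>{0..1}. schoenberg_curve t = \<theta>}"
  have "closed ?F"
    by (rule continuous_closed_preimage_constant[OF continuous_schoenberg_curve_fun closed_atLeastAtMost])
  moreover have "?F \<noteq> {}" using \<theta> by auto
  moreover have "bdd_below ?F" by (rule bdd_belowI[of _ 0]) auto
  ultimately have "Inf ?F \<in> ?F" by (intro closed_contains_Inf)
  then show "curve_section \<theta> \<in> {0..1}" "schoenberg_curve (curve_section \<theta>) = \<theta>"
    using \<theta> by (auto simp: curve_section_def)
qed

lemma curve_section_range: "curve_section \<theta> \<in> {0..1}"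
  using curve_section(1)[of \<theta>] by (cases "\<theta> \<in> schoenberg_curve ` {0..1}") (auto simp: curve_section_def)

text \<open>
  The points reached up to time \<open>c\<close> are a compact image, so the sublevel sets of the first hitting time are
  Borel sets. This is why the smallest preimage is chosen.
\<close>

lemma curve_section_measurable: "curve_section \<in> borel_measurable (borel :: ('n::finite \<Rightarrow> real) measure)"
proof (rule borel_measurableI_le)
  fix c :: real
  have closed: "closed (schoenberg_curve ` ({0..1} \<inter> {..c}) :: ('n \<Rightarrow> real) set)" for c
    by (rule compact_imp_closed, intro compact_continuous_image continuous_schoenberg_curve_fun compact_Int_closed) auto
  have closed1: "closed (schoenberg_curve ` {0..1} :: ('n \<Rightarrow> real) set)"
    using closed[of 1] by (simp add: Int_absorb2 atLeastatMost_subset_iff subset_iff)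
  have "{\<theta>. curve_section \<theta> \<le> c} = schoenberg_curve ` ({0..1} \<inter> {..c}) \<union> (if 0 \<le> c then - schoenberg_curve ` {0..1} else ({} :: ('n \<Rightarrow> real) set))"
  proof (intro equalityI subsetI)
    fix \<theta> :: "'n \<Rightarrow> real" assume "\<theta> \<in> {\<theta>. curve_section \<theta> \<le> c}"
    then show "\<theta> \<in> schoenberg_curve ` ({0..1} \<inter> {..c}) \<union> (if 0 \<le> c then - schoenberg_curve ` {0..1} else {})"
      using curve_section[of \<theta>] by (cases "\<theta> \<in> schoenberg_curve ` {0..1}") (auto simp: curve_section_def intro!: image_eqI[of _ _ "curve_section \<theta>"])
  next
    fix \<theta> :: "'n \<Rightarrow> real"
    assume "\<theta> \<in> schoenberg_curve ` ({0..1} \<inter> {..c}) \<union> (if 0 \<le> c then - schoenberg_curve ` {0..1} else {})"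
    then consider t where "t \<in> {0..1}" "t \<le> c" "\<theta> = schoenberg_curve t" | "0 \<le> c" "\<theta> \<notin> schoenberg_curve ` {0..1}"
      by (auto split: if_splits)
    then show "\<theta> \<in> {\<theta>. curve_section \<theta> \<le> c}"
    proof cases
      case 1
      have "Inf {t\<in>{0..1}. schoenberg_curve t = \<theta>} \<le> t"
        by (rule cInf_lower) (use 1 in \<open>auto intro: bdd_belowI[of _ 0]\<close>)
      then show ?thesis using 1 by (simp add: curve_section_def)
    next
      case 2
      then show ?thesis by (simp add: curve_section_def)
    qed
  qed
  then show "{\<theta> \<in> space borel. curve_section \<theta> \<le> c} \<in> sets (borel :: ('n \<Rightarrow> real) measure)"
    using closed closed1 by (simp add: borel_comp)
qed

text \<open>
  The curve is known to reach all points with coordinates in \<open>[0, 1)\<close>; the others form a null set.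
\<close>

lemma AE_torus_angles_in_curve:
  "AE x in torus_angles (UNIV :: 'n::finite set). x \<in> schoenberg_curve ` {0..1}"
proof -
  have "AE x in lborel. x \<noteq> (1::real)" by (rule AE_lborel_singleton)
  then have "AE x in angle_measure. 0 \<le> x \<and> x < 1"
    unfolding angle_measure_def by (subst AE_density) (auto elim!: eventually_mono simp: indicator_def)
  then have "AE x in torus_angles UNIV. 0 \<le> x l \<and> x l < 1" for l :: 'n
    unfolding torus_angles_def by (intro AE_PiM_component prob_space_angle_measure) auto
  then have "AE x in torus_angles UNIV. \<forall>l :: 'n. 0 \<le> x l \<and> x l < 1"
    by (simp add: AE_all_countable)
  then show ?thesis
  proof eventually_elim
    case (elim x)
    then show ?case using schoenberg_curve_surj[of x] by (metis atLeastAtMost_iff image_eqI)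
  qed
qed

lemma sets_torus_angles: "sets (torus_angles UNIV :: ('n::finite \<Rightarrow> real) measure) = sets borel"
proof -
  have "sets (torus_angles UNIV :: ('n \<Rightarrow> real) measure) = sets (PiM UNIV (\<lambda>_::'n. borel :: real measure))"
    unfolding torus_angles_def by (intro sets_PiM_cong) auto
  then show ?thesis by (simp add: sets_PiM_equal_borel)
qed

definition torus_curve :: "'n::finite \<Rightarrow> real \<Rightarrow> complex" where
  "torus_curve l x = circle_point (schoenberg_curve x l)"

lemma continuous_torus_curve: "continuous_on UNIV (torus_curve l)"
  unfolding torus_curve_def[abs_def]
  by (rule continuous_on_compose2[OF continuous_circle_point continuous_schoenberg_curve]) auto

lemma norm_torus_curve: "norm (torus_curve l x) = 1"
  by (simp add: torus_curve_def)

text \<open>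
  Push the measures to the unit interval by the section of the curve. There they are tight, and Helly's
  theorem gives a weakly convergent subsequence. A continuous function on the torus, composed with the
  curve, is a continuous function on the line, and the curve inverts the section almost everywhere; so the
  limit on the line does what a limit on the torus would do.
\<close>

lemma torus_measures_weakly_compact:
  fixes d :: "nat \<Rightarrow> ('n::finite \<Rightarrow> real) \<Rightarrow> real"
  assumes int: "\<And>k. integrable (torus_angles UNIV) (d k)" and pos: "\<And>k x. 0 \<le> d k x"
    and mass: "\<And>k. (\<integral>x. d k x \<partial>torus_angles UNIV) = c"
  shows "\<exists>(M :: real measure) r. finite_measure M \<and> sets M = sets borel \<and> strict_mono r \<and>
    (\<forall>B :: ('n \<Rightarrow> complex) \<Rightarrow> complex. continuous_on {\<xi>. \<forall>l. norm (\<xi> l) = 1} B \<longrightarrow> bounded (B ` {\<xi>. \<forall>l. norm (\<xi> l) = 1}) \<longrightarrow>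
       (\<lambda>k. \<integral>x. B (\<lambda>l. circle_point (x l)) * of_real (d (r k) x) \<partial>torus_angles UNIV) \<longlonglongrightarrow> (\<integral>x. B (\<lambda>l. torus_curve l x) \<partial>M))"
proof -
  let ?T = "torus_angles UNIV :: ('n \<Rightarrow> real) measure"
  interpret T: prob_space ?T by (rule prob_space_torus_angles)
  note [measurable_cong] = sets_torus_angles
  have [measurable]: "d k \<in> borel_measurable ?T" for k using int by auto
  have [measurable]: "curve_section \<in> borel_measurable ?T" by (simp add: measurable_cong_sets[OF sets_torus_angles refl] curve_section_measurable)
  have c0: "0 \<le> c" unfolding mass[of 0, symmetric] using pos by (intro Bochner_Integration.integral_nonneg) auto
  show ?thesis
  proof (cases "c = 0")
    case True
    have ae: "AE x in ?T. d k x = 0" for k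
      using integral_nonneg_eq_0_iff_AE[OF int[of k]] mass[of k] pos True by simp
    have "(\<integral>x. B (\<lambda>l. circle_point (x l)) * of_real (d k x) \<partial>?T) = 0" for k and B :: "('n \<Rightarrow> complex) \<Rightarrow> complex"
      by (rule integral_eq_zero_AE) (use ae[of k] in \<open>auto elim: eventually_mono\<close>)
    moreover have "(\<integral>x. f x \<partial>null_measure borel) = 0" for f :: "real \<Rightarrow> complex"
      by (rule integral_eq_zero_AE) (auto simp: eventually_ae_filter null_sets_def intro!: bexI[of _ UNIV])
    ultimately show ?thesis
      by (intro exI[of _ "null_measure borel"] exI[of _ id]) (auto simp: strict_mono_def intro!: finite_measureI)
  next
    case False
    then have c: "0 < c" using c0 by simp
    define D where "D k = density ?T (\<lambda>x. ennreal (d k x / c))" for k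
    define \<mu> where "\<mu> k = distr (D k) borel curve_section" for k
    have [measurable_cong]: "sets (D k) = sets borel" for k by (simp add: D_def sets_torus_angles)
    have D_prob: "prob_space (D k)" for k
    proof (rule prob_spaceI)
      have "emeasure (D k) (space (D k)) = (\<integral>\<^sup>+x. ennreal (d k x / c) \<partial>?T)"
        unfolding D_def by (subst emeasure_density) (auto intro!: nn_integral_cong)
      also have "\<dots> = ennreal (\<integral>x. d k x / c \<partial>?T)"
        using int pos c by (intro nn_integral_eq_integral) auto
      also have "(\<integral>x. d k x / c \<partial>?T) = 1" using mass c by simp
      finally show "emeasure (D k) (space (D k)) = 1" by simp
    qed
    have \<mu>: "real_distribution (\<mu> k)" for k
    proof -
      interpret prob_space "D k" by (rule D_prob)
      have "prob_space (\<mu> k)" unfolding \<mu>_def by (rule prob_space_distr) measurable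
      then show ?thesis by (intro real_distribution.intro real_distribution_axioms.intro) (auto simp: \<mu>_def)
    qed
    have "tight \<mu>"
      unfolding tight_def
    proof (intro conjI allI impI \<mu>)
      fix \<epsilon> :: real assume \<epsilon>: "0 < \<epsilon>"
      have "measure (\<mu> k) {-1<..1} = 1" for k
      proof -
        interpret prob_space "D k" by (rule D_prob)
        have "curve_section x \<in> {-1<..1}" for x :: "'n \<Rightarrow> real"
          using curve_section_range[of x] by simp
        then have "curve_section -` {-1<..1} \<inter> space (D k) = space (D k)"
          by blast
        then show ?thesis unfolding \<mu>_def by (subst measure_distr) (auto simp: prob_space)
      qed
      then show "\<exists>a b. a < b \<and> (\<forall>n. 1 - \<epsilon> < measure (\<mu> n) {a<..b})"
        using \<epsilon> by (intro exI[of _ "-1"] exI[of _ 1]) auto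
    qed
    from tight_imp_convergent_subsubsequence[OF this, of id]
    obtain r M where r: "strict_mono r" and M: "real_distribution M" and conv: "weak_conv_m (\<mu> \<circ> r) M"
      by (auto simp: strict_mono_def)
    interpret M: real_distribution M by (rule M)
    \<comment> \<open>Helly's theorem is applied to probability measures; the common mass \<open>c\<close> is restored here.\<close>
    define M' where "M' = density M (\<lambda>_. ennreal c)"
    show ?thesis
    proof (intro exI[of _ M'] exI[of _ r] conjI allI impI)
      show "finite_measure M'"
        by (rule finite_measureI) (simp add: M'_def emeasure_density M.emeasure_eq_measure ennreal_mult_eq_top_iff)
      show "sets M' = sets borel" by (simp add: M'_def)
      show "strict_mono r" by (rule r)
      fix B :: "('n \<Rightarrow> complex) \<Rightarrow> complex"
      assume B: "continuous_on {\<xi>. \<forall>l. norm (\<xi> l) = 1} B" and "bounded (B ` {\<xi>. \<forall>l. norm (\<xi> l) = 1})"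
      then obtain C where BC: "\<And>\<xi>. (\<And>l. norm (\<xi> l) = 1) \<Longrightarrow> norm (B \<xi>) \<le> C"
        by (auto simp: bounded_iff)
      define f where "f x = B (\<lambda>l. torus_curve l x)" for x
      have f: "continuous_on UNIV f"
        unfolding f_def by (rule continuous_on_compose2[OF B continuous_on_coordinatewise_then_product[OF continuous_torus_curve]]) (auto simp: norm_torus_curve)
      then have [measurable]: "f \<in> borel_measurable borel" by (rule borel_measurable_continuous_onI)
      have "(\<lambda>k. integral\<^sup>L ((\<mu> \<circ> r) k) f) \<longlonglongrightarrow> integral\<^sup>L M f"
      proof (rule weak_conv_imp_integral_bdd_continuous_conv[OF _ M conv])
        show "isCont f x" for x using f by (simp add: continuous_on_eq_continuous_at)
        show "norm (f x) \<le> C" for x unfolding f_def by (rule BC) (simp add: norm_torus_curve)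
      qed (simp add: \<mu>)
      moreover have "integral\<^sup>L (\<mu> k) f = (\<integral>x. B (\<lambda>l. circle_point (x l)) * of_real (d k x) \<partial>?T) / of_real c" for k
      proof -
        have "integral\<^sup>L (\<mu> k) f = (\<integral>x. f (curve_section x) \<partial>D k)"
          unfolding \<mu>_def by (rule integral_distr) measurable
        also have "\<dots> = (\<integral>x. (d k x / c) *\<^sub>R f (curve_section x) \<partial>?T)"
          unfolding D_def using pos c by (intro integral_density) auto
        also have "\<dots> = (\<integral>x. (d k x / c) *\<^sub>R B (\<lambda>l. circle_point (x l)) \<partial>?T)"
        proof (rule integral_cong_AE)
          show ae: "AE x in ?T. (d k x / c) *\<^sub>R f (curve_section x) = (d k x / c) *\<^sub>R B (\<lambda>l. circle_point (x l))"
            using AE_torus_angles_in_curve by eventually_elim (simp add: f_def torus_curve_def curve_section)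
          show "(\<lambda>x. (d k x / c) *\<^sub>R f (curve_section x)) \<in> borel_measurable ?T" by measurable
          have "continuous_on UNIV (\<lambda>x :: 'n \<Rightarrow> real. B (\<lambda>l. circle_point (x l)))"
            by (rule continuous_on_compose2[OF B continuous_on_coordinatewise_then_product])
               (auto intro!: continuous_on_compose2[OF continuous_circle_point continuous_on_product_coordinates])
          then have [measurable]: "(\<lambda>x :: 'n \<Rightarrow> real. B (\<lambda>l. circle_point (x l))) \<in> borel_measurable ?T"
            unfolding measurable_cong_sets[OF sets_torus_angles refl] by (rule borel_measurable_continuous_onI)
          show "(\<lambda>x. (d k x / c) *\<^sub>R B (\<lambda>l. circle_point (x l))) \<in> borel_measurable ?T" by measurable
        qed
        also have "\<dots> = (\<integral>x. B (\<lambda>l. circle_point (x l)) * of_real (d k x) / of_real c \<partial>?T)"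
          by (intro Bochner_Integration.integral_cong refl) (simp add: scaleR_conv_of_real mult_ac)
        finally show ?thesis by simp
      qed
      ultimately have "(\<lambda>k. of_real c * ((\<integral>x. B (\<lambda>l. circle_point (x l)) * of_real (d (r k) x) \<partial>?T) / of_real c)) \<longlonglongrightarrow> of_real c * integral\<^sup>L M f"
        by (intro tendsto_mult_left) simp
      moreover have "of_real c * integral\<^sup>L M f = (\<integral>x. B (\<lambda>l. torus_curve l x) \<partial>M')"
        unfolding M'_def f_def[symmetric] using c by (subst integral_density) (auto simp: scaleR_conv_of_real)
      ultimately show "(\<lambda>k. \<integral>x. B (\<lambda>l. circle_point (x l)) * of_real (d (r k) x) \<partial>?T) \<longlonglongrightarrow> (\<integral>x. B (\<lambda>l. torus_curve l x) \<partial>M')"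
        using False by simp
    qed
  qed
qed

section \<open>Faces of the torus\<close>

text \<open>
  A sequence of radii tending to 1, as complex numbers because they are used as points of the disc.
\<close>

definition radius_seq :: "nat \<Rightarrow> complex" where
  "radius_seq k = of_real (1 - 1 / real (k + 2))"

lemma norm_radius_seq: "norm (radius_seq k) = 1 - 1 / real (k + 2)"
  unfolding radius_seq_def norm_of_real by (simp add: field_simps)

lemma norm_radius_seq_lt_1: "norm (radius_seq k) < 1"
  unfolding norm_radius_seq by simp

lemma radius_seq_tendsto: "radius_seq \<longlonglongrightarrow> 1"
proof -
  have "(\<lambda>k. 1 - 1 / real (k + 2)) \<longlonglongrightarrow> 1" by real_asymp
  then have "(\<lambda>k. complex_of_real (1 - 1 / real (k + 2))) \<longlonglongrightarrow> of_real 1" by (rule tendsto_of_real)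
  then show ?thesis by (simp add: radius_seq_def[abs_def])
qed

lemma cauchy_tail_radial_limit:
  assumes "norm \<omega> = 1"
  shows "(\<lambda>k. (1 - radius_seq k) * cauchy_tail (radius_seq k) \<omega>) \<longlonglongrightarrow> (if \<omega> = 1 then 1 else 0)"
proof (cases "\<omega> = 1")
  case True
  have "1 - radius_seq k \<noteq> 0" for k using norm_radius_seq_lt_1[of k] by auto
  then show ?thesis using True radius_seq_tendsto by (simp add: cauchy_tail_def)
next
  case False
  then have "(\<lambda>k. (1 - radius_seq k) * cauchy_tail (radius_seq k) \<omega>) \<longlonglongrightarrow> (1 - 1) * (1 / (\<omega> - 1))"
    unfolding cauchy_tail_def by (intro tendsto_intros radius_seq_tendsto) auto
  then show ?thesis using False by simp
qed

text \<open>
  At \<open>\<omega> = 1\<close> the value is \<open>r\<close>. At every other point of the circle the kernel stays bounded as \<open>r \<rightarrow> 1\<close>.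
\<close>

lemma disc_factor_radial_limit:
  assumes "norm \<omega> = 1" "s \<noteq> 0"
  shows "(\<lambda>k. (1 - radius_seq k) * disc_factor s (radius_seq k) \<omega>) \<longlonglongrightarrow> (if \<omega> = 1 then 1 else 0)"
proof -
  have "(\<lambda>k. cnj ((1 - radius_seq k) * cauchy_tail (radius_seq k) \<omega>)) \<longlonglongrightarrow> cnj (if \<omega> = 1 then 1 else 0)"
    by (intro tendsto_cnj cauchy_tail_radial_limit assms)
  moreover have "cnj (radius_seq k) = radius_seq k" for k by (simp add: radius_seq_def)
  ultimately have "(\<lambda>k. (1 - radius_seq k) * cnj (cauchy_tail (radius_seq k) \<omega>)) \<longlonglongrightarrow> (if \<omega> = 1 then 1 else 0)"
    by (cases "\<omega> = 1") simp_all
  then show ?thesis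
    using cauchy_tail_radial_limit[OF assms(1)] assms(2) by (cases "s = -1") (simp_all only: disc_factor_def if_False if_True refl)
qed

lemma norm_disc_factor_radial_le:
  assumes "norm \<omega> = 1"
  shows "norm ((1 - radius_seq k) * disc_factor s (radius_seq k) \<omega>) \<le> 1"
proof -
  have "1 - radius_seq k = of_real (1 / real (k + 2))" by (simp add: radius_seq_def)
  then have *: "norm (1 - radius_seq k) = 1 - norm (radius_seq k)"
    unfolding norm_radius_seq by (simp only: norm_of_real) simp
  have "norm ((1 - radius_seq k) * disc_factor s (radius_seq k) \<omega>)
      \<le> (1 - norm (radius_seq k)) * (1 / (1 - norm (radius_seq k)))"
    unfolding norm_mult * using norm_radius_seq_lt_1[of k]
    by (intro mult_left_mono norm_disc_factor_le assms) auto
  then show ?thesis using norm_radius_seq_lt_1[of k] by simp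
qed

context torus_measure
begin

definition face :: "'n \<Rightarrow> 'a set" where
  "face l = {x \<in> space M. w l x = 1}"

lemma face_measurable [measurable]: "face l \<in> sets M"
  unfolding face_def by measurable

lemma radial_limit_integral:
  assumes [measurable]: "G \<in> borel_measurable M" and B: "\<And>x. x \<in> space M \<Longrightarrow> norm (G x) \<le> B" and s: "s \<noteq> 0"
  shows "(\<lambda>k. (1 - radius_seq k) * (\<integral>x. disc_factor s (radius_seq k) (w l x) * G x \<partial>M))
     \<longlonglongrightarrow> (\<integral>x. indicator (face l) x *\<^sub>R G x \<partial>M)"
proof -
  have "(\<lambda>k. \<integral>x. ((1 - radius_seq k) * disc_factor s (radius_seq k) (w l x)) * G x \<partial>M)
     \<longlonglongrightarrow> (\<integral>x. indicator (face l) x *\<^sub>R G x \<partial>M)"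
  proof (rule integral_dominated_convergence[where w = "\<lambda>_. B"])
    show "AE x in M. (\<lambda>k. ((1 - radius_seq k) * disc_factor s (radius_seq k) (w l x)) * G x)
        \<longlonglongrightarrow> indicator (face l) x *\<^sub>R G x"
    proof (rule AE_I2)
      fix x assume x: "x \<in> space M"
      have "(\<lambda>k. ((1 - radius_seq k) * disc_factor s (radius_seq k) (w l x)) * G x)
        \<longlonglongrightarrow> (if w l x = 1 then 1 else 0) * G x"
        by (intro tendsto_mult disc_factor_radial_limit norm_w x s tendsto_const)
      then show "(\<lambda>k. ((1 - radius_seq k) * disc_factor s (radius_seq k) (w l x)) * G x)
        \<longlonglongrightarrow> indicator (face l) x *\<^sub>R G x"
        using x by (auto simp: face_def indicator_def)
    qed
    show "AE x in M. norm (((1 - radius_seq k) * disc_factor s (radius_seq k) (w l x)) * G x) \<le> B" for k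
    proof (rule AE_I2)
      fix x assume x: "x \<in> space M"
      have "norm (((1 - radius_seq k) * disc_factor s (radius_seq k) (w l x)) * G x) \<le> 1 * B"
        unfolding norm_mult[of _ "G x"] by (intro mult_mono norm_disc_factor_radial_le norm_w x B) auto
      then show "norm (((1 - radius_seq k) * disc_factor s (radius_seq k) (w l x)) * G x) \<le> B" by simp
    qed
  qed auto
  then show ?thesis by (simp add: mult.assoc)
qed

end

text \<open>
  Each mixed moment is required to vanish by itself. This is stronger than the vanishing of their sum, and
  it is what boundary measures of holomorphic functions satisfy.
\<close>

locale mixed_free_torus_measure = torus_measure +
  assumes mixed_moment_eq_0: "\<And>\<rho> \<zeta>. \<rho> \<in> mixed_indices \<Longrightarrow> (\<And>j. norm (\<zeta> j) < 1) \<Longrightarrow>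
      (\<integral>x. (\<Prod>j\<in>UNIV. disc_factor (\<rho> $ j) (\<zeta> j) (w j x)) \<partial>M) = 0"
begin

text \<open>
  Choose the index in the coordinate \<open>l\<close> opposite to the nonzero index of \<open>j\<close>. The vector is then mixed, so
  its moment vanishes for all radii in the coordinate \<open>l\<close>, and the radial limit puts the indicator of the
  face in place of the factor of \<open>l\<close>.
\<close>

lemma face_moment_eq_0:
  fixes \<rho> :: "int ^ 'b"
  assumes \<rho>: "\<And>i. \<rho> $ i \<in> {-1,0,1}" and j: "j \<noteq> l" "\<rho> $ j \<noteq> 0" and \<zeta>: "\<And>i. norm (\<zeta> i) < 1"
  shows "(\<integral>x. indicator (face l) x *\<^sub>R (\<Prod>i\<in>UNIV - {l}. disc_factor (\<rho> $ i) (\<zeta> i) (w i x)) \<partial>M) = 0"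
proof -
  define s where "s = - (\<rho> $ j)"
  have s: "s \<in> {-1,1}" using \<rho>[of j] j by (auto simp: s_def)
  \<comment> \<open>The vector \<open>\<rho>\<close> with the opposite sign of \<open>\<rho> $ j\<close> put in place \<open>l\<close>.\<close>
  define \<rho>' where "\<rho>' = (\<chi> i. if i = l then s else \<rho> $ i)"
  have "\<rho>' \<in> mixed_indices"
    unfolding mixed_indices_def
  proof (intro CollectI conjI allI)
    show "\<rho>' $ i \<in> {-1,0,1}" for i using \<rho>[of i] s by (auto simp: \<rho>'_def)
    have "\<rho>' $ l = s" "\<rho>' $ j = -s" using j by (auto simp: \<rho>'_def s_def)
    with s show "\<exists>i. \<rho>' $ i = -1" "\<exists>i. \<rho>' $ i = 1" by auto
  qed
  have "(\<integral>x. disc_factor s (radius_seq k) (w l x) * (\<Prod>i\<in>UNIV - {l}. disc_factor (\<rho> $ i) (\<zeta> i) (w i x)) \<partial>M) = 0" for k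
  proof -
    have "(\<integral>x. (\<Prod>i\<in>UNIV. disc_factor (\<rho>' $ i) ((\<zeta>(l := radius_seq k)) i) (w i x)) \<partial>M) = 0"
      using \<zeta> norm_radius_seq_lt_1 by (intro mixed_moment_eq_0 \<open>\<rho>' \<in> mixed_indices\<close>) auto
    moreover have "(\<Prod>i\<in>UNIV. disc_factor (\<rho>' $ i) ((\<zeta>(l := radius_seq k)) i) (w i x))
      = disc_factor s (radius_seq k) (w l x) * (\<Prod>i\<in>UNIV - {l}. disc_factor (\<rho> $ i) (\<zeta> i) (w i x))" for x
      by (subst prod.remove[of _ l]) (auto simp: \<rho>'_def intro!: prod.cong arg_cong2[where f = "(*)"])
    ultimately show ?thesis by simp
  qed
  then have "(\<lambda>k. 0) \<longlonglongrightarrow> (\<integral>x. indicator (face l) x *\<^sub>R (\<Prod>i\<in>UNIV - {l}. disc_factor (\<rho> $ i) (\<zeta> i) (w i x)) \<partial>M)"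
    using radial_limit_integral[where s = s and l = l and G = "\<lambda>x. \<Prod>i\<in>UNIV - {l}. disc_factor (\<rho> $ i) (\<zeta> i) (w i x)",
        OF _ bounded_prod_disc_factor[OF \<zeta>]] s by auto
  then show ?thesis using LIMSEQ_unique[OF tendsto_const] by fastforce
qed

lemma face_moment_subset_eq_0:
  assumes X: "X \<subseteq> UNIV - {l}" "X \<noteq> {}" and \<zeta>: "\<And>i. norm (\<zeta> i) < 1"
  shows "(\<integral>x. indicator (face l) x *\<^sub>R (\<Prod>i\<in>X. cauchy_tail (\<zeta> i) (w i x)) \<partial>M) = 0"
proof -
  define \<rho> :: "int ^ 'b" where "\<rho> = (\<chi> i. if i \<in> X then -1 else 0)"
  obtain j where "j \<in> X" using X by auto
  then have "(\<integral>x. indicator (face l) x *\<^sub>R (\<Prod>i\<in>UNIV - {l}. disc_factor (\<rho> $ i) (\<zeta> i) (w i x)) \<partial>M) = 0"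
    using X \<zeta> by (intro face_moment_eq_0[of _ j]) (auto simp: \<rho>_def)
  also have "(\<lambda>x. \<Prod>i\<in>UNIV - {l}. disc_factor (\<rho> $ i) (\<zeta> i) (w i x)) = (\<lambda>x. \<Prod>i\<in>X. cauchy_tail (\<zeta> i) (w i x))"
    using X by (intro ext prod.mono_neutral_cong_right) (auto simp: \<rho>_def)
  finally show ?thesis .
qed

text \<open>
  The moment of a single tail in the coordinate \<open>j\<close> vanishes on the face of \<open>l\<close>; the radial limit in \<open>j\<close>
  turns it into the mass of the intersection.
\<close>

lemma measure_face_Int_face:
  assumes "j \<noteq> l"
  shows "measure M (face l \<inter> face j) = 0"
proof -
  have "(\<integral>x. disc_factor (-1) (radius_seq k) (w j x) * (indicator (face l) x *\<^sub>R 1) \<partial>M) = 0" for k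
    using face_moment_subset_eq_0[of "{j}" l "\<lambda>_. radius_seq k"] assms norm_radius_seq_lt_1 by (simp add: scaleR_conv_of_real mult.commute)
  then have "(\<lambda>k. 0) \<longlonglongrightarrow> (\<integral>x. indicator (face j) x *\<^sub>R (indicator (face l) x *\<^sub>R (1::complex)) \<partial>M)"
    using radial_limit_integral[where s = "-1" and l = j and G = "\<lambda>x. indicator (face l) x *\<^sub>R 1" and B = 1] by (simp add: indicator_def)
  then have "(\<integral>x. indicator (face l \<inter> face j) x *\<^sub>R (1::complex) \<partial>M) = 0"
    using LIMSEQ_unique[OF tendsto_const] by (fastforce simp: indicator_inter_arith mult.commute)
  then show ?thesis by (simp add: scaleR_conv_of_real)
qed

definition faces :: "'a set" where "faces = (\<Union>l. face l)"

lemma faces_measurable [measurable]: "faces \<in> sets M"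
  unfolding faces_def by measurable

lemma AE_indicator_faces: "AE x in M. indicator faces x = (\<Sum>l\<in>UNIV. indicator (face l) x :: real)"
proof -
  have "AE x in M. x \<notin> face l \<inter> face j" if "j \<noteq> l" for l j
  proof -
    have "emeasure M (face l \<inter> face j) = 0" using measure_face_Int_face[OF that] by (simp add: emeasure_eq_measure)
    then show ?thesis by (intro AE_not_in) (simp add: null_sets_def)
  qed
  then have "AE x in M. \<forall>l j. j \<noteq> l \<longrightarrow> x \<notin> face l \<inter> face j"
    by (simp add: AE_all_countable AE_impI)
  then show ?thesis
  proof (rule AE_mp, intro AE_I2 impI)
    fix x assume *: "\<forall>l j. j \<noteq> l \<longrightarrow> x \<notin> face l \<inter> face j"
    show "indicator faces x = (\<Sum>l\<in>UNIV. indicator (face l) x :: real)"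
    proof (cases "x \<in> faces")
      case True
      then obtain l where l: "x \<in> face l" by (auto simp: faces_def)
      then have "(\<Sum>l\<in>UNIV. indicator (face l) x :: real) = (\<Sum>i\<in>{l}. indicator (face i) x)"
        using * by (intro sum.mono_neutral_right) auto
      then show ?thesis using True l by simp
    next
      case False
      then show ?thesis by (simp add: faces_def)
    qed
  qed
qed

text \<open>
  The faces overlap in null sets only, so their contributions add up.
\<close>

lemma integral_faces:
  fixes G :: "'a \<Rightarrow> complex"
  assumes G: "integrable M G"
  shows "(\<integral>x. G x \<partial>M) = (\<integral>x. indicator (space M - faces) x *\<^sub>R G x \<partial>M) + (\<Sum>l\<in>UNIV. \<integral>x. indicator (face l) x *\<^sub>R G x \<partial>M)"
proof -
  have [measurable]: "G \<in> borel_measurable M" using G by auto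
  have int: "integrable M (\<lambda>x. indicator A x *\<^sub>R G x)" if "A \<in> sets M" for A
    by (rule integrable_mult_indicator[OF that G])
  have "(\<integral>x. G x \<partial>M) = (\<integral>x. indicator (space M - faces) x *\<^sub>R G x + indicator faces x *\<^sub>R G x \<partial>M)"
    by (intro Bochner_Integration.integral_cong) (auto simp: indicator_def)
  also have "\<dots> = (\<integral>x. indicator (space M - faces) x *\<^sub>R G x \<partial>M) + (\<integral>x. indicator faces x *\<^sub>R G x \<partial>M)"
    by (intro Bochner_Integration.integral_add int) auto
  also have "(\<integral>x. indicator faces x *\<^sub>R G x \<partial>M) = (\<integral>x. (\<Sum>l\<in>UNIV. indicator (face l) x *\<^sub>R G x) \<partial>M)"
  proof (rule integral_cong_AE)
    show "AE x in M. indicator faces x *\<^sub>R G x = (\<Sum>l\<in>UNIV. indicator (face l) x *\<^sub>R G x)"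
      using AE_indicator_faces by eventually_elim (simp add: scaleR_sum_left)
  qed measurable
  also have "\<dots> = (\<Sum>l\<in>UNIV. \<integral>x. indicator (face l) x *\<^sub>R G x \<partial>M)"
    by (intro Bochner_Integration.integral_sum int) auto
  finally show ?thesis .
qed

text \<open>
  A mixed vector keeps a nonzero index when one coordinate is taken out, so the faces contribute nothing to
  the vanishing moment.
\<close>

lemma mixed_moment_off_faces_eq_0:
  assumes \<rho>: "\<rho> \<in> mixed_indices" and \<zeta>: "\<And>j. norm (\<zeta> j) < 1"
  shows "(\<integral>x. indicator (space M - faces) x *\<^sub>R (\<Prod>j\<in>UNIV. disc_factor (\<rho> $ j) (\<zeta> j) (w j x)) \<partial>M) = 0"
proof -
  have "(\<integral>x. indicator (face l) x *\<^sub>R (\<Prod>j\<in>UNIV. disc_factor (\<rho> $ j) (\<zeta> j) (w j x)) \<partial>M) = 0" for l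
  proof -
    have "(\<integral>x. indicator (face l) x *\<^sub>R (\<Prod>j\<in>UNIV. disc_factor (\<rho> $ j) (\<zeta> j) (w j x)) \<partial>M)
      = (\<integral>x. disc_factor (\<rho> $ l) (\<zeta> l) 1 * (indicator (face l) x *\<^sub>R (\<Prod>j\<in>UNIV - {l}. disc_factor (\<rho> $ j) (\<zeta> j) (w j x))) \<partial>M)"
      by (intro Bochner_Integration.integral_cong refl)
         (auto simp: indicator_def face_def prod.remove[of UNIV l])
    also have "\<dots> = 0"
    proof -
      obtain a b where ab: "\<rho> $ a = -1" "\<rho> $ b = 1" and *: "\<And>j. \<rho> $ j \<in> {-1,0,1}"
        using \<rho> unfolding mixed_indices_def by blast
      have "\<exists>j. j \<noteq> l \<and> \<rho> $ j \<noteq> 0"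
      proof (cases "a = l")
        case True
        then show ?thesis using ab by (intro exI[of _ b]) auto
      qed (use ab in \<open>auto intro!: exI[of _ a]\<close>)
      then obtain j where "j \<noteq> l" "\<rho> $ j \<noteq> 0" by blast
      from face_moment_eq_0[where \<zeta> = \<zeta>, OF * this \<zeta>] show ?thesis
        by (simp only: integral_mult_right_zero mult_zero_right)
    qed
    finally show ?thesis .
  qed
  then show ?thesis
    using integral_faces[OF integrable_prod_disc_factor[where \<zeta> = \<zeta> and \<rho> = "vec_nth \<rho>" and J = UNIV, OF \<zeta>]] mixed_moment_eq_0[OF \<rho> \<zeta>] by simp
qed

text \<open>
  Expanding the product over subsets, all terms but the constant one are moments that vanish on the face.
\<close>

lemma face_cauchy_integral:
  assumes \<zeta>: "\<And>j. norm (\<zeta> j) < 1"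
  shows "(\<integral>x. indicator (face l) x *\<^sub>R (\<Prod>j\<in>UNIV - {l}. 1 + cauchy_tail (\<zeta> j) (w j x)) \<partial>M) = of_real (measure M (face l))"
proof -
  have int: "integrable M (\<lambda>x. indicator (face l) x *\<^sub>R (\<Prod>i\<in>X. cauchy_tail (\<zeta> i) (w i x)))" for X
    using integrable_mult_indicator[OF face_measurable integrable_prod_disc_factor[OF \<zeta>, of "\<lambda>_. -1"]] by simp
  have "(\<integral>x. indicator (face l) x *\<^sub>R (\<Prod>j\<in>UNIV - {l}. 1 + cauchy_tail (\<zeta> j) (w j x)) \<partial>M)
    = (\<integral>x. (\<Sum>X\<in>Pow (UNIV - {l}). indicator (face l) x *\<^sub>R (\<Prod>i\<in>X. cauchy_tail (\<zeta> i) (w i x))) \<partial>M)"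
    by (subst add.commute) (simp add: prod_add scaleR_sum_right)
  also have "\<dots> = (\<Sum>X\<in>Pow (UNIV - {l}). \<integral>x. indicator (face l) x *\<^sub>R (\<Prod>i\<in>X. cauchy_tail (\<zeta> i) (w i x)) \<partial>M)"
    by (intro Bochner_Integration.integral_sum int)
  also have "\<dots> = (\<Sum>X\<in>{{}}. \<integral>x. indicator (face l) x *\<^sub>R (\<Prod>i\<in>X. cauchy_tail (\<zeta> i) (w i x)) \<partial>M)"
    by (intro sum.mono_neutral_right) (auto intro!: face_moment_subset_eq_0 \<zeta>)
  also have "\<dots> = of_real (measure M (face l))" by (simp add: scaleR_conv_of_real)
  finally show ?thesis .
qed

text \<open>
  On the face of \<open>l\<close> the factor of the coordinate \<open>l\<close> is the constant \<open>1 / (1 - \<zeta>\<^sub>l)\<close>, and the rest of the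
  product integrates to the mass of the face.
\<close>

lemma integral_herglotz_kernel_faces:
  assumes \<zeta>: "\<And>j. norm (\<zeta> j) < 1"
  shows "(\<integral>x. herglotz_kernel \<zeta> (\<lambda>l. w l x) \<partial>M) =
     (\<integral>x. indicator (space M - faces) x *\<^sub>R herglotz_kernel \<zeta> (\<lambda>l. w l x) \<partial>M)
     + (\<Sum>l\<in>UNIV. of_real (measure M (face l)) * ((1 + \<zeta> l) / (1 - \<zeta> l)))"
proof -
  have "(\<integral>x. indicator (face l) x *\<^sub>R herglotz_kernel \<zeta> (\<lambda>l. w l x) \<partial>M) = of_real (measure M (face l)) * ((1 + \<zeta> l) / (1 - \<zeta> l))" for l
  proof -
    have int: "integrable M (\<lambda>x. indicator (face l) x *\<^sub>R (\<Prod>j\<in>UNIV - {l}. 1 + cauchy_tail (\<zeta> j) (w j x)))"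
      by (rule integrable_mult_indicator[OF face_measurable integrable_prod_cauchy[OF \<zeta>]])
    have int1: "integrable M (\<lambda>x. indicator (face l) x *\<^sub>R (1::complex))"
      by (rule integrable_mult_indicator) auto
    have nz: "1 - \<zeta> l \<noteq> 0" using \<zeta>[of l] by auto
    have "(\<integral>x. indicator (face l) x *\<^sub>R herglotz_kernel \<zeta> (\<lambda>l. w l x) \<partial>M) =
      (\<integral>x. 2 * (1 + cauchy_tail (\<zeta> l) 1) * (indicator (face l) x *\<^sub>R (\<Prod>j\<in>UNIV - {l}. 1 + cauchy_tail (\<zeta> j) (w j x)))
         - indicator (face l) x *\<^sub>R 1 \<partial>M)"
      by (intro Bochner_Integration.integral_cong refl)
         (auto simp: indicator_def face_def herglotz_kernel_def prod.remove[of UNIV l])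
    also have "\<dots> = 2 * (1 + cauchy_tail (\<zeta> l) 1) * of_real (measure M (face l)) - of_real (measure M (face l))"
      using int int1 face_cauchy_integral[where \<zeta> = \<zeta> and l = l, OF \<zeta>]
      by (subst Bochner_Integration.integral_diff)
         (auto simp only: integral_mult_right_zero integrable_mult_right scaleR_conv_of_real, auto)
    also have "\<dots> = of_real (measure M (face l)) * ((1 + \<zeta> l) / (1 - \<zeta> l))"
      using nz by (simp add: cauchy_tail_def field_simps)
    finally show ?thesis .
  qed
  then show ?thesis using integral_faces[OF integrable_herglotz_kernel[OF \<zeta>]] by simp
qed

end

section \<open>Existence of the representation\<close>

context mixed_free_torus_measure
begin

definition real_point :: "'a \<Rightarrow> real ^ 'b" where
  "real_point x = (\<chi> l. Re (inv_cayley (w l x)))"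

text \<open>
  The measure off the faces, carried back to \<open>\<real>\<^sup>n\<close>. The division by the weight reverses \<open>normalized_measure\<close>,
  and the power of \<open>\<pi>\<close> cancels the constant in front of the integral of \<open>K\<^sub>n\<close>.
\<close>

definition line_measure :: "(real ^ 'b) measure" where
  "line_measure = distr (density M (\<lambda>x. ennreal (indicator (space M - faces) x * pi ^ CARD('b) / weight (real_point x)))) borel real_point"

lemma real_point_measurable [measurable]: "real_point \<in> borel_measurable M"
proof -
  have "(\<lambda>x l. Re (inv_cayley (w l x))) \<in> measurable M (PiM UNIV (\<lambda>_::'b. borel :: real measure))"
    by (rule measurable_PiM_single') (auto simp: inv_cayley_def)
  then have "(\<lambda>x l. Re (inv_cayley (w l x))) \<in> borel_measurable M"
    by (simp add: measurable_cong_sets[OF refl sets_PiM_equal_borel])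
  moreover have "(vec_lambda :: ('b \<Rightarrow> real) \<Rightarrow> real ^ 'b) \<in> borel_measurable borel"
    by (intro borel_measurable_continuous_onI) (auto intro!: continuous_on_vec_lambda[of UNIV "\<lambda>i f. f i"])
  ultimately show ?thesis unfolding real_point_def by (rule measurable_compose)
qed

lemma line_to_circle_real_point:
  assumes "x \<in> space M - faces"
  shows "line_to_circle l (real_point x) = w l x"
proof -
  have "w l x \<noteq> 1" "norm (w l x) = 1" using assms norm_w by (auto simp: faces_def face_def)
  then show ?thesis
    using inv_cayley_unit_circle cayley_inv_cayley by (metis line_to_circle_def real_point_def vec_lambda_beta)
qed

lemma sets_line_measure: "sets line_measure = sets borel"
  by (simp add: line_measure_def)

lemma growth_condition_line_measure: "growth_condition line_measure"
proof -
  have "(\<integral>\<^sup>+t. ennreal (weight t) \<partial>line_measure)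
    = (\<integral>\<^sup>+x. ennreal (indicator (space M - faces) x * pi ^ CARD('b) / weight (real_point x)) * ennreal (weight (real_point x)) \<partial>M)"
    unfolding line_measure_def by (simp add: nn_integral_distr nn_integral_density)
  also have "\<dots> \<le> (\<integral>\<^sup>+x. ennreal (pi ^ CARD('b)) \<partial>M)"
  proof (rule nn_integral_mono)
    fix x
    have "ennreal (indicator (space M - faces) x * pi ^ CARD('b) / weight (real_point x)) * ennreal (weight (real_point x))
      = ennreal (indicator (space M - faces) x * pi ^ CARD('b))"
      using weight_pos[of "real_point x"] by (subst ennreal_mult'[symmetric]) (auto simp: less_imp_le)
    also have "\<dots> \<le> ennreal (pi ^ CARD('b))" by (rule ennreal_leI) (simp add: indicator_def)
    finally show "ennreal (indicator (space M - faces) x * pi ^ CARD('b) / weight (real_point x)) * ennreal (weight (real_point x)) \<le> ennreal (pi ^ CARD('b))" .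
  qed
  also have "\<dots> < \<infinity>" by (simp add: emeasure_eq_measure ennreal_mult_less_top del: ennreal_power)
  finally show ?thesis by (simp add: growth_condition_def weight_def)
qed

lemma integral_normalized_line_measure:
  fixes G :: "real ^ 'b \<Rightarrow> complex"
  assumes [measurable]: "G \<in> borel_measurable borel"
  shows "(\<integral>t. G t \<partial>normalized_measure line_measure) = pi ^ CARD('b) * (\<integral>x. indicator (space M - faces) x *\<^sub>R G (real_point x) \<partial>M)"
proof -
  have "(\<integral>t. G t \<partial>normalized_measure line_measure) = (\<integral>t. of_real (weight t) * G t \<partial>line_measure)"
    by (rule integral_normalized_measure[OF sets_line_measure, symmetric]) measurable
  also have "\<dots> = (\<integral>x. (indicator (space M - faces) x * pi ^ CARD('b) / weight (real_point x)) *\<^sub>R (of_real (weight (real_point x)) * G (real_point x)) \<partial>M)"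
    unfolding line_measure_def by (subst integral_distr, simp, simp, subst integral_density) (auto simp: less_imp_le[OF weight_pos])
  also have "\<dots> = (\<integral>x. of_real (pi ^ CARD('b)) * (indicator (space M - faces) x *\<^sub>R G (real_point x)) \<partial>M)"
    using less_imp_neq[OF weight_pos] by (intro Bochner_Integration.integral_cong refl) (auto simp: scaleR_conv_of_real)
  finally show ?thesis by (simp only: integral_mult_right_zero of_real_power)
qed

lemma represents_line_measure:
  fixes q :: "complex ^ 'b \<Rightarrow> complex"
  assumes q: "\<And>z. z \<in> poly_upper_half_plane \<Longrightarrow>
      q z = of_real a + \<i> * (\<integral>x. herglotz_kernel (\<lambda>l. cayley (z $ l)) (\<lambda>l. w l x) \<partial>M)"
  shows "represents q a (\<chi> l. measure M (face l)) line_measure"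
  unfolding represents_def
proof (intro conjI ballI allI)
  show "0 \<le> (\<chi> l. measure M (face l)) $ l" for l by simp
  show "sets line_measure = sets borel" by (rule sets_line_measure)
  show "growth_condition line_measure" by (rule growth_condition_line_measure)
  show "nevanlinna_condition line_measure"
    unfolding nevanlinna_condition_iff[OF sets_line_measure]
  proof (intro ballI sum.neutral)
    fix z :: "complex ^ 'b" and \<rho> :: "int ^ 'b"
    assume z: "z \<in> poly_upper_half_plane" and \<rho>: "\<rho> \<in> mixed_indices"
    have "(\<integral>x. indicator (space M - faces) x *\<^sub>R (\<Prod>j\<in>UNIV. disc_factor (\<rho> $ j) (cayley (z $ j)) (line_to_circle j (real_point x))) \<partial>M)
      = (\<integral>x. indicator (space M - faces) x *\<^sub>R (\<Prod>j\<in>UNIV. disc_factor (\<rho> $ j) (cayley (z $ j)) (w j x)) \<partial>M)"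
      by (intro Bochner_Integration.integral_cong refl) (auto simp: indicator_def line_to_circle_real_point)
    also have "\<dots> = 0"
      using z by (intro mixed_moment_off_faces_eq_0[where \<zeta> = "\<lambda>j. cayley (z $ j)"] \<rho> cayley_poly_upper_half_plane)
    finally show "(\<integral>t. (\<Prod>j\<in>UNIV. disc_factor (\<rho> $ j) (cayley (z $ j)) (line_to_circle j t)) \<partial>normalized_measure line_measure) = 0"
      by (subst integral_normalized_line_measure) simp_all
  qed
  fix z :: "complex ^ 'b" assume z: "z \<in> poly_upper_half_plane"
  define \<zeta> where "\<zeta> l = cayley (z $ l)" for l
  have \<zeta>: "norm (\<zeta> l) < 1" for l unfolding \<zeta>_def using z by (rule cayley_poly_upper_half_plane)
  have "(\<integral>x. indicator (space M - faces) x *\<^sub>R herglotz_kernel \<zeta> (\<lambda>l. line_to_circle l (real_point x)) \<partial>M)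
    = (\<integral>x. indicator (space M - faces) x *\<^sub>R herglotz_kernel \<zeta> (\<lambda>l. w l x) \<partial>M)"
    by (intro Bochner_Integration.integral_cong refl) (auto simp: indicator_def line_to_circle_real_point)
  then have K: "(\<integral>t. kernel_K z t \<partial>line_measure) = \<i> * (of_real pi ^ CARD('b) * (\<integral>x. indicator (space M - faces) x *\<^sub>R herglotz_kernel \<zeta> (\<lambda>l. w l x) \<partial>M))"
    unfolding integral_kernel_K[OF sets_line_measure z] \<zeta>_def[symmetric] by (subst integral_normalized_line_measure) simp_all
  have i: "\<i> * ((1 + \<zeta> l) / (1 - \<zeta> l)) = z $ l" for l
  proof -
    have "z $ l + \<i> \<noteq> 0" using z upper_half_planeD(1) by (simp add: poly_upper_half_plane_def)
    from inv_cayley_cayley[OF this] show ?thesis by (simp add: inv_cayley_def \<zeta>_def)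
  qed
  have "\<i> * (of_real (measure M (face l)) * ((1 + \<zeta> l) / (1 - \<zeta> l))) = of_real (measure M (face l)) * z $ l" for l
    unfolding i[symmetric, of l] by (simp only: mult.left_commute)
  then have "\<i> * (\<Sum>l\<in>UNIV. of_real (measure M (face l)) * ((1 + \<zeta> l) / (1 - \<zeta> l))) = (\<Sum>l\<in>UNIV. of_real (measure M (face l)) * z $ l)"
    by (simp only: sum_distrib_left)
  then show "q z = of_real a + (\<Sum>l\<in>UNIV. of_real ((\<chi> l. measure M (face l)) $ l) * z $ l) + 1 / of_real pi ^ CARD('b) * (\<integral>t. kernel_K z t \<partial>line_measure)"
    unfolding q[OF z] K \<zeta>_def[symmetric] integral_herglotz_kernel_faces[where \<zeta> = \<zeta>, OF \<zeta>] by (simp add: distrib_left)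
qed

end

lemma compact_closed_polydisc: "compact (closed_polydisc :: ('n::finite \<Rightarrow> complex) set)"
proof -
  have "compactin (product_topology (\<lambda>_::'n. euclidean) UNIV) (PiE UNIV (\<lambda>_. cball (0::complex) 1))"
    by (subst compactin_PiE) auto
  moreover have "PiE UNIV (\<lambda>_. cball 0 1) = (closed_polydisc :: ('n \<Rightarrow> complex) set)"
    by (auto simp: closed_polydisc_def PiE_def Pi_def)
  ultimately show ?thesis by (simp add: euclidean_product_topology)
qed

lemma bounded_linear_axis: "bounded_linear (axis l :: complex \<Rightarrow> complex ^ 'n)"
proof -
  have "linear (axis l :: complex \<Rightarrow> complex ^ 'n)"
    by (rule linearI) (auto simp: axis_def vec_eq_iff)
  then show ?thesis by (simp add: linear_conv_bounded_linear)
qed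

lemma holomorphic_several_on_imp_continuous_on: "holomorphic_several_on f S \<Longrightarrow> continuous_on S f"
  unfolding holomorphic_several_on_def
  by (meson continuous_at_imp_continuous_on has_derivative_continuous)

text \<open>
  The restriction to a line parallel to a coordinate axis is holomorphic by the chain rule.
\<close>

lemma holomorphic_several_on_coordinate:
  fixes f :: "complex ^ 'n \<Rightarrow> complex"
  assumes f: "holomorphic_several_on f S" and g: "g holomorphic_on A" and A: "open A"
    and S: "\<And>u. u \<in> A \<Longrightarrow> c + axis l (g u) \<in> S"
  shows "(\<lambda>u. f (c + axis l (g u))) holomorphic_on A"
  unfolding holomorphic_on_open[OF A]
proof
  fix u assume u: "u \<in> A"
  obtain g' where g': "(g has_field_derivative g') (at u)" using g A u by (auto simp: holomorphic_on_open)
  obtain D :: "complex ^ 'n" where D: "(f has_derivative (\<lambda>h. \<Sum>j\<in>UNIV. D $ j * h $ j)) (at (c + axis l (g u)))"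
    using f S[OF u] by (auto simp: holomorphic_several_on_def)
  have "((\<lambda>u. c + axis l (g u)) has_derivative (\<lambda>h. 0 + axis l (g' * h))) (at u)"
    by (intro has_derivative_add has_derivative_const bounded_linear.has_derivative[OF bounded_linear_axis] g'[unfolded has_field_derivative_def])
  from has_derivative_compose[OF this D]
  have "((\<lambda>u. f (c + axis l (g u))) has_derivative (\<lambda>h. \<Sum>j\<in>UNIV. D $ j * (0 + axis l (g' * h)) $ j)) (at u)" .
  also have "(\<lambda>h. \<Sum>j\<in>UNIV. D $ j * (0 + axis l (g' * h)) $ j) = (*) (D $ l * g')"
    by (auto simp: axis_def if_distrib cong: if_cong)
  finally show "\<exists>f'. ((\<lambda>u. f (c + axis l (g u))) has_field_derivative f') (at u)"
    by (auto simp: has_field_derivative_def)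
qed

context
  fixes q :: "complex ^ 'n \<Rightarrow> complex"
  assumes q: "herglotz_nevanlinna q"
begin

text \<open>
  The factor \<open>- \<i>\<close> turns the condition on the imaginary part into one on the real part.
\<close>

definition disc_transform :: "('n \<Rightarrow> complex) \<Rightarrow> complex" where
  "disc_transform \<zeta> = - \<i> * q (\<chi> l. inv_cayley (\<zeta> l))"

lemma inv_cayley_vec: "(\<And>l. norm (\<zeta> l) < 1) \<Longrightarrow> (\<chi> l. inv_cayley (\<zeta> l)) \<in> (poly_upper_half_plane :: (complex ^ 'n) set)"
  by (simp add: poly_upper_half_plane_def inv_cayley_upper_half_plane)

lemma Re_disc_transform_nonneg: "(\<And>l. norm (\<zeta> l) < 1) \<Longrightarrow> 0 \<le> Re (disc_transform \<zeta>)"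
  using q inv_cayley_vec unfolding disc_transform_def herglotz_nevanlinna_def by simp

lemma holomorphic_q: "holomorphic_several_on q poly_upper_half_plane"
  using q by (simp add: herglotz_nevanlinna_def)

lemma continuous_on_disc_transform:
  fixes g :: "'b::topological_space \<Rightarrow> 'n \<Rightarrow> complex"
  assumes g: "\<And>l. continuous_on A (\<lambda>x. g x l)" and lt: "\<And>x l. x \<in> A \<Longrightarrow> norm (g x l) < 1"
  shows "continuous_on A (\<lambda>x. disc_transform (g x))"
proof -
  have "1 - g x l \<noteq> 0" if "x \<in> A" for x l using lt[OF that, of l] by auto
  then have c: "continuous_on A (\<lambda>x. \<chi> l. inv_cayley (g x l))"
    unfolding inv_cayley_def by (intro continuous_intros g) auto
  have "continuous_on A (\<lambda>x. q (\<chi> l. inv_cayley (g x l)))"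
    by (rule continuous_on_compose2[OF holomorphic_several_on_imp_continuous_on[OF holomorphic_q] c]) (auto intro: inv_cayley_vec lt)
  then show ?thesis unfolding disc_transform_def by (intro continuous_intros)
qed

text \<open>
  The dilation by \<open>r\<close> makes the function holomorphic across the torus; it is cut off outside the closed
  polydisc so that it is Borel measurable on the whole space.
\<close>

definition dilated :: "complex \<Rightarrow> ('n \<Rightarrow> complex) \<Rightarrow> complex" where
  "dilated r \<xi> = indicator closed_polydisc \<xi> *\<^sub>R disc_transform (\<lambda>l. r * \<xi> l)"

lemma dilated_eq: "\<xi> \<in> closed_polydisc \<Longrightarrow> dilated r \<xi> = disc_transform (\<lambda>l. r * \<xi> l)"
  by (simp add: dilated_def)

lemma polydisc_algebra_dilated:
  assumes r: "norm r < 1"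
  shows "polydisc_algebra (dilated r)"
  unfolding polydisc_algebra_def
proof (intro conjI ballI allI)
  have lt: "norm (r * \<xi> l) < 1" if "\<xi> \<in> closed_polydisc" for \<xi> :: "'n \<Rightarrow> complex" and l
  proof -
    have "norm (r * \<xi> l) \<le> norm r * 1"
      unfolding norm_mult using that by (intro mult_left_mono) (auto simp: closed_polydisc_def)
    then show ?thesis using r by simp
  qed
  have cont: "continuous_on closed_polydisc (\<lambda>\<xi> :: 'n \<Rightarrow> complex. disc_transform (\<lambda>l. r * \<xi> l))"
    by (intro continuous_on_disc_transform continuous_intros continuous_on_subset[OF continuous_on_product_coordinates] lt) auto
  have "closed_polydisc \<in> sets (borel :: ('n \<Rightarrow> complex) measure)"
    by (intro borel_closed compact_imp_closed compact_closed_polydisc)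
  then show "dilated r \<in> borel_measurable borel"
    unfolding dilated_def[abs_def] using cont by (rule borel_measurable_continuous_on_indicator)
  have "bounded ((\<lambda>\<xi> :: 'n \<Rightarrow> complex. disc_transform (\<lambda>l. r * \<xi> l)) ` closed_polydisc)"
    by (intro compact_imp_bounded compact_continuous_image cont compact_closed_polydisc)
  then show "\<exists>B. \<forall>\<xi>\<in>closed_polydisc. norm (dilated r \<xi>) \<le> B"
    by (auto simp: bounded_iff dilated_eq)
  fix \<xi> :: "'n \<Rightarrow> complex" and l assume \<xi>: "\<xi> \<in> closed_polydisc"
  then have upd: "\<xi>(l := u) \<in> closed_polydisc" if "norm u \<le> 1" for u
    using that by (auto simp: closed_polydisc_def)
  have eq: "dilated r (\<xi>(l := u)) = disc_transform (\<lambda>j. r * (\<xi>(l := u)) j)" if "norm u \<le> 1" for u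
    by (rule dilated_eq[OF upd[OF that]])
  have "continuous_on (cball 0 1) (\<lambda>u. disc_transform (\<lambda>j. r * (\<xi>(l := u)) j))"
  proof (rule continuous_on_disc_transform)
    show "continuous_on (cball 0 1) (\<lambda>u. r * (\<xi>(l := u)) j)" for j
      by (cases "j = l") (auto intro!: continuous_intros)
  qed (use lt[OF upd] in auto)
  then show "continuous_on (cball 0 1) (\<lambda>u. dilated r (\<xi>(l := u)))"
    by (rule continuous_on_eq) (rule eq[symmetric], simp)
  define c where "c = (\<chi> j. if j = l then 0 else inv_cayley (r * \<xi> j))"
  have vec: "(\<chi> j. inv_cayley (r * (\<xi>(l := u)) j)) = c + axis l (inv_cayley (r * u))" for u
    by (auto simp: c_def axis_def vec_eq_iff)
  have "(\<lambda>u. q (c + axis l (inv_cayley (r * u)))) holomorphic_on ball 0 1"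
  proof (rule holomorphic_several_on_coordinate[OF holomorphic_q])
    have "1 - r * u \<noteq> 0" if "u \<in> ball 0 1" for u
      using lt[OF upd[of u], of l] that by auto
    then show "(\<lambda>u. inv_cayley (r * u)) holomorphic_on ball 0 1"
      unfolding inv_cayley_def by (intro holomorphic_intros) auto
    show "c + axis l (inv_cayley (r * u)) \<in> poly_upper_half_plane" if "u \<in> ball 0 1" for u
      unfolding vec[symmetric] using that by (intro inv_cayley_vec lt upd) auto
  qed auto
  then have "(\<lambda>u. - \<i> * q (c + axis l (inv_cayley (r * u)))) holomorphic_on ball 0 1"
    by (intro holomorphic_intros)
  then show "(\<lambda>u. dilated r (\<xi>(l := u))) holomorphic_on ball 0 1"
    by (rule holomorphic_transform) (simp only: eq disc_transform_def vec mem_ball_0 less_imp_le)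
qed

lemma herglotz_nevanlinna_imp_represents: "\<exists>a b \<mu>. represents q a b \<mu>"
proof -
  define h where "h k = dilated (radius_seq k)" for k
  have h: "polydisc_algebra (h k)" for k
    unfolding h_def by (rule polydisc_algebra_dilated[OF norm_radius_seq_lt_1])
  define d where "d k x = Re (h k (\<lambda>l. circle_point (x l)))" for k and x :: "'n \<Rightarrow> real"
  have in_disc: "(\<lambda>l. circle_point (x l)) \<in> closed_polydisc" for x :: "'n \<Rightarrow> real"
    by (simp add: closed_polydisc_def)
  have pos: "0 \<le> d k x" for k x
    unfolding d_def h_def dilated_eq[OF in_disc]
    by (rule Re_disc_transform_nonneg) (simp add: norm_mult norm_radius_seq_lt_1)
  have h_disc: "h k \<zeta> = disc_transform (\<lambda>l. radius_seq k * \<zeta> l)" if "\<And>l. norm (\<zeta> l) < 1" for k \<zeta>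
    unfolding h_def using that by (intro dilated_eq) (auto simp: closed_polydisc_def intro: less_imp_le)
  define f0 where "f0 = disc_transform (\<lambda>_. 0)"
  have h0: "h k (\<lambda>_. 0) = f0" for k by (simp add: h_disc f0_def)
  have int: "integrable (torus_angles UNIV) (d k)" for k
  proof -
    have "integrable (torus_angles UNIV) (\<lambda>x. 1 * h k (\<lambda>l. circle_point (x l)))"
      by (rule integrable_torus_polydisc_algebra[OF h, where B = 1]) auto
    from integrable_Re[OF this] show ?thesis by (simp add: d_def[abs_def])
  qed
  \<comment> \<open>At the origin the Herglotz kernel is 1, so the representation formula computes the total mass.\<close>
  have mass: "(\<integral>x. d k x \<partial>torus_angles UNIV) = Re f0" for k
  proof -
    have "complex_of_real (\<integral>x. d k x \<partial>torus_angles UNIV)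
      = (\<integral>x. herglotz_kernel (\<lambda>_. 0) (\<lambda>l. circle_point (x l)) * of_real (d k x) \<partial>torus_angles UNIV)"
      by (simp add: herglotz_kernel_def cauchy_tail_def)
    also have "\<dots> = f0 - \<i> * of_real (Im f0)"
      unfolding d_def by (subst herglotz_integral_Re[OF h]) (simp_all add: h0)
    finally show ?thesis by (simp add: complex_eq_iff)
  qed
  obtain M :: "real measure" and r where M: "finite_measure M" "sets M = sets borel" and r: "strict_mono r"
    and lim: "\<And>B :: ('n \<Rightarrow> complex) \<Rightarrow> complex. continuous_on {\<xi>. \<forall>l. norm (\<xi> l) = 1} B \<Longrightarrow> bounded (B ` {\<xi>. \<forall>l. norm (\<xi> l) = 1}) \<Longrightarrow>
       (\<lambda>k. \<integral>x. B (\<lambda>l. circle_point (x l)) * of_real (d (r k) x) \<partial>torus_angles UNIV) \<longlonglongrightarrow> (\<integral>x. B (\<lambda>l. torus_curve l x) \<partial>M)"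
    using torus_measures_weakly_compact[where d = d and c = "Re f0", OF int pos mass] by blast
  have tail_cont: "continuous_on {\<xi>. \<forall>l. norm (\<xi> l) = 1} (\<lambda>\<xi>. cauchy_tail \<zeta> (\<xi> l))" if "norm \<zeta> < 1" for \<zeta> and l :: 'n
    unfolding cauchy_tail_def using that
    by (intro continuous_intros continuous_on_subset[OF continuous_on_product_coordinates]) auto
  interpret torus_measure M "torus_curve :: 'n \<Rightarrow> real \<Rightarrow> complex"
  proof (intro torus_measure.intro torus_measure_axioms.intro M)
    show "torus_curve l \<in> borel_measurable M" for l :: 'n
      unfolding measurable_cong_sets[OF M(2) refl] by (rule borel_measurable_continuous_onI[OF continuous_torus_curve])
  qed (rule norm_torus_curve)
  interpret mixed_free_torus_measure M "torus_curve :: 'n \<Rightarrow> real \<Rightarrow> complex"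
  proof
    fix \<rho> :: "int ^ 'n" and \<zeta> :: "'n \<Rightarrow> complex" assume \<rho>: "\<rho> \<in> mixed_indices" and \<zeta>: "\<And>j. norm (\<zeta> j) < 1"
    have "(\<lambda>k. \<integral>x. (\<Prod>l\<in>UNIV. disc_factor (\<rho> $ l) (\<zeta> l) (circle_point (x l))) * of_real (d (r k) x) \<partial>torus_angles UNIV)
       \<longlonglongrightarrow> (\<integral>x. (\<Prod>l\<in>UNIV. disc_factor (\<rho> $ l) (\<zeta> l) (torus_curve l x)) \<partial>M)"
    proof (rule lim)
      have "continuous_on {\<xi>. \<forall>l. norm (\<xi> l) = 1} (\<lambda>\<xi>. disc_factor s (\<zeta> l) (\<xi> l))" for s l
        unfolding disc_factor_def using tail_cont[OF \<zeta>]
        by (cases "s = -1"; cases "s = 0") (auto intro!: continuous_intros)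
      then show "continuous_on {\<xi>. \<forall>l. norm (\<xi> l) = 1} (\<lambda>\<xi>. \<Prod>l\<in>UNIV. disc_factor (\<rho> $ l) (\<zeta> l) (\<xi> l))"
        by (intro continuous_on_prod)
      have "norm (\<Prod>l\<in>UNIV. disc_factor (\<rho> $ l) (\<zeta> l) (\<xi> l)) \<le> (\<Prod>l\<in>UNIV. 1 / (1 - norm (\<zeta> l)))" if "\<And>l. norm (\<xi> l) = 1" for \<xi>
        unfolding prod_norm[symmetric] using \<zeta> that by (intro prod_mono) (auto intro!: norm_disc_factor_le)
      then show "bounded ((\<lambda>\<xi>. \<Prod>l\<in>UNIV. disc_factor (\<rho> $ l) (\<zeta> l) (\<xi> l)) ` {\<xi>. \<forall>l. norm (\<xi> l) = 1})"
        unfolding bounded_iff by blast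
    qed
    moreover have "(\<integral>x. (\<Prod>l\<in>UNIV. disc_factor (\<rho> $ l) (\<zeta> l) (circle_point (x l))) * of_real (d (r k) x) \<partial>torus_angles UNIV) = 0" for k
      unfolding d_def by (rule mixed_moment_Re_eq_0[OF h \<zeta> \<rho>])
    ultimately show "(\<integral>x. (\<Prod>j\<in>UNIV. disc_factor (\<rho> $ j) (\<zeta> j) (torus_curve j x)) \<partial>M) = 0"
      using LIMSEQ_unique[OF tendsto_const] by fastforce
  qed
  have disc: "disc_transform \<zeta> = \<i> * of_real (Im f0) + (\<integral>x. herglotz_kernel \<zeta> (\<lambda>l. torus_curve l x) \<partial>M)"
    if \<zeta>: "\<And>l. norm (\<zeta> l) < 1" for \<zeta>
  proof -
    have "(\<lambda>k. \<integral>x. herglotz_kernel \<zeta> (\<lambda>l. circle_point (x l)) * of_real (d (r k) x) \<partial>torus_angles UNIV)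
       \<longlonglongrightarrow> (\<integral>x. herglotz_kernel \<zeta> (\<lambda>l. torus_curve l x) \<partial>M)"
    proof (rule lim)
      show "continuous_on {\<xi>. \<forall>l. norm (\<xi> l) = 1} (herglotz_kernel \<zeta>)"
        unfolding herglotz_kernel_def[abs_def] by (intro continuous_intros tail_cont \<zeta>)
      have "norm (herglotz_kernel \<zeta> \<xi>) \<le> 2 * (\<Prod>l\<in>UNIV. 1 / (1 - norm (\<zeta> l))) + 1" if "\<And>l. norm (\<xi> l) = 1" for \<xi>
      proof -
        have "norm (\<Prod>l\<in>UNIV. 1 + cauchy_tail (\<zeta> l) (\<xi> l)) \<le> (\<Prod>l\<in>UNIV. 1 / (1 - norm (\<zeta> l)))"
          unfolding prod_norm[symmetric] using \<zeta> that by (intro prod_mono) (auto intro!: norm_one_plus_cauchy_tail_le)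
        then show ?thesis
          unfolding herglotz_kernel_def by (intro order_trans[OF norm_triangle_ineq4]) (simp add: norm_mult)
      qed
      then show "bounded (herglotz_kernel \<zeta> ` {\<xi>. \<forall>l. norm (\<xi> l) = 1})"
        unfolding bounded_iff by blast
    qed
    moreover have "(\<integral>x. herglotz_kernel \<zeta> (\<lambda>l. circle_point (x l)) * of_real (d k x) \<partial>torus_angles UNIV) = h k \<zeta> - \<i> * of_real (Im f0)" for k
      unfolding d_def by (subst herglotz_integral_Re[OF h \<zeta>]) (simp_all add: h0)
    moreover have "(\<lambda>k. h (r k) \<zeta> - \<i> * of_real (Im f0)) \<longlonglongrightarrow> disc_transform \<zeta> - \<i> * of_real (Im f0)"
    proof (intro tendsto_diff tendsto_const)
      have cont: "continuous_on (cball 0 1) (\<lambda>u. disc_transform (\<lambda>l. u * \<zeta> l))"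
      proof (rule continuous_on_disc_transform)
        show "norm (u * \<zeta> l) < 1" if "u \<in> cball 0 1" for u l
        proof -
          have "norm (u * \<zeta> l) \<le> 1 * norm (\<zeta> l)" unfolding norm_mult using that by (intro mult_right_mono) auto
          then show ?thesis using \<zeta>[of l] by simp
        qed
      qed (intro continuous_intros)
      have "(\<lambda>k. disc_transform (\<lambda>l. radius_seq k * \<zeta> l)) \<longlonglongrightarrow> disc_transform (\<lambda>l. 1 * \<zeta> l)"
        by (intro continuous_on_tendsto_compose[OF cont radius_seq_tendsto]) (simp_all add: less_imp_le[OF norm_radius_seq_lt_1])
      from LIMSEQ_subseq_LIMSEQ[OF this r] show "(\<lambda>k. h (r k) \<zeta>) \<longlonglongrightarrow> disc_transform \<zeta>"
        by (simp add: h_disc[OF \<zeta>] comp_def)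
    qed
    ultimately have "(\<integral>x. herglotz_kernel \<zeta> (\<lambda>l. torus_curve l x) \<partial>M) = disc_transform \<zeta> - \<i> * of_real (Im f0)"
      using LIMSEQ_unique by simp
    then show ?thesis by simp
  qed
  have "represents q (- Im f0) (\<chi> l. measure M (face l)) line_measure"
  proof (rule represents_line_measure)
    fix z :: "complex ^ 'n" assume z: "z \<in> poly_upper_half_plane"
    then have "inv_cayley (cayley (z $ l)) = z $ l" for l
      using upper_half_planeD(1) by (intro inv_cayley_cayley) (simp add: poly_upper_half_plane_def)
    then have "q z = \<i> * disc_transform (\<lambda>l. cayley (z $ l))"
      by (simp add: disc_transform_def)
    also have "\<dots> = of_real (- Im f0) + \<i> * (\<integral>x. herglotz_kernel (\<lambda>l. cayley (z $ l)) (\<lambda>l. torus_curve l x) \<partial>M)"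
      by (subst disc) (simp_all add: cayley_poly_upper_half_plane[OF z] distrib_left mult.assoc[symmetric])
    finally show "q z = of_real (- Im f0) + \<i> * (\<integral>x. herglotz_kernel (\<lambda>l. cayley (z $ l)) (\<lambda>l. torus_curve l x) \<partial>M)" .
  qed
  then show ?thesis by blast
qed

end

theorem theorem4p1:
  fixes q :: "complex ^ 'n \<Rightarrow> complex"
  shows "(herglotz_nevanlinna q \<longleftrightarrow> (\<exists>a b \<mu>. represents q a b \<mu>)) \<and>
         (\<forall>a b \<mu> a' b' \<mu>'. represents q a b \<mu> \<longrightarrow> represents q a' b' \<mu>' \<longrightarrow>
            a = a' \<and> b = b' \<and> \<mu> = \<mu>')"
  using herglotz_nevanlinna_imp_represents represents_imp_herglotz_nevanlinna represents_unique by blast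

end
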